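(* Suppose that $s>\max\{n/2,3/4\}$. Let $\Omega\subset\mathbb{C}^d$ be open and let $\Phi:\Omega\to\mathbb{C}$ be a holomorphic function. If $u=(u_1,\dots,u_d)\in \mathcal{H}^s_{\mathrm{ul}}(\mathbb{R}^n)^d$ satisfies the condition $\overline{u(\mathbb{R}^n)}\subset\Omega$, then $$\Phi\circ u\equiv\Phi(u)\in\mathcal{H}^s_{\mathrm{ul}}(\mathbb{R}^n).$$
   Context: For $s\in\mathbb{R}$, $\mathcal{H}^s(\mathbb{R}^n)=\{u\in\mathcal{S}'(\mathbb{R}^n):(1-\Delta)^{s/2}u\in L^2(\mathbb{R}^n)\}$ with norm $\|u\|_{\mathcal{H}^s}=\|(1-\Delta)^{s/2}u\|_{L^2}$. For a distribution $\chi$ and $y\in\mathbb{R}^n$, $\tau_y\chi=\chi(\cdot-y)$. The uniformly local (Kato-)Sobolev space $\mathcal{H}^s_{\mathrm{ul}}(\mathbb{R}^n)$ is the set of distributions $u\in\mathcal{D}'(\mathbb{R}^n)$ for which there is $\chi\in\mathcal{C}_0^\infty(\mathbb{R}^n)\smallsetminus\{0\}$ such that $\sup_{y\in\mathbb{R}^n}\|u\,\tau_y\chi\|_{\mathcal{H}^s}<\infty$ (this does not depend on the choice of $\chi$). For $s>n/2$ the elements of $\mathcal{H}^s_{\mathrm{ul}}(\mathbb{R}^n)$ are (represented by) bounded continuous functions, so that $u(\mathbb{R}^n)\subset\mathbb{C}^d$ makes sense; the closure is taken in $\mathbb{C}^d$. *)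

theory Defs
  imports "HOL-Analysis.Analysis"
begin

section \<open>Smooth functions, test functions and Schwartz functions\<close>

definition partial :: "'n::finite \<Rightarrow> (real^'n \<Rightarrow> complex) \<Rightarrow> real^'n \<Rightarrow> complex" where
  "partial i f x = frechet_derivative f (at x) (axis i 1)"

text \<open>Multi-indices are lists of coordinate directions; the order of the derivative is the
  length of the list.\<close>

primrec partials :: "'n::finite list \<Rightarrow> (real^'n \<Rightarrow> complex) \<Rightarrow> real^'n \<Rightarrow> complex" where
  "partials [] f = f"
| "partials (i # is) f = partial i (partials is f)"

definition smooth :: "(real^'n::finite \<Rightarrow> complex) \<Rightarrow> bool" where
  "smooth f \<longleftrightarrow> (\<forall>is. partials is f differentiable_on UNIV)"

definition test_functions :: "(real^'n::finite \<Rightarrow> complex) set" where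
  "test_functions = {\<phi>. smooth \<phi> \<and> compact (closure {x. \<phi> x \<noteq> 0})}"

definition schwartz :: "(real^'n::finite \<Rightarrow> complex) set" where
  "schwartz = {\<phi>. smooth \<phi> \<and>
     (\<forall>k is. bdd_above (range (\<lambda>x. (1 + norm x) ^ k * norm (partials is \<phi> x))))}"

section \<open>Distributions\<close>

text \<open>A distribution is a functional on all functions, of which only the values on test functions
  (on Schwartz functions, in the tempered case) are constrained and ever used.\<close>

type_synonym 'n functional = "(real^'n \<Rightarrow> complex) \<Rightarrow> complex"

definition linear_functional_on :: "(real^'n::finite \<Rightarrow> complex) set \<Rightarrow> 'n functional \<Rightarrow> bool" where
  "linear_functional_on V u \<longleftrightarrow>
     (\<forall>\<phi>\<in>V. \<forall>\<psi>\<in>V. u (\<lambda>x. \<phi> x + \<psi> x) = u \<phi> + u \<psi>) \<and>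
     (\<forall>\<phi>\<in>V. \<forall>c. u (\<lambda>x. c * \<phi> x) = c * u \<phi>)"

definition distribution :: "'n::finite functional \<Rightarrow> bool" where
  "distribution u \<longleftrightarrow> linear_functional_on test_functions u \<and>
     (\<forall>K. compact K \<longrightarrow>
        (\<exists>C N. \<forall>\<phi>\<in>test_functions. {x. \<phi> x \<noteq> 0} \<subseteq> K \<longrightarrow>
           norm (u \<phi>) \<le> C * (\<Sum>is | length is \<le> N. SUP x. norm (partials is \<phi> x))))"

definition tempered_distribution :: "'n::finite functional \<Rightarrow> bool" where
  "tempered_distribution u \<longleftrightarrow> linear_functional_on schwartz u \<and>
     (\<exists>C N. \<forall>\<phi>\<in>schwartz.
        norm (u \<phi>) \<le> C * (\<Sum>is | length is \<le> N. SUP x. (1 + norm x) ^ N * norm (partials is \<phi> x)))"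

definition distr_of_fun :: "(real^'n::finite \<Rightarrow> complex) \<Rightarrow> 'n functional" where
  "distr_of_fun f \<phi> = (LINT x|lborel. f x * \<phi> x)"

text \<open>For a distribution \<open>u\<close> and a test function \<open>h\<close>, this formula also makes sense on
  Schwartz functions and there is the canonical extension of \<open>h u\<close> to a tempered distribution.\<close>

definition mult_distr :: "(real^'n::finite \<Rightarrow> complex) \<Rightarrow> 'n functional \<Rightarrow> 'n functional" where
  "mult_distr h u \<phi> = u (\<lambda>x. h x * \<phi> x)"

definition translate :: "real^'n::finite \<Rightarrow> (real^'n \<Rightarrow> complex) \<Rightarrow> real^'n \<Rightarrow> complex" where
  "translate y h x = h (x - y)"

text \<open>Meaningful only if \<open>u\<close> is given by a continuous function, which is then unique.\<close>

definition cont_rep :: "'n::finite functional \<Rightarrow> real^'n \<Rightarrow> complex" where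
  "cont_rep u = (THE f. continuous_on UNIV f \<and> (\<forall>\<phi>\<in>test_functions. u \<phi> = distr_of_fun f \<phi>))"

section \<open>Sobolev spaces\<close>

definition fourier :: "(real^'n::finite \<Rightarrow> complex) \<Rightarrow> real^'n \<Rightarrow> complex" where
  "fourier \<phi> \<xi> = (LINT x|lborel. cis (- (x \<bullet> \<xi>)) * \<phi> x)"

definition inv_fourier :: "(real^'n::finite \<Rightarrow> complex) \<Rightarrow> real^'n \<Rightarrow> complex" where
  "inv_fourier \<phi> x = (LINT \<xi>|lborel. cis (x \<bullet> \<xi>) * \<phi> \<xi>) / of_real ((2 * pi) ^ CARD('n))"

text \<open>The operator \<open>(1 - \<Delta>)\<^bsup>s/2\<^esup>\<close> on Schwartz functions. Since its symbol is even, it is symmetric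
  for the bilinear pairing, so it acts on tempered distributions by transposition, without a
  reflection.\<close>

definition bessel :: "real \<Rightarrow> (real^'n::finite \<Rightarrow> complex) \<Rightarrow> real^'n \<Rightarrow> complex" where
  "bessel s \<phi> = inv_fourier (\<lambda>\<xi>. of_real ((1 + (norm \<xi>)\<^sup>2) powr (s / 2)) * fourier \<phi> \<xi>)"

definition bessel_distr :: "real \<Rightarrow> 'n::finite functional \<Rightarrow> 'n functional" where
  "bessel_distr s u \<phi> = u (bessel s \<phi>)"

definition L2 :: "(real^'n::finite \<Rightarrow> complex) set" where
  "L2 = {g \<in> borel_measurable lborel. integrable lborel (\<lambda>x. (norm (g x))\<^sup>2)}"

definition L2_norm :: "(real^'n::finite \<Rightarrow> complex) \<Rightarrow> real" where
  "L2_norm g = sqrt (LINT x|lborel. (norm (g x))\<^sup>2)"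

definition L2_density :: "'n::finite functional \<Rightarrow> (real^'n \<Rightarrow> complex) \<Rightarrow> bool" where
  "L2_density v g \<longleftrightarrow> g \<in> L2 \<and> (\<forall>\<phi>\<in>schwartz. v \<phi> = distr_of_fun g \<phi>)"

definition sobolev :: "real \<Rightarrow> 'n::finite functional set" where
  "sobolev s = {u. tempered_distribution u \<and> (\<exists>g. L2_density (bessel_distr s u) g)}"

text \<open>The density is unique up to null sets, so its choice does not affect the norm.\<close>

definition sobolev_norm :: "real \<Rightarrow> 'n::finite functional \<Rightarrow> real" where
  "sobolev_norm s u = L2_norm (SOME g. L2_density (bessel_distr s u) g)"

definition sobolev_ul :: "real \<Rightarrow> 'n::finite functional set" where
  "sobolev_ul s = {u. distribution u \<and>
     (\<exists>h\<in>test_functions. h \<noteq> (\<lambda>x. 0) \<and>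
        (\<forall>y. mult_distr (translate y h) u \<in> sobolev s) \<and>
        bdd_above (range (\<lambda>y. sobolev_norm s (mult_distr (translate y h) u))))}"

section \<open>Holomorphic functions of several variables\<close>

definition holomorphic_several :: "(complex^'d::finite \<Rightarrow> complex) \<Rightarrow> (complex^'d) set \<Rightarrow> bool" where
  "holomorphic_several \<Phi> \<Omega> \<longleftrightarrow>
     (\<forall>z\<in>\<Omega>. \<exists>L. (\<Phi> has_derivative L) (at z) \<and> (\<forall>c w. L (c *s w) = c * L w))"

end

theory Submission
  imports Defs "HOL-Probability.Probability" "HOL-Complex_Analysis.Complex_Analysis"
begin

text \<open>For \<open>s > n/2\<close> a function in \<open>\<H>\<^sup>s\<close> is an absolutely convergent Fourier integral \<open>fourier P\<close>
  whose density satisfies \<open>hsq s P < \<infinity>\<close>, and the Cauchy--Schwarz inequality embeds \<open>\<H>\<^sup>s\<close> into the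
  Wiener algebra, whose norm \<open>wnorm P\<close> is the \<open>L\<^sup>1\<close>-norm of the density (\<open>wnorm_le_hsq\<close>). Products
  of functions are convolutions of densities. Since the weight of \<open>\<xi> + \<eta>\<close> is at most \<open>2\<^sup>s\<close> times the
  sum of the weights of \<open>\<xi>\<close> and \<open>\<eta>\<close>, Young's inequality shows that in the estimate of a product only
  one factor at a time has to be measured in \<open>\<H>\<^sup>s\<close>, and the others in the Wiener norm (\<open>hsq_conv\<close>).
  Therefore a power series in functions from \<open>\<H>\<^sup>s\<close> converges in \<open>\<H>\<^sup>s\<close> as soon as their Wiener norms
  are small, however large their \<open>\<H>\<^sup>s\<close>-norms are (\<open>Taylor_density\<close>).

  The smallness comes from localisation. If \<open>\<chi>\<close> is a cutoff function, then the Wiener norm of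
  \<open>\<chi> (x/r) (f x - f 0)\<close> tends to \<open>0\<close> with \<open>r\<close>, uniformly for \<open>f\<close> in bounded subsets of \<open>\<H>\<^sup>s\<close>
  (\<open>localized_wnorm\<close>). Near every point \<open>y\<close>, the components of \<open>u\<close> thus differ from the constants
  \<open>u y\<close> by functions of small Wiener norm, and the product of \<open>\<Phi> \<circ> u\<close> with a smaller cutoff function
  is the Taylor series of \<open>\<Phi>\<close> at \<open>u y\<close> in these functions. The range of \<open>u\<close> is bounded, so its
  closure is a compact subset of \<open>\<Omega>\<close>; hence the radius and the Taylor coefficients are controlled
  uniformly in \<open>y\<close> (\<open>local_composition\<close>), and the resulting uniform bound on the windows of \<open>\<Phi> \<circ> u\<close>
  is membership in \<open>\<H>\<^sup>s\<^sub>u\<^sub>l\<close> (\<open>local_density_imp_sobolev_ul\<close>).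

  Two further ingredients are needed. The Taylor expansion in several variables is reduced to
  Cauchy's formula in one variable (\<open>pd_holomorphic_several\<close>, \<open>several_Taylor\<close>). The distributional
  definitions are linked with Fourier densities by a Fourier transform on \<open>L\<^sup>2\<close> (\<open>L2_fourier\<close>),
  which rests on Gaussian regularisation; it yields \<open>sobolev_imp_fourier_density\<close>, its converse
  \<open>fourier_density_imp_sobolev\<close>, and \<open>sobolev_ul_local_density\<close>, by which an element of \<open>\<H>\<^sup>s\<^sub>u\<^sub>l\<close> is a
  continuous function that agrees with functions of bounded \<open>\<H>\<^sup>s\<close>-norm on balls of a fixed
  radius.\<close>

section \<open>Calculus of smooth functions\<close>

lemma partial_eq:
  assumes "(f has_derivative f') (at x)"
  shows "partial i f x = f' (axis i 1)"
  using frechet_derivative_at[OF assms] by (simp add: partial_def)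

lemma partials_append: "partials is (partials js f) = partials (is @ js) f"
  by (induction "is") auto

text \<open>Smoothness is a greatest fixed point, so it is proved by coinduction: it suffices to
  exhibit a class of differentiable functions that is closed under partial derivatives.\<close>

lemma smooth_coinduct:
  assumes "f \<in> A"
    and "\<And>g. g \<in> A \<Longrightarrow> g differentiable_on UNIV"
    and "\<And>g i. g \<in> A \<Longrightarrow> partial i g \<in> A"
  shows "smooth f"
proof -
  have "partials is f \<in> A" for "is"
    by (induction "is") (use assms in auto)
  with assms show ?thesis by (auto simp: smooth_def)
qed

lemma smooth_partials: "smooth f \<Longrightarrow> smooth (partials is f)"
  by (simp add: smooth_def partials_append)

lemma smooth_partial: "smooth f \<Longrightarrow> smooth (partial i f)"
  using smooth_partials[of f "[i]"] by simp

lemma smooth_differentiable_on: "smooth f \<Longrightarrow> f differentiable_on UNIV"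
  unfolding smooth_def by (metis partials.simps(1))

lemma smooth_differentiable: "smooth f \<Longrightarrow> f differentiable (at x)"
  using smooth_differentiable_on[of f] by (auto simp: differentiable_on_def)

lemma smooth_continuous_on: "smooth f \<Longrightarrow> continuous_on S f"
  by (meson continuous_on_subset differentiable_imp_continuous_on smooth_differentiable_on subset_UNIV)

lemma smooth_measurable: "smooth f \<Longrightarrow> f \<in> borel_measurable borel"
  by (simp add: borel_measurable_continuous_onI smooth_continuous_on)

lemma differentiable_has_derivative_partial:
  fixes f :: "real^'n::finite \<Rightarrow> complex"
  assumes "f differentiable (at x)"
  shows "(f has_derivative (\<lambda>h. \<Sum>i\<in>UNIV. (h $ i) *\<^sub>R partial i f x)) (at x)"
proof -
  have d: "(f has_derivative frechet_derivative f (at x)) (at x)"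
    using assms frechet_derivative_works by blast
  have "frechet_derivative f (at x) h = (\<Sum>i\<in>UNIV. (h $ i) *\<^sub>R partial i f x)" for h
  proof -
    interpret linear "frechet_derivative f (at x)"
      using d has_derivative_linear by blast
    have "h = (\<Sum>i\<in>UNIV. (h $ i) *\<^sub>R axis i 1)"
      using basis_expansion[of h] by (simp add: scalar_mult_eq_scaleR)
    then have "frechet_derivative f (at x) h = frechet_derivative f (at x) (\<Sum>i\<in>UNIV. (h $ i) *\<^sub>R axis i 1)"
      by simp
    then show ?thesis by (simp add: sum scale partial_def)
  qed
  then have "frechet_derivative f (at x) = (\<lambda>h. \<Sum>i\<in>UNIV. (h $ i) *\<^sub>R partial i f x)" by blast
  with d show ?thesis by simp
qed

lemma partial_add:
  assumes "f differentiable (at x)" "g differentiable (at x)"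
  shows "partial i (\<lambda>x. f x + g x) x = partial i f x + partial i g x"
  using partial_eq[OF has_derivative_add[OF assms(1)[unfolded frechet_derivative_works]
        assms(2)[unfolded frechet_derivative_works]]]
  by (simp add: partial_def)

lemma partial_mult:
  assumes "f differentiable (at x)" "g differentiable (at x)"
  shows "partial i (\<lambda>x. f x * g x) x = partial i f x * g x + f x * partial i g x"
  using partial_eq[OF has_derivative_mult[OF assms(1)[unfolded frechet_derivative_works]
        assms(2)[unfolded frechet_derivative_works]]]
  by (simp add: partial_def)

lemma partial_const [simp]: "partial i (\<lambda>x. c) = (\<lambda>x. 0)"
  by (rule ext, subst partial_eq[OF has_derivative_const]) simp

lemma partial_cmult:
  assumes "f differentiable (at x)"
  shows "partial i (\<lambda>x. c * f x) x = c * partial i f x"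
  using partial_mult[OF _ assms, of "\<lambda>_. c" i] by simp

lemma partial_affine:
  assumes "f differentiable (at (c *\<^sub>R x + b))"
  shows "partial i (\<lambda>x. f (c *\<^sub>R x + b)) x = of_real c * partial i f (c *\<^sub>R x + b)"
proof -
  let ?D = "frechet_derivative f (at (c *\<^sub>R x + b))"
  have D: "(f has_derivative ?D) (at (c *\<^sub>R x + b))"
    using assms frechet_derivative_works by blast
  have "((\<lambda>x. f (c *\<^sub>R x + b)) has_derivative (\<lambda>h. ?D (c *\<^sub>R h))) (at x)"
    by (rule has_derivative_compose[where g = f and f = "\<lambda>x. c *\<^sub>R x + b", OF _ D]) (auto intro!: derivative_eq_intros)
  from partial_eq[OF this] show ?thesis
    using linear_cmul[OF has_derivative_linear[OF D]] by (simp add: partial_def scaleR_conv_of_real)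
qed

lemma smooth_const [simp]: "smooth (\<lambda>x. c)"
  by (rule smooth_coinduct[where A = "range (\<lambda>c x. c)"]) auto

lemma smooth_add:
  assumes "smooth f" "smooth g" shows "smooth (\<lambda>x. f x + g x)"
proof (rule smooth_coinduct[where A = "{\<lambda>x. f x + g x |f g. smooth f \<and> smooth g}"])
  fix h i assume "h \<in> {\<lambda>x. f x + g x |f g. smooth f \<and> smooth g}"
  then obtain f g where h: "h = (\<lambda>x. f x + g x)" "smooth f" "smooth g" by auto
  then show "h differentiable_on UNIV"
    using differentiable_on_add[OF smooth_differentiable_on smooth_differentiable_on] by blast
  have "partial i h = (\<lambda>x. partial i f x + partial i g x)"
    using h by (auto simp: partial_add smooth_differentiable)
  then show "partial i h \<in> {\<lambda>x. f x + g x |f g. smooth f \<and> smooth g}"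
    using h smooth_partial by blast
qed (use assms in auto)

lemma smooth_sum: "(\<And>a. a \<in> A \<Longrightarrow> smooth (f a)) \<Longrightarrow> smooth (\<lambda>x. \<Sum>a\<in>A. f a x)"
  by (induction A rule: infinite_finite_induct) (auto intro: smooth_add)

text \<open>The Leibniz rule produces sums of products, so the coinduction invariant for a product has
  to be the additive span of the products.\<close>

inductive_set product_span :: "(real^'n::finite \<Rightarrow> complex) set" where
  product: "smooth f \<Longrightarrow> smooth g \<Longrightarrow> (\<lambda>x. f x * g x) \<in> product_span"
| sum: "f \<in> product_span \<Longrightarrow> g \<in> product_span \<Longrightarrow> (\<lambda>x. f x + g x) \<in> product_span"

lemma smooth_mult:
  assumes "smooth f" "smooth g" shows "smooth (\<lambda>x. f x * g x)"
proof -
  have *: "h differentiable_on UNIV \<and> (\<forall>i. partial i h \<in> product_span)"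
    if "h \<in> product_span" for h :: "real^'n \<Rightarrow> complex"
    using that
  proof induction
    case (product f g)
    have "partial i (\<lambda>x. f x * g x) = (\<lambda>x. partial i f x * g x + f x * partial i g x)" for i
      using product by (auto simp: partial_mult smooth_differentiable)
    then have "partial i (\<lambda>x. f x * g x) \<in> product_span" for i
      using product by (auto intro!: product_span.intros smooth_partial)
    then show ?case
      using differentiable_on_mult[OF smooth_differentiable_on[OF product(1)] smooth_differentiable_on[OF product(2)]] by blast
  next
    case (sum f g)
    have "partial i (\<lambda>x. f x + g x) = (\<lambda>x. partial i f x + partial i g x)" for i
      using sum by (intro ext partial_add) (auto simp: differentiable_on_def)
    then show ?case using sum by (auto intro!: differentiable_on_add product_span.intros)
  qed
  show ?thesis
    by (rule smooth_coinduct[where A = product_span]) (use * assms in \<open>auto intro: product_span.product\<close>)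
qed

lemma smooth_cnj:
  assumes "smooth f" shows "smooth (\<lambda>x. cnj (f x))"
proof (rule smooth_coinduct[where A = "{\<lambda>x. cnj (f x) |f. smooth f}"])
  fix h i assume "h \<in> {\<lambda>x. cnj (f x) |f. smooth f}"
  then obtain f where h: "h = (\<lambda>x. cnj (f x))" "smooth f" by auto
  have D: "(h has_derivative (\<lambda>v. cnj (frechet_derivative f (at x) v))) (at x)" for x
    unfolding h using smooth_differentiable[OF h(2)] frechet_derivative_works
    by (blast intro: has_derivative_cnj)
  then show "h differentiable_on UNIV"
    by (auto simp: differentiable_on_def differentiable_def)
  have "partial i h = (\<lambda>x. cnj (partial i f x))"
    using partial_eq[OF D] by (auto simp: partial_def)
  then show "partial i h \<in> {\<lambda>x. cnj (f x) |f. smooth f}"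
    using h smooth_partial by blast
qed (use assms in auto)

lemma smooth_affine:
  assumes "smooth f" shows "smooth (\<lambda>x. f (c *\<^sub>R x + b))"
proof (rule smooth_coinduct[where A = "{\<lambda>x. a * f (c *\<^sub>R x + b) |a f. smooth f}"])
  show "(\<lambda>x. f (c *\<^sub>R x + b)) \<in> {\<lambda>x. a * f (c *\<^sub>R x + b) |a f. smooth f}"
    using assms by (auto intro!: exI[of _ 1])
next
  fix h i assume "h \<in> {\<lambda>x. a * f (c *\<^sub>R x + b) |a f. smooth f}"
  then obtain a f where h: "h = (\<lambda>x. a * f (c *\<^sub>R x + b))" "smooth f" by auto
  have d: "(\<lambda>x. f (c *\<^sub>R x + b)) differentiable (at x)" for x
    by (rule differentiable_compose[of f]) (use h in \<open>auto intro: smooth_differentiable\<close>)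
  then show "h differentiable_on UNIV" unfolding h differentiable_on_def
    by (auto intro!: differentiable_mult)
  have "partial i h = (\<lambda>x. (a * of_real c) * partial i f (c *\<^sub>R x + b))"
    unfolding h using d h(2) by (auto simp: partial_cmult partial_affine smooth_differentiable)
  then show "partial i h \<in> {\<lambda>x. a * f (c *\<^sub>R x + b) |a f. smooth f}"
    using h smooth_partial by blast
qed

text \<open>The remainder bound only involves the second derivatives on the segment. It is used with
  a majorant that varies with \<open>x\<close>, so that the remainder may be integrated over \<open>x\<close>. The mean
  value inequality is applied twice, to the first derivatives and to \<open>f\<close> minus its linear part.\<close>

lemma smooth_quadratic_taylor:
  fixes f :: "real^'n::finite \<Rightarrow> complex" and C :: real
  assumes f: "smooth f"
    and C: "\<And>i j y. y \<in> closed_segment x (x + h) \<Longrightarrow> norm (partial j (partial i f) y) \<le> C"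
  shows "norm (f (x + h) - f x - (\<Sum>i\<in>UNIV. (h $ i) *\<^sub>R partial i f x)) \<le> (real CARD('n))\<^sup>2 * C * (norm h)\<^sup>2"
proof -
  let ?n = "real CARD('n)"
  have C0: "0 \<le> C" using order_trans[OF norm_ge_zero C[OF ends_in_segment(1)]] .
  have seg: "closed_segment x y \<subseteq> closed_segment x (x + h) \<and> norm (y - x) \<le> norm h"
    if "y \<in> closed_segment x (x + h)" for y
    using that by (metis add_diff_cancel_left' ends_in_segment(1) norm_minus_commute
         segment_bound1 subset_closed_segment)
  have on: "onorm (\<lambda>k. \<Sum>i\<in>UNIV. (k $ i) *\<^sub>R D i) \<le> ?n * K"
    if "\<And>i. norm (D i) \<le> K" for D :: "'n \<Rightarrow> complex" and K
  proof (rule onorm_le)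
    fix k :: "real^'n"
    have "norm (\<Sum>i\<in>UNIV. (k $ i) *\<^sub>R D i) \<le> (\<Sum>i\<in>(UNIV::'n set). norm k * K)"
      by (rule sum_norm_le) (auto intro!: mult_mono that component_le_norm_cart)
    then show "norm (\<Sum>i\<in>UNIV. (k $ i) *\<^sub>R D i) \<le> ?n * K * norm k" by (simp add: mult_ac)
  qed
  have 1: "norm (partial i f y - partial i f x) \<le> ?n * C * norm h" if y: "y \<in> closed_segment x (x + h)" for i y
  proof -
    have "norm (partial i f y - partial i f x) \<le> ?n * C * norm (y - x)"
    proof (rule differentiable_bound[where S = "closed_segment x y"])
      fix z assume z: "z \<in> closed_segment x y"
      show "(partial i f has_derivative (\<lambda>k. \<Sum>j\<in>UNIV. (k $ j) *\<^sub>R partial j (partial i f) z)) (at z within closed_segment x y)"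
        by (rule has_derivative_at_withinI, rule differentiable_has_derivative_partial,
            rule smooth_differentiable, rule smooth_partial, rule f)
      show "onorm (\<lambda>k. \<Sum>j\<in>UNIV. (k $ j) *\<^sub>R partial j (partial i f) z) \<le> ?n * C"
        using C z seg[OF y] by (intro on) blast
    qed auto
    also have "\<dots> \<le> ?n * C * norm h"
      using seg[OF y] C0 by (intro mult_left_mono) auto
    finally show ?thesis .
  qed
  define F where "F y = f y - (\<Sum>i\<in>UNIV. (y $ i) *\<^sub>R partial i f x)" for y
  have "norm (F (x + h) - F x) \<le> (?n * (?n * C * norm h)) * norm ((x + h) - x)"
  proof (rule differentiable_bound[where S = "closed_segment x (x + h)"])
    fix y assume y: "y \<in> closed_segment x (x + h)"
    have "((\<lambda>y. \<Sum>i\<in>UNIV. (y $ i) *\<^sub>R partial i f x) has_derivative (\<lambda>k. \<Sum>i\<in>UNIV. (k $ i) *\<^sub>R partial i f x)) (at y)"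
      by (auto intro!: derivative_eq_intros bounded_linear.has_derivative[OF bounded_linear_vec_nth])
    from has_derivative_diff[OF differentiable_has_derivative_partial[OF smooth_differentiable[OF f]] this]
    have "(F has_derivative (\<lambda>k. \<Sum>i\<in>UNIV. (k $ i) *\<^sub>R (partial i f y - partial i f x))) (at y)"
      by (simp only: F_def [abs_def] sum_subtractf scaleR_diff_right)
    then show "(F has_derivative (\<lambda>k. \<Sum>i\<in>UNIV. (k $ i) *\<^sub>R (partial i f y - partial i f x))) (at y within closed_segment x (x + h))"
      by (rule has_derivative_at_withinI)
    show "onorm (\<lambda>k. \<Sum>i\<in>UNIV. (k $ i) *\<^sub>R (partial i f y - partial i f x)) \<le> ?n * (?n * C * norm h)"
      using 1[OF y] by (intro on) blast
  qed auto
  moreover have "F (x + h) - F x = f (x + h) - f x - (\<Sum>i\<in>UNIV. (h $ i) *\<^sub>R partial i f x)"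
    by (simp add: F_def scaleR_add_left sum.distrib)
  ultimately show ?thesis by (simp add: power2_eq_square mult_ac)
qed

section \<open>Test functions\<close>

lemma test_functions_iff:
  "f \<in> test_functions \<longleftrightarrow> smooth f \<and> (\<exists>R. \<forall>x. norm x > R \<longrightarrow> f x = 0)"
proof -
  have "compact (closure {x. f x \<noteq> 0}) \<longleftrightarrow> (\<exists>R. \<forall>x. norm x > R \<longrightarrow> f x = 0)"
    unfolding compact_closure bounded_iff by (simp add: not_less[symmetric]) (metis not_less)
  then show ?thesis by (auto simp: test_functions_def)
qed

lemma test_functionsI: "smooth f \<Longrightarrow> (\<And>x. norm x > R \<Longrightarrow> f x = 0) \<Longrightarrow> f \<in> test_functions"
  by (auto simp: test_functions_iff)

lemma test_functions_smooth: "f \<in> test_functions \<Longrightarrow> smooth f"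
  by (simp add: test_functions_def)

lemma partial_eq_0_open:
  assumes "open S" "x \<in> S" "\<And>y. y \<in> S \<Longrightarrow> f y = 0"
  shows "partial i f x = 0"
proof -
  have "(f has_derivative (\<lambda>h. 0)) (at x)"
    by (rule has_derivative_transform_within_open[where f = "\<lambda>_. 0" and s = S]) (use assms in auto)
  from partial_eq[OF this] show ?thesis by simp
qed

lemma test_functions_partial:
  assumes "f \<in> test_functions" shows "partial i f \<in> test_functions"
proof -
  obtain R where R: "smooth f" "\<And>x. norm x > R \<Longrightarrow> f x = 0"
    using assms by (auto simp: test_functions_iff)
  have "open {x::real^'a. R < norm x}"
    by (intro open_Collect_less continuous_intros)
  then have "partial i f x = 0" if "norm x > R" for x
    by (rule partial_eq_0_open) (use that R in auto)
  then show ?thesis using R smooth_partial test_functions_iff by blast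
qed

lemma test_functions_partials: "f \<in> test_functions \<Longrightarrow> partials is f \<in> test_functions"
  by (induction "is") (auto intro: test_functions_partial)

lemma test_functions_bounded:
  assumes "f \<in> test_functions" obtains C where "C \<ge> 0" "\<And>x. norm (f x) \<le> C"
proof -
  obtain R where R: "smooth f" "\<And>x. norm x > R \<Longrightarrow> f x = 0"
    using assms by (auto simp: test_functions_iff)
  have "compact (f ` cball 0 R)"
    by (intro compact_continuous_image smooth_continuous_on R) auto
  then obtain C where C: "\<And>x. x \<in> cball 0 R \<Longrightarrow> norm (f x) \<le> C"
    by (meson bounded_iff compact_imp_bounded image_eqI)
  have "norm (f x) \<le> max 0 C" for x
    using C[of x] R(2)[of x] by (cases "norm x \<le> R") (auto simp: le_max_iff_disj)
  then show ?thesis using that[of "max 0 C"] by auto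
qed

lemma test_functions_zero [simp]: "(\<lambda>x. 0) \<in> test_functions"
  by (auto simp: test_functions_iff)

lemma test_functions_mult:
  assumes "f \<in> test_functions" "smooth g" shows "(\<lambda>x. f x * g x) \<in> test_functions"
  using assms by (auto simp: test_functions_iff intro: smooth_mult)

lemma test_functions_mult':
  assumes "f \<in> test_functions" "smooth g" shows "(\<lambda>x. g x * f x) \<in> test_functions"
  using test_functions_mult[OF assms] by (simp add: mult.commute)

lemma test_functions_cmult: "f \<in> test_functions \<Longrightarrow> (\<lambda>x. c * f x) \<in> test_functions"
  using test_functions_mult'[of f "\<lambda>_. c"] by simp

lemma test_functions_add:
  assumes "f \<in> test_functions" "g \<in> test_functions" shows "(\<lambda>x. f x + g x) \<in> test_functions"
proof -
  obtain R R' where "\<And>x. norm x > R \<Longrightarrow> f x = 0" "\<And>x. norm x > R' \<Longrightarrow> g x = 0"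
    using assms by (auto simp: test_functions_iff)
  then show ?thesis
    by (intro test_functionsI[where R = "max R R'"]) (use assms in \<open>auto intro: smooth_add test_functions_smooth\<close>)
qed

lemma test_functions_sum:
  "(\<And>a. a \<in> A \<Longrightarrow> f a \<in> test_functions) \<Longrightarrow> (\<lambda>x. \<Sum>a\<in>A. f a x) \<in> test_functions"
  by (induction A rule: infinite_finite_induct) (auto intro: test_functions_add)

lemma test_functions_cnj: "f \<in> test_functions \<Longrightarrow> (\<lambda>x. cnj (f x)) \<in> test_functions"
  by (auto simp: test_functions_iff intro: smooth_cnj)

lemma test_functions_affine:
  assumes "f \<in> test_functions" "c \<noteq> 0" shows "(\<lambda>x. f (c *\<^sub>R x + b)) \<in> test_functions"
proof -
  obtain R where R: "smooth f" "\<And>x. norm x > R \<Longrightarrow> f x = 0"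
    using assms by (auto simp: test_functions_iff)
  have "f (c *\<^sub>R x + b) = 0" if "norm x > (R + norm b) / \<bar>c\<bar>" for x
  proof (rule R(2))
    have "R + norm b < norm (c *\<^sub>R x)"
      using that assms by (simp add: field_simps)
    then show "R < norm (c *\<^sub>R x + b)"
      using norm_diff_ineq[of "c *\<^sub>R x" b] by linarith
  qed
  then show ?thesis using R smooth_affine test_functions_iff by blast
qed

lemma translate_conv: "translate y h = (\<lambda>x. h (1 *\<^sub>R x + (- y)))"
  by (simp add: translate_def fun_eq_iff)

lemma test_functions_translate: "f \<in> test_functions \<Longrightarrow> translate y f \<in> test_functions"
  unfolding translate_conv by (rule test_functions_affine) auto

text \<open>Dividing by a power of \<open>D\<close> rather than by \<open>D\<close> makes the class of quotients closed under
  differentiation. Points where \<open>D\<close> vanishes are outside the support of the numerator, and there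
  division by zero yields the right value \<open>0\<close>.\<close>

lemma test_functions_divide:
  fixes f :: "real^'n::finite \<Rightarrow> complex"
  assumes f: "f \<in> test_functions" and D: "smooth D"
    and S: "closed S" "\<And>x. f x \<noteq> 0 \<Longrightarrow> x \<in> S" "\<And>x. x \<in> S \<Longrightarrow> D x \<noteq> 0"
  shows "(\<lambda>x. f x / D x) \<in> test_functions"
proof -
  define A where "A = {\<lambda>x. g x / D x ^ k |g k. g \<in> test_functions \<and> (\<forall>x. g x \<noteq> 0 \<longrightarrow> x \<in> S)}"
  have "smooth (\<lambda>x. f x / D x)"
  proof (rule smooth_coinduct[where A = A])
    show "(\<lambda>x. f x / D x) \<in> A"
      unfolding A_def using f S by (auto intro!: exI[of _ f] exI[of _ 1])
  next
    fix h i assume "h \<in> A"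
    then obtain g k where h: "h = (\<lambda>x. g x / D x ^ k)" and g: "g \<in> test_functions" "\<And>x. g x \<noteq> 0 \<Longrightarrow> x \<in> S"
      unfolding A_def by blast
    define g' where "g' x = partial i g x * D x + (- of_nat k) * (g x * partial i D x)" for x
    have out: "open (- S)" using S(1) by auto
    have gout: "g x = 0" if "x \<in> - S" for x using g(2) that by auto
    have *: "h differentiable (at x) \<and> partial i h x = g' x / D x ^ Suc k" for x
    proof (cases "x \<in> S")
      case True
      have dg: "(g has_derivative frechet_derivative g (at x)) (at x)"
        and dD: "(D has_derivative frechet_derivative D (at x)) (at x)"
        using g D by (auto simp: frechet_derivative_works[symmetric] smooth_differentiable test_functions_smooth)
      have D0: "D x \<noteq> 0" using S True by auto
      have "(h has_derivative (\<lambda>v. - g x * (inverse (D x ^ k) * (of_nat k * frechet_derivative D (at x) v * D x ^ (k - 1)) * inverse (D x ^ k))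
           + frechet_derivative g (at x) v / D x ^ k)) (at x)"
        unfolding h by (rule has_derivative_divide[OF dg has_derivative_power[OF dD], of k]) (use D0 in auto)
      note d = this
      have "partial i h x = g' x / D x ^ Suc k"
        unfolding partial_eq[OF d] unfolding g'_def partial_def using D0
        by (cases k) (auto simp: field_simps)
      then show ?thesis using d differentiable_def by blast
    next
      case False
      have "(h has_derivative (\<lambda>v. 0)) (at x)"
        by (rule has_derivative_transform_within_open[where f = "\<lambda>_. 0" and s = "-S"])
           (use False out gout h in auto)
      moreover have "partial i g x = 0"
        by (rule partial_eq_0_open[OF out]) (use False gout in auto)
      ultimately show ?thesis
        using False gout partial_eq[of h "\<lambda>_. 0" x i] by (auto simp: differentiable_def g'_def)
    qed
    then show "h differentiable_on UNIV" by (auto simp: differentiable_on_def)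
    have "partial i h = (\<lambda>x. g' x / D x ^ Suc k)" using * by auto
    moreover have "g' \<in> test_functions" unfolding g'_def
      by (intro test_functions_add test_functions_mult test_functions_cmult test_functions_partial g D smooth_partial)
    moreover have "x \<in> S" if "g' x \<noteq> 0" for x
    proof (rule ccontr)
      assume "x \<notin> S"
      then have "partial i g x = 0" "g x = 0"
        using gout by (auto intro!: partial_eq_0_open[OF out])
      then show False using that by (simp add: g'_def)
    qed
    ultimately show "partial i h \<in> A" unfolding A_def by blast
  qed
  then show ?thesis using f by (auto simp: test_functions_iff)
qed

section \<open>Schwartz functions\<close>

definition rapid :: "(real^'n::finite \<Rightarrow> complex) \<Rightarrow> bool" where
  "rapid f \<longleftrightarrow> (\<forall>k. \<exists>C. \<forall>x. (1 + norm x) ^ k * norm (f x) \<le> C)"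

lemma schwartz_iff: "\<phi> \<in> schwartz \<longleftrightarrow> smooth \<phi> \<and> (\<forall>is. rapid (partials is \<phi>))"
  unfolding schwartz_def rapid_def by (auto simp: bdd_above_def)

lemma schwartz_coinduct:
  assumes "f \<in> A"
    and "\<And>g. g \<in> A \<Longrightarrow> g differentiable_on UNIV" "\<And>g. g \<in> A \<Longrightarrow> rapid g"
    and "\<And>g i. g \<in> A \<Longrightarrow> partial i g \<in> A"
  shows "f \<in> schwartz"
proof -
  have "partials is f \<in> A" for "is"
    by (induction "is") (use assms in auto)
  with assms show ?thesis by (auto simp: schwartz_iff smooth_def)
qed

lemma schwartz_smooth: "\<phi> \<in> schwartz \<Longrightarrow> smooth \<phi>" by (simp add: schwartz_iff)

lemma schwartz_rapid: "\<phi> \<in> schwartz \<Longrightarrow> rapid \<phi>"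
  unfolding schwartz_iff by (metis partials.simps(1))

lemma schwartz_partial: "\<phi> \<in> schwartz \<Longrightarrow> partial i \<phi> \<in> schwartz"
  unfolding schwartz_iff using partials_append[of _ "[i]" \<phi>] smooth_partial by fastforce

lemma rapidE:
  assumes "rapid f" obtains C where "C \<ge> 0" "\<And>x. (1 + norm x) ^ k * norm (f x) \<le> C"
proof -
  obtain C where C: "\<And>x. (1 + norm x) ^ k * norm (f x) \<le> C"
    using assms by (auto simp: rapid_def)
  moreover have "0 \<le> (1 + norm (0::real^'a)) ^ k * norm (f 0)" by simp
  ultimately have "C \<ge> 0" using order_trans by blast
  with C that show ?thesis by blast
qed

lemma rapid_add: assumes "rapid f" "rapid g" shows "rapid (\<lambda>x. f x + g x)"
  unfolding rapid_def
proof
  fix k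
  obtain C C' where C: "\<And>x. (1 + norm x) ^ k * norm (f x) \<le> C" "\<And>x. (1 + norm x) ^ k * norm (g x) \<le> C'"
    using assms unfolding rapid_def by metis
  have "(1 + norm x) ^ k * norm (f x + g x) \<le> C + C'" for x
  proof -
    have "(1 + norm x) ^ k * norm (f x + g x) \<le> (1 + norm x) ^ k * (norm (f x) + norm (g x))"
      by (intro mult_left_mono norm_triangle_ineq) auto
    then show ?thesis using C(1)[of x] C(2)[of x] by (simp add: distrib_left)
  qed
  then show "\<exists>C. \<forall>x. (1 + norm x) ^ k * norm (f x + g x) \<le> C" by blast
qed

lemma rapid_mult:
  fixes f :: "real^'n::finite \<Rightarrow> complex"
  assumes "rapid f" "\<And>x. norm (m x) \<le> K * (1 + norm x) ^ N" shows "rapid (\<lambda>x. m x * f x)"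
  unfolding rapid_def
proof
  fix k
  obtain C where C: "C \<ge> 0" "\<And>x. (1 + norm x) ^ (k + N) * norm (f x) \<le> C"
    using rapidE[OF assms(1)] by metis
  have K: "K \<ge> 0" using order_trans[OF norm_ge_zero assms(2)[of 0]] by simp
  have "(1 + norm x) ^ k * norm (m x * f x) \<le> K * C" for x
  proof -
    have "(1 + norm x) ^ k * norm (m x * f x) \<le> (1 + norm x) ^ k * ((K * (1 + norm x) ^ N) * norm (f x))"
      unfolding norm_mult by (intro mult_left_mono mult_right_mono assms) auto
    also have "\<dots> = K * ((1 + norm x) ^ (k + N) * norm (f x))" by (simp add: power_add mult_ac)
    also have "\<dots> \<le> K * C" by (intro mult_left_mono C K)
    finally show ?thesis .
  qed
  then show "\<exists>C. \<forall>x. (1 + norm x) ^ k * norm (m x * f x) \<le> C" by blast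
qed

lemma test_functions_rapid:
  assumes "f \<in> test_functions" shows "rapid f"
  unfolding rapid_def
proof
  fix k
  obtain R where R: "\<And>x. norm x > R \<Longrightarrow> f x = 0"
    using assms by (auto simp: test_functions_iff)
  obtain C where C: "C \<ge> 0" "\<And>x. norm (f x) \<le> C" using test_functions_bounded[OF assms] by blast
  have "(1 + norm x) ^ k * norm (f x) \<le> (1 + max 0 R) ^ k * C" for x
  proof (cases "norm x > R")
    case False
    then show ?thesis by (intro mult_mono power_mono C) auto
  qed (use R C in auto)
  then show "\<exists>C. \<forall>x. (1 + norm x) ^ k * norm (f x) \<le> C" by blast
qed

lemma test_functions_schwartz: "f \<in> test_functions \<Longrightarrow> f \<in> schwartz"
  by (auto simp: schwartz_iff test_functions_smooth intro: test_functions_partials test_functions_rapid)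

lemma schwartz_add:
  assumes "f \<in> schwartz" "g \<in> schwartz" shows "(\<lambda>x. f x + g x) \<in> schwartz"
proof (rule schwartz_coinduct[where A = "{\<lambda>x. f x + g x |f g. f \<in> schwartz \<and> g \<in> schwartz}"])
  fix h i assume "h \<in> {\<lambda>x. f x + g x |f g. f \<in> schwartz \<and> g \<in> schwartz}"
  then obtain f g where h: "h = (\<lambda>x. f x + g x)" "f \<in> schwartz" "g \<in> schwartz" by auto
  show "h differentiable_on UNIV" "rapid h"
    unfolding h(1) by (intro smooth_differentiable_on smooth_add schwartz_smooth rapid_add schwartz_rapid h)+
  have "partial i h = (\<lambda>x. partial i f x + partial i g x)"
    using h by (auto simp: partial_add smooth_differentiable schwartz_smooth)
  then show "partial i h \<in> {\<lambda>x. f x + g x |f g. f \<in> schwartz \<and> g \<in> schwartz}"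
    using h schwartz_partial by blast
qed (use assms in auto)

lemma schwartz_cmult:
  assumes "f \<in> schwartz" shows "(\<lambda>x. c * f x) \<in> schwartz"
proof (rule schwartz_coinduct[where A = "{\<lambda>x. c * f x |f. f \<in> schwartz}"])
  fix h i assume "h \<in> {\<lambda>x. c * f x |f. f \<in> schwartz}"
  then obtain f where h: "h = (\<lambda>x. c * f x)" "f \<in> schwartz" by auto
  then show "h differentiable_on UNIV"
    using smooth_differentiable_on[OF smooth_mult[OF smooth_const schwartz_smooth]] by blast
  show "rapid h" unfolding h(1)
    by (rule rapid_mult[OF schwartz_rapid[OF h(2)], of _ "norm c" 0]) auto
  have "partial i h = (\<lambda>x. c * partial i f x)"
    using h by (auto simp: partial_cmult smooth_differentiable schwartz_smooth)
  then show "partial i h \<in> {\<lambda>x. c * f x |f. f \<in> schwartz}"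
    using h schwartz_partial by blast
qed (use assms in auto)

lemma schwartz_uminus_arg:
  assumes "f \<in> schwartz" shows "(\<lambda>x. f (- x)) \<in> schwartz"
proof (rule schwartz_coinduct[where A = "{\<lambda>x. f (- x) |f. f \<in> schwartz}"])
  fix h i assume "h \<in> {\<lambda>x. f (- x) |f. f \<in> schwartz}"
  then obtain f where h: "h = (\<lambda>x. f (- x))" "f \<in> schwartz" by auto
  show "h differentiable_on UNIV" unfolding h(1)
    using smooth_affine[OF schwartz_smooth[OF h(2)], of "-1" 0] by (simp add: smooth_differentiable_on)
  show "rapid h" unfolding h(1)
    using schwartz_rapid[OF h(2)] unfolding rapid_def by (metis norm_minus_cancel)
  have "partial i h = (\<lambda>x. (\<lambda>x. (- 1) * partial i f x) (- x))"
    using h partial_affine[of f "-1" _ 0 i] by (auto simp: smooth_differentiable schwartz_smooth)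
  then show "partial i h \<in> {\<lambda>x. f (- x) |f. f \<in> schwartz}"
    using schwartz_cmult[OF schwartz_partial[OF h(2)], of "-1" i] by (auto intro!: exI[of _ "\<lambda>x. - 1 * partial i f x"])
qed (use assms in auto)

lemma has_derivative_coord: "((\<lambda>x. complex_of_real (x $ i)) has_derivative (\<lambda>h. complex_of_real (h $ i))) (at x)"
  by (auto intro!: derivative_eq_intros bounded_linear.has_derivative[OF bounded_linear_vec_nth])

lemma schwartz_coord_mult:
  fixes f :: "real^'n::finite \<Rightarrow> complex"
  assumes "f \<in> schwartz" shows "(\<lambda>x. of_real (x $ j) * f x) \<in> schwartz"
proof (rule schwartz_coinduct[where A = "{\<lambda>x. of_real (x $ j) * f x + g x |f g. f \<in> schwartz \<and> g \<in> schwartz}"])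
  let ?A = "{\<lambda>x::real^'n. of_real (x $ j) * f x + g x |f g. f \<in> schwartz \<and> g \<in> schwartz}"
  show "(\<lambda>x. of_real (x $ j) * f x) \<in> ?A"
    using assms test_functions_schwartz[OF test_functions_zero]
    by (intro CollectI exI[of _ f] exI[of _ "\<lambda>x. 0"]) auto
  fix h i assume "h \<in> ?A"
  then obtain f g where h: "h = (\<lambda>x. of_real (x $ j) * f x + g x)" "f \<in> schwartz" "g \<in> schwartz" by auto
  have d: "f differentiable (at x)" "g differentiable (at x)" "(\<lambda>x. complex_of_real (x $ j)) differentiable (at x)" for x
    using has_derivative_coord[of j x] h(2,3)
    by (auto intro: smooth_differentiable schwartz_smooth differentiableI)
  then show "h differentiable_on UNIV" unfolding h(1) differentiable_on_def
    by (auto intro!: derivative_intros)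
  show "rapid h" unfolding h(1)
    by (intro rapid_add schwartz_rapid h rapid_mult[where K = 1 and N = 1])
       (use component_le_norm_cart in \<open>auto intro: order_trans[OF component_le_norm_cart]\<close>)
  have "partial i h = (\<lambda>x. of_real (x $ j) * partial i f x + (of_real (axis i 1 $ j) * f x + partial i g x))"
    unfolding h using d partial_eq[OF has_derivative_coord[of j]]
    by (auto simp: partial_add partial_mult differentiable_mult)
  moreover have "(\<lambda>x. of_real (axis i 1 $ j) * f x + partial i g x) \<in> schwartz"
    by (intro schwartz_add schwartz_cmult schwartz_partial h)
  ultimately show "partial i h \<in> ?A"
    using schwartz_partial[OF h(2), of i] unfolding mem_Collect_eq
    by (intro exI[of _ "partial i f"] exI[of _ "\<lambda>x. of_real (axis i 1 $ j) * f x + partial i g x"] conjI)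
qed

text \<open>The power \<open>\<langle>\<xi>\<rangle>\<^sup>s\<close> of the Japanese bracket, the symbol of \<open>(1 - \<Delta>)\<^bsup>s/2\<^esup>\<close>.\<close>

definition weight :: "real \<Rightarrow> real^'n::finite \<Rightarrow> real" where
  "weight s \<xi> = (1 + (norm \<xi>)\<^sup>2) powr (s / 2)"

lemma weight_pos [simp]: "weight s \<xi> > 0"
  using add_pos_nonneg[of 1 "(norm \<xi>)\<^sup>2"] by (simp add: weight_def)

lemma weight_nonneg [simp]: "weight s \<xi> \<ge> 0" using weight_pos less_imp_le by blast
lemma weight_nz [simp]: "weight s \<xi> \<noteq> 0" using weight_pos[of s \<xi>] by linarith
lemma weight_minus [simp]: "weight s (- \<xi>) = weight s \<xi>" by (simp add: weight_def)
lemma weight_uminus: "weight (- s) \<xi> = inverse (weight s \<xi>)"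
  by (simp add: weight_def powr_minus)

lemma weight_measurable [measurable]: "weight s \<in> borel_measurable borel"
  unfolding weight_def by measurable

lemma weight_le: "weight a x \<le> (1 + norm x) ^ nat \<lceil>\<bar>a\<bar>\<rceil>"
proof -
  have 1: "1 + (norm x)\<^sup>2 \<le> (1 + norm x)\<^sup>2" by (simp add: power2_eq_square algebra_simps)
  have "weight a x \<le> weight \<bar>a\<bar> x"
    unfolding weight_def by (intro powr_mono) auto
  also have "\<dots> \<le> ((1 + norm x)\<^sup>2) powr (\<bar>a\<bar> / 2)"
    unfolding weight_def by (intro powr_mono2 1) auto
  also have "\<dots> = (1 + norm x) powr \<bar>a\<bar>"
    by (simp add: powr_powr flip: powr_numeral)
  also have "\<dots> \<le> (1 + norm x) powr (real (nat \<lceil>\<bar>a\<bar>\<rceil>))"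
    by (intro powr_mono) (auto simp: real_nat_ceiling_ge)
  also have "\<dots> = (1 + norm x) ^ nat \<lceil>\<bar>a\<bar>\<rceil>"
    by (intro powr_realpow) (smt (verit) norm_ge_zero)
  finally show ?thesis .
qed

lemma weight_one_plus_norm: "1 \<le> (weight (- real m) x)\<^sup>2 * (1 + norm x) ^ (2 * m)"
proof -
  have p: "0 < 1 + (norm x)\<^sup>2" by (simp add: add_pos_nonneg)
  then have "(1 + (norm x)\<^sup>2) powr - real m = inverse ((1 + (norm x)\<^sup>2) ^ m)"
    by (simp add: powr_minus powr_realpow)
  moreover have "(weight (- real m) x)\<^sup>2 = (1 + (norm x)\<^sup>2) powr - real m"
    by (simp add: weight_def power2_eq_square flip: powr_add)
  moreover have "(1 + (norm x)\<^sup>2) ^ m \<le> (1 + norm x) ^ (2 * m)"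
    unfolding power_mult by (intro power_mono) (auto simp: power2_eq_square algebra_simps)
  moreover have "0 < (1 + (norm x)\<^sup>2) ^ m" using p by (rule zero_less_power)
  ultimately show ?thesis by (simp add: divide_inverse[symmetric] mult.commute[of "inverse _"])
qed

text \<open>A quantity \<open>F\<close> that decays like \<open>(1 + norm y) ^ (- 2 m)\<close> is dominated at \<open>y\<close> by a fixed
  integrable function of \<open>x\<close>, uniformly for \<open>y\<close> in the unit ball around \<open>x\<close>. This provides the
  majorants for small translations.\<close>

lemma decay_nearby:
  fixes x y :: "real^'n::finite"
  assumes F: "(1 + norm y) ^ (2 * m) * F \<le> C" "F \<ge> 0" and near: "norm (x - y) \<le> 1"
  shows "F \<le> C * 4 ^ m * (weight (- real m) x)\<^sup>2"
proof -
  let ?w = "(weight (- real m) x)\<^sup>2"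
  have "norm x \<le> norm y + norm (x - y)" using norm_triangle_ineq[of y "x - y"] by simp
  then have "1 + norm x \<le> 2 * (1 + norm y)" using near norm_ge_zero[of y] by (smt (verit) distrib_left mult_2)
  then have "(1 + norm x) ^ (2 * m) \<le> (2 * (1 + norm y)) ^ (2 * m)" by (intro power_mono) auto
  also have "\<dots> = 4 ^ m * (1 + norm y) ^ (2 * m)" unfolding power_mult_distrib by (simp add: power_mult[of 2 2])
  finally have *: "(1 + norm x) ^ (2 * m) \<le> 4 ^ m * (1 + norm y) ^ (2 * m)" .
  have "F \<le> (?w * (1 + norm x) ^ (2 * m)) * F"
    using mult_right_mono[OF weight_one_plus_norm[of m x] F(2)] by simp
  also have "\<dots> \<le> (?w * (4 ^ m * (1 + norm y) ^ (2 * m))) * F"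
    by (intro mult_right_mono mult_left_mono * F) auto
  also have "\<dots> = ?w * 4 ^ m * ((1 + norm y) ^ (2 * m) * F)" by simp
  also have "\<dots> \<le> ?w * 4 ^ m * C" by (intro mult_left_mono F) auto
  finally show ?thesis by (simp add: mult_ac)
qed

lemma has_derivative_weight:
  "((\<lambda>x. complex_of_real (weight a x)) has_derivative (\<lambda>h. of_real (a * weight (a - 2) x * (x \<bullet> h)))) (at x)"
proof -
  have p: "1 + (norm x)\<^sup>2 > 0" by (simp add: add_pos_nonneg)
  have "((\<lambda>x. (1 + x \<bullet> x) powr (a / 2)) has_derivative
      (\<lambda>h. (1 + x \<bullet> x) powr (a / 2) * (0 * ln (1 + x \<bullet> x) + (x \<bullet> h + h \<bullet> x) * (a / 2) / (1 + x \<bullet> x)))) (at x)"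
    by (rule has_derivative_powr) (use p in \<open>auto intro!: derivative_eq_intros simp: power2_norm_eq_inner\<close>)
  also have "(\<lambda>h. (1 + x \<bullet> x) powr (a / 2) * (0 * ln (1 + x \<bullet> x) + (x \<bullet> h + h \<bullet> x) * (a / 2) / (1 + x \<bullet> x)))
     = (\<lambda>h. a * weight (a - 2) x * (x \<bullet> h))"
  proof
    fix h
    have "weight (a - 2) x = weight a x / (1 + x \<bullet> x)"
      unfolding weight_def power2_norm_eq_inner using p
      by (simp add: diff_divide_distrib powr_diff power2_norm_eq_inner)
    then show "(1 + x \<bullet> x) powr (a / 2) * (0 * ln (1 + x \<bullet> x) + (x \<bullet> h + h \<bullet> x) * (a / 2) / (1 + x \<bullet> x)) = a * weight (a - 2) x * (x \<bullet> h)"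
      by (simp add: weight_def power2_norm_eq_inner inner_commute field_simps)
  qed
  finally have "((\<lambda>x. weight a x) has_derivative (\<lambda>h. a * weight (a - 2) x * (x \<bullet> h))) (at x)"
    by (simp add: weight_def power2_norm_eq_inner)
  then show ?thesis by (rule has_derivative_of_real)
qed

text \<open>A partial derivative of \<open>\<langle>x\<rangle>\<^sup>a f x\<close> combines the weights of exponents \<open>a\<close> and \<open>a - 2\<close>, so the
  coinduction invariant has to admit sums with varying exponents.\<close>

inductive_set weight_span :: "(real^'n::finite \<Rightarrow> complex) set" where
  weighted: "f \<in> schwartz \<Longrightarrow> (\<lambda>x. of_real (weight a x) * f x) \<in> weight_span"
| sum: "f \<in> weight_span \<Longrightarrow> g \<in> weight_span \<Longrightarrow> (\<lambda>x. f x + g x) \<in> weight_span"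

lemma schwartz_weight_mult:
  fixes f :: "real^'n::finite \<Rightarrow> complex"
  assumes "f \<in> schwartz" shows "(\<lambda>x. of_real (weight a x) * f x) \<in> schwartz"
proof -
  have *: "h differentiable_on UNIV \<and> rapid h \<and> (\<forall>i. partial i h \<in> weight_span)"
    if "h \<in> weight_span" for h :: "real^'n \<Rightarrow> complex"
    using that
  proof induction
    case (weighted f a)
    have d: "f differentiable (at x)" "(\<lambda>x. complex_of_real (weight a x)) differentiable (at x)" for x
      using has_derivative_weight[of a x]
      by (auto simp: smooth_differentiable[OF schwartz_smooth[OF weighted]] differentiable_def[of "\<lambda>x. complex_of_real (weight a x)"])
    have "partial i (\<lambda>x. of_real (weight a x) * f x) =
       (\<lambda>x. of_real (weight (a - 2) x) * (of_real a * (of_real (x $ i) * f x)) + of_real (weight a x) * partial i f x)" for i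
      by (rule ext, subst partial_mult[OF d(2,1)])
         (simp add: partial_eq[OF has_derivative_weight[of a]] inner_axis mult_ac)
    then have "partial i (\<lambda>x. of_real (weight a x) * f x) \<in> weight_span" for i
      using weighted by (auto intro!: weight_span.intros schwartz_cmult schwartz_coord_mult schwartz_partial)
    moreover have "rapid (\<lambda>x. of_real (weight a x) * f x)"
      by (rule rapid_mult[OF schwartz_rapid[OF weighted], where K = 1 and N = "nat \<lceil>\<bar>a\<bar>\<rceil>"])
         (simp add: weight_le abs_of_pos)
    ultimately show ?case using d by (auto simp: differentiable_on_def intro!: derivative_intros)
  next
    case (sum f g)
    have "partial i (\<lambda>x. f x + g x) = (\<lambda>x. partial i f x + partial i g x)" for i
      using sum by (intro ext partial_add) (auto simp: differentiable_on_def)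
    then show ?case using sum by (auto intro!: differentiable_on_add weight_span.intros rapid_add)
  qed
  show ?thesis
    by (rule schwartz_coinduct[where A = weight_span]) (use * assms in \<open>auto intro: weight_span.weighted\<close>)
qed

section \<open>Integrals over Euclidean space\<close>

lemma nn_integral_lborel_affine:
  fixes f :: "'a::euclidean_space \<Rightarrow> ennreal"
  assumes [measurable]: "f \<in> borel_measurable borel" and c: "c \<noteq> 0"
  shows "(\<integral>\<^sup>+x. f x \<partial>lborel) = ennreal (\<bar>c\<bar> ^ DIM('a)) * (\<integral>\<^sup>+x. f (t + c *\<^sub>R x) \<partial>lborel)"
  by (subst lborel_affine[OF c, of t])
     (simp add: nn_integral_density nn_integral_distr nn_integral_cmult ennreal_power)

lemma nn_integral_lborel_reflect:
  fixes f :: "'a::euclidean_space \<Rightarrow> ennreal"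
  assumes "f \<in> borel_measurable borel"
  shows "(\<integral>\<^sup>+x. f (a - x) \<partial>lborel) = (\<integral>\<^sup>+x. f x \<partial>lborel)"
  using nn_integral_lborel_affine[OF assms, of "-1" a] by simp

lemma nn_integral_lborel_shift:
  fixes f :: "'a::euclidean_space \<Rightarrow> ennreal"
  assumes "f \<in> borel_measurable borel"
  shows "(\<integral>\<^sup>+x. f (x - a) \<partial>lborel) = (\<integral>\<^sup>+x. f x \<partial>lborel)"
  using nn_integral_lborel_affine[OF assms, of 1 "-a"] by simp

lemma integrable_lborel_affine:
  fixes f :: "'a::euclidean_space \<Rightarrow> 'b::{banach, second_countable_topology}"
  assumes f: "integrable lborel f" and c: "c \<noteq> 0"
  shows "integrable lborel (\<lambda>x. f (t + c *\<^sub>R x))"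
proof -
  have [measurable]: "f \<in> borel_measurable borel" using f by auto
  have "(\<integral>\<^sup>+x. norm (f x) \<partial>lborel) < \<infinity>" using f by (simp add: integrable_iff_bounded)
  then have "(\<integral>\<^sup>+x. norm (f (t + c *\<^sub>R x)) \<partial>lborel) \<noteq> \<infinity>"
    using c by (subst (asm) nn_integral_lborel_affine[of _ c t])
      (auto simp: ennreal_mult_less_top ennreal_mult_eq_top_iff)
  then show ?thesis by (intro integrableI_bounded) (auto simp: top.not_eq_extremum)
qed

lemma integral_lborel_affine:
  fixes f :: "'a::euclidean_space \<Rightarrow> complex"
  assumes [measurable]: "f \<in> borel_measurable borel" and c: "c \<noteq> 0"
  shows "(LINT x|lborel. f x) = of_real (\<bar>c\<bar> ^ DIM('a)) * (LINT x|lborel. f (t + c *\<^sub>R x))"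
proof -
  have "(LINT x|lborel. f x) = (LINT x|density (distr lborel borel (\<lambda>x. t + c *\<^sub>R x)) (\<lambda>_. ennreal (\<bar>c\<bar>^DIM('a))). f x)"
    using lborel_affine[OF c, of t] by (simp add: ennreal_power)
  also have "\<dots> = (LINT x|lborel. \<bar>c\<bar>^DIM('a) *\<^sub>R f (t + c *\<^sub>R x))"
    by (subst integral_density) (auto simp: integral_distr)
  finally show ?thesis by (simp add: scaleR_conv_of_real)
qed

lemma integral_lborel_reflect:
  fixes f :: "'a::euclidean_space \<Rightarrow> complex"
  assumes "f \<in> borel_measurable borel"
  shows "(LINT x|lborel. f (a - x)) = (LINT x|lborel. f x)"
  using integral_lborel_affine[OF assms, of "-1" a] by simp

lemma integral_lborel_shift:
  fixes f :: "'a::euclidean_space \<Rightarrow> complex"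
  assumes "f \<in> borel_measurable borel"
  shows "(LINT x|lborel. f (x + a)) = (LINT x|lborel. f x)"
  using integral_lborel_affine[OF assms, of 1 a] by (simp add: add.commute)

lemma norm_integral_le_nn_integral:
  fixes f :: "'a \<Rightarrow> complex"
  assumes "f \<in> borel_measurable M"
  shows "ennreal (norm (LINT x|M. f x)) \<le> (\<integral>\<^sup>+x. norm (f x) \<partial>M)"
  using integral_norm_bound_ennreal[of M f] not_integrable_integral_eq[of M f]
  by (cases "integrable M f") auto

lemma two_squares_ennreal: "((a::ennreal) + b)\<^sup>2 \<le> 2 * a\<^sup>2 + 2 * b\<^sup>2"
proof -
  have "2 * a * b = a * b + a * b" by (simp only: mult_2 distrib_right)
  then have "(a + b)\<^sup>2 = a\<^sup>2 + b\<^sup>2 + 2 * a * b" by (simp add: power2_eq_square distrib_left distrib_right add_ac mult.commute)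
  also have "\<dots> \<le> a\<^sup>2 + b\<^sup>2 + (a\<^sup>2 + b\<^sup>2)" by (intro add_left_mono sum_of_squares_ge_ennreal)
  finally show ?thesis by (simp add: mult_2 add_ac)
qed

text \<open>Young's inequality for the exponents 1 and 2. It is the Cauchy--Schwarz inequality for the
  measure with density \<open>\<lambda>\<xi>. a (\<eta> - \<xi>)\<close>, followed by an interchange of integrals.\<close>

lemma Young_L1_L2:
  fixes a b :: "'a::euclidean_space \<Rightarrow> ennreal"
  assumes a [measurable]: "a \<in> borel_measurable borel" and b [measurable]: "b \<in> borel_measurable borel"
  shows "(\<integral>\<^sup>+\<eta>. (\<integral>\<^sup>+\<xi>. a (\<eta> - \<xi>) * b \<xi> \<partial>lborel)\<^sup>2 \<partial>lborel)
    \<le> (\<integral>\<^sup>+\<xi>. a \<xi> \<partial>lborel)\<^sup>2 * (\<integral>\<^sup>+\<xi>. (b \<xi>)\<^sup>2 \<partial>lborel)"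
proof -
  let ?A = "\<integral>\<^sup>+\<xi>. a \<xi> \<partial>lborel"
  have "(\<integral>\<^sup>+\<xi>. a (\<eta> - \<xi>) * b \<xi> \<partial>lborel)\<^sup>2 \<le> (\<integral>\<^sup>+\<xi>. a (\<eta> - \<xi>) * (b \<xi>)\<^sup>2 \<partial>lborel) * ?A" for \<eta>
  proof -
    let ?M = "density lborel (\<lambda>\<xi>. a (\<eta> - \<xi>))"
    have CS: "(\<integral>\<^sup>+\<xi>. b \<xi> * 1 \<partial>?M)\<^sup>2 \<le> (\<integral>\<^sup>+\<xi>. (b \<xi>)\<^sup>2 \<partial>?M) * (\<integral>\<^sup>+\<xi>. 1\<^sup>2 \<partial>?M)"
      by (rule Cauchy_Schwarz_nn_integral) auto
    have dens: "(\<integral>\<^sup>+\<xi>. g \<xi> \<partial>?M) = (\<integral>\<^sup>+\<xi>. a (\<eta> - \<xi>) * g \<xi> \<partial>lborel)"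
      if "g \<in> borel_measurable borel" for g
      by (rule nn_integral_density) (use that in auto)
    have e: "(\<integral>\<^sup>+\<xi>. b \<xi> * 1 \<partial>?M) = (\<integral>\<^sup>+\<xi>. a (\<eta> - \<xi>) * (b \<xi> * 1) \<partial>lborel)"
       "(\<integral>\<^sup>+\<xi>. (b \<xi>)\<^sup>2 \<partial>?M) = (\<integral>\<^sup>+\<xi>. a (\<eta> - \<xi>) * (b \<xi>)\<^sup>2 \<partial>lborel)"
       "(\<integral>\<^sup>+\<xi>. 1\<^sup>2 \<partial>?M) = (\<integral>\<^sup>+\<xi>. a (\<eta> - \<xi>) * 1\<^sup>2 \<partial>lborel)"
      by (rule dens, measurable)+
    from CS have "(\<integral>\<^sup>+\<xi>. a (\<eta> - \<xi>) * (b \<xi> * 1) \<partial>lborel)\<^sup>2 \<le> (\<integral>\<^sup>+\<xi>. a (\<eta> - \<xi>) * (b \<xi>)\<^sup>2 \<partial>lborel) * (\<integral>\<^sup>+\<xi>. a (\<eta> - \<xi>) * 1\<^sup>2 \<partial>lborel)"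
      unfolding e .
    then show ?thesis by (simp add: nn_integral_lborel_reflect)
  qed
  then have "(\<integral>\<^sup>+\<eta>. (\<integral>\<^sup>+\<xi>. a (\<eta> - \<xi>) * b \<xi> \<partial>lborel)\<^sup>2 \<partial>lborel)
     \<le> (\<integral>\<^sup>+\<eta>. (\<integral>\<^sup>+\<xi>. a (\<eta> - \<xi>) * (b \<xi>)\<^sup>2 \<partial>lborel) * ?A \<partial>lborel)"
    by (intro nn_integral_mono)
  also have "\<dots> = (\<integral>\<^sup>+\<eta>. (\<integral>\<^sup>+\<xi>. a (\<eta> - \<xi>) * (b \<xi>)\<^sup>2 \<partial>lborel) \<partial>lborel) * ?A"
    by (rule nn_integral_multc) measurable
  also have "(\<integral>\<^sup>+\<eta>. (\<integral>\<^sup>+\<xi>. a (\<eta> - \<xi>) * (b \<xi>)\<^sup>2 \<partial>lborel) \<partial>lborel) = (\<integral>\<^sup>+\<xi>. (\<integral>\<^sup>+\<eta>. a (\<eta> - \<xi>) * (b \<xi>)\<^sup>2 \<partial>lborel) \<partial>lborel)"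
    by (rule lborel_pair.Fubini') measurable
  also have "\<dots> = (\<integral>\<^sup>+\<xi>. ?A * (b \<xi>)\<^sup>2 \<partial>lborel)"
    by (intro nn_integral_cong) (simp add: nn_integral_multc nn_integral_lborel_shift)
  also have "\<dots> = ?A * (\<integral>\<^sup>+\<xi>. (b \<xi>)\<^sup>2 \<partial>lborel)"
    by (rule nn_integral_cmult) measurable
  finally show ?thesis by (simp add: power2_eq_square mult_ac)
qed

lemma nn_integral_convolution:
  fixes a b :: "'a::euclidean_space \<Rightarrow> ennreal"
  assumes a [measurable]: "a \<in> borel_measurable borel" and b [measurable]: "b \<in> borel_measurable borel"
  shows "(\<integral>\<^sup>+\<eta>. (\<integral>\<^sup>+\<xi>. a (\<eta> - \<xi>) * b \<xi> \<partial>lborel) \<partial>lborel) = (\<integral>\<^sup>+\<xi>. a \<xi> \<partial>lborel) * (\<integral>\<^sup>+\<xi>. b \<xi> \<partial>lborel)"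
proof -
  have "(\<integral>\<^sup>+\<eta>. (\<integral>\<^sup>+\<xi>. a (\<eta> - \<xi>) * b \<xi> \<partial>lborel) \<partial>lborel) = (\<integral>\<^sup>+\<xi>. (\<integral>\<^sup>+\<eta>. a (\<eta> - \<xi>) * b \<xi> \<partial>lborel) \<partial>lborel)"
    by (rule lborel_pair.Fubini') measurable
  then show ?thesis by (simp add: nn_integral_multc nn_integral_lborel_shift nn_integral_cmult)
qed

text \<open>The weight \<open>\<langle>\<xi>\<rangle>\<^sup>-\<^sup>s\<close> is square-integrable for \<open>s > n/2\<close>: it is dominated by a
  combination of indicators of the dyadic balls, whose integrals form a geometric series.\<close>

lemma weight_square_integrable:
  assumes s: "s > real CARD('n::finite) / 2"
  shows "(\<integral>\<^sup>+\<xi>. ennreal ((weight (- s) (\<xi>::real^'n))\<^sup>2) \<partial>lborel) < \<infinity>"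
proof -
  let ?n = "CARD('n)" and ?B = "\<lambda>k. cball 0 (2 ^ k) :: (real^'n) set"
  have s0: "s > 0" using s by (meson divide_nonneg_nonneg le_less_trans of_nat_0_le_iff zero_le_numeral)
  have dom: "ennreal ((weight (- s) \<xi>)\<^sup>2) \<le> (\<Sum>k. ennreal (4 powr s * 4 powr (- s * k)) * indicator (?B k) \<xi>)" for \<xi> :: "real^'n"
  proof -
    have w: "(weight (- s) \<xi>)\<^sup>2 = (1 + (norm \<xi>)\<^sup>2) powr (- s)"
      by (simp add: weight_def power2_eq_square flip: powr_add)
    obtain k0 where "norm \<xi> < 2 ^ k0" using real_arch_pow[of 2 "norm \<xi>"] by auto
    then have ex: "\<exists>k. norm \<xi> \<le> 2 ^ k" by (meson less_imp_le)
    define k where "k = (LEAST k. norm \<xi> \<le> 2 ^ k)"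
    have k: "norm \<xi> \<le> 2 ^ k" using LeastI_ex[OF ex] by (simp add: k_def)
    have "(1 + (norm \<xi>)\<^sup>2) powr (- s) \<le> 4 powr s * 4 powr (- s * k)"
    proof (cases k)
      case 0
      have "(1 + (norm \<xi>)\<^sup>2) powr (- s) \<le> 1 powr (- s)"
        by (rule powr_mono2') (use s0 in auto)
      also have "\<dots> \<le> 4 powr s" using s0 by (simp add: ge_one_powr_ge_zero)
      finally show ?thesis using 0 by simp
    next
      case (Suc m)
      then have "\<not> norm \<xi> \<le> 2 ^ m" using not_less_Least[of m "\<lambda>k. norm \<xi> \<le> 2 ^ k"] by (simp add: k_def)
      then have "(2 ^ m)\<^sup>2 \<le> (norm \<xi>)\<^sup>2" by (intro power_mono) auto
      moreover have "((2::real) ^ m)\<^sup>2 = 4 powr m"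
        by (simp add: powr_realpow power2_eq_square flip: power_mult_distrib)
      ultimately have "4 powr m \<le> 1 + (norm \<xi>)\<^sup>2" by linarith
      then have "(1 + (norm \<xi>)\<^sup>2) powr (- s) \<le> (4 powr m) powr (- s)"
        by (intro powr_mono2') (use s0 in auto)
      also have "\<dots> = 4 powr s * 4 powr (- s * k)"
        using Suc by (simp add: powr_powr algebra_simps flip: powr_add)
      finally show ?thesis .
    qed
    then have "ennreal ((weight (- s) \<xi>)\<^sup>2) \<le> (\<Sum>j\<in>{k}. ennreal (4 powr s * 4 powr (- s * j)) * indicator (?B j) \<xi>)"
      using k by (simp add: w ennreal_leI)
    also have "\<dots> \<le> (\<Sum>j. ennreal (4 powr s * 4 powr (- s * j)) * indicator (?B j) \<xi>)"
      by (rule sum_le_suminf) auto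
    finally show ?thesis .
  qed
  have "(\<integral>\<^sup>+\<xi>. ennreal ((weight (- s) (\<xi>::real^'n))\<^sup>2) \<partial>lborel) \<le>
      (\<integral>\<^sup>+\<xi>. (\<Sum>k. ennreal (4 powr s * 4 powr (- s * k)) * indicator (?B k) \<xi>) \<partial>lborel)"
    by (intro nn_integral_mono dom)
  also have "\<dots> = (\<Sum>k. ennreal (4 powr s * 4 powr (- s * k)) * emeasure lborel (?B k))"
  proof -
    have "(\<lambda>\<xi>. ennreal (4 powr s * 4 powr (- s * k)) * indicator (?B k) \<xi>) \<in> borel_measurable lborel" for k
      by (intro borel_measurable_times_ennreal borel_measurable_const borel_measurable_indicator) auto
    then have "(\<integral>\<^sup>+\<xi>. (\<Sum>k. ennreal (4 powr s * 4 powr (- s * k)) * indicator (?B k) \<xi>) \<partial>lborel)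
        = (\<Sum>k. \<integral>\<^sup>+\<xi>. ennreal (4 powr s * 4 powr (- s * k)) * indicator (?B k) \<xi> \<partial>lborel)"
      by (rule nn_integral_suminf)
    also have "\<dots> = (\<Sum>k. ennreal (4 powr s * 4 powr (- s * k)) * emeasure lborel (?B k))"
      by (intro suminf_cong nn_integral_cmult_indicator) auto
    finally show ?thesis .
  qed
  also have "\<dots> = (\<Sum>k. ennreal ((4 powr s * unit_ball_vol ?n) * (2 powr (?n - 2 * s)) ^ k))"
  proof (rule suminf_cong)
    fix k
    have "4 powr s * 4 powr (- s * k) * (unit_ball_vol ?n * (2 ^ k) ^ ?n) = (4 powr s * unit_ball_vol ?n) * (2 powr (?n - 2 * s)) ^ k"
    proof -
      have 4: "4 powr (- s * k) = 2 powr (- 2 * s * k)"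
        using powr_powr[of 2 2 "- s * k"] by (simp add: mult.assoc)
      have "(2 powr (?n - 2 * s)) ^ k = 2 powr (- 2 * s * k) * 2 powr (?n * k)"
        by (simp add: powr_power algebra_simps flip: powr_add)
      also have "2 powr (?n * k) = ((2::real) ^ k) ^ ?n"
        by (simp add: powr_realpow mult.commute flip: power_mult of_nat_mult)
      finally show ?thesis using 4 by simp
    qed
    then show "ennreal (4 powr s * 4 powr (- s * k)) * emeasure lborel (?B k) = ennreal ((4 powr s * unit_ball_vol ?n) * (2 powr (?n - 2 * s)) ^ k)"
      by (simp add: emeasure_cball flip: ennreal_mult')
  qed
  also have "\<dots> < \<infinity>"
  proof -
    have "2 powr (real ?n - 2 * s) < 2 powr 0" using s by (intro powr_less_mono) (auto simp: field_simps)
    then have "summable (\<lambda>k. (4 powr s * unit_ball_vol ?n) * (2 powr (?n - 2 * s)) ^ k)"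
      by (intro summable_mult summable_geometric) auto
    then show ?thesis by (subst suminf_ennreal2) auto
  qed
  finally show ?thesis .
qed

lemma rapid_integrable:
  fixes f :: "real^'n::finite \<Rightarrow> complex"
  assumes f: "rapid f" and [measurable]: "f \<in> borel_measurable borel"
  shows "integrable lborel f"
proof -
  let ?n = "CARD('n)"
  obtain C where C: "C \<ge> 0" "\<And>x. (1 + norm x) ^ (2 * ?n) * norm (f x) \<le> C" using rapidE[OF f] by blast
  have "norm (f x) \<le> C * (weight (- real ?n) x)\<^sup>2" for x
  proof -
    have "norm (f x) \<le> ((weight (- real ?n) x)\<^sup>2 * (1 + norm x) ^ (2 * ?n)) * norm (f x)"
      using mult_right_mono[OF weight_one_plus_norm[of ?n x], of "norm (f x)"] by simp
    also have "\<dots> = (weight (- real ?n) x)\<^sup>2 * ((1 + norm x) ^ (2 * ?n) * norm (f x))" by simp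
    also have "\<dots> \<le> (weight (- real ?n) x)\<^sup>2 * C" by (intro mult_left_mono C) auto
    finally show ?thesis by (simp add: mult.commute)
  qed
  then have "(\<integral>\<^sup>+x. norm (f x) \<partial>lborel) \<le> (\<integral>\<^sup>+x. ennreal C * ennreal ((weight (- real ?n) (x::real^'n))\<^sup>2) \<partial>lborel)"
    using C by (intro nn_integral_mono) (simp add: ennreal_leI flip: ennreal_mult')
  also have "\<dots> = ennreal C * (\<integral>\<^sup>+x. ennreal ((weight (- real ?n) (x::real^'n))\<^sup>2) \<partial>lborel)"
    by (rule nn_integral_cmult) measurable
  also have "\<dots> < \<infinity>"
    using weight_square_integrable[where 'n = 'n, of "real ?n"] by (simp add: ennreal_mult_less_top)
  finally show ?thesis by (intro integrableI_bounded) auto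
qed

lemma schwartz_measurable: "\<phi> \<in> schwartz \<Longrightarrow> \<phi> \<in> borel_measurable borel"
  by (simp add: smooth_measurable schwartz_smooth)

lemma schwartz_integrable: "\<phi> \<in> schwartz \<Longrightarrow> integrable lborel \<phi>"
  by (simp add: rapid_integrable schwartz_rapid schwartz_measurable)

lemma test_functions_integrable: "\<phi> \<in> test_functions \<Longrightarrow> integrable lborel \<phi>"
  by (simp add: schwartz_integrable test_functions_schwartz)

lemma rapid_square:
  fixes f :: "real^'n::finite \<Rightarrow> complex"
  assumes "rapid f" shows "rapid (\<lambda>x. f x * f x)"
proof -
  obtain C where C: "C \<ge> 0" "\<And>x. (1 + norm x) ^ 0 * norm (f x) \<le> C" using rapidE[OF assms] by blast
  show ?thesis by (rule rapid_mult[OF assms, where K = C and N = 0]) (use C in auto)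
qed

section \<open>Square-integrable functions\<close>

text \<open>The squared \<open>L\<^sup>2\<close>-norm takes values in \<open>ennreal\<close> so that it can be estimated before it is known
  to be finite.\<close>

definition nsq :: "('a::euclidean_space \<Rightarrow> complex) \<Rightarrow> ennreal" where
  "nsq f = (\<integral>\<^sup>+x. (ennreal (norm (f x)))\<^sup>2 \<partial>lborel)"

lemma L2_iff: "g \<in> L2 \<longleftrightarrow> g \<in> borel_measurable borel \<and> nsq g < \<infinity>"
  by (auto simp: L2_def nsq_def integrable_iff_bounded ennreal_power)

lemma L2_norm_sq: assumes "g \<in> L2" shows "ennreal ((L2_norm g)\<^sup>2) = nsq g"
proof -
  have "integrable lborel (\<lambda>x. (norm (g x))\<^sup>2)" using assms by (simp add: L2_def)
  then have "(\<integral>\<^sup>+x. ennreal ((norm (g x))\<^sup>2) \<partial>lborel) = ennreal (LINT x|lborel. (norm (g x))\<^sup>2)"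
    by (intro nn_integral_eq_integral) auto
  then show ?thesis by (simp add: L2_norm_def nsq_def ennreal_power integral_nonneg_AE)
qed

lemma nsq_cmult: "nsq (\<lambda>x. c * f x) = ennreal ((norm c)\<^sup>2) * nsq f"
  if "f \<in> borel_measurable borel" for f :: "'a::euclidean_space \<Rightarrow> complex"
  using that unfolding nsq_def
  by (subst nn_integral_cmult[symmetric]) (auto intro!: nn_integral_cong simp: norm_mult ennreal_mult' power_mult_distrib ennreal_power)

lemma nsq_mono: "(\<And>x. norm (f x) \<le> norm (g x)) \<Longrightarrow> nsq f \<le> nsq g"
  unfolding nsq_def by (intro nn_integral_mono power_mono ennreal_leI) auto

lemma nsq_add:
  fixes f g :: "'a::euclidean_space \<Rightarrow> complex"
  assumes [measurable]: "f \<in> borel_measurable borel" "g \<in> borel_measurable borel"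
  shows "nsq (\<lambda>x. f x + g x) \<le> 2 * nsq f + 2 * nsq g"
proof -
  have "nsq (\<lambda>x. f x + g x) \<le> (\<integral>\<^sup>+x. 2 * (ennreal (norm (f x)))\<^sup>2 + 2 * (ennreal (norm (g x)))\<^sup>2 \<partial>lborel)"
    unfolding nsq_def
  proof (rule nn_integral_mono)
    fix x
    have "(ennreal (norm (f x + g x)))\<^sup>2 \<le> (ennreal (norm (f x)) + ennreal (norm (g x)))\<^sup>2"
      by (intro power_mono) (simp_all add: norm_triangle_ineq ennreal_leI flip: ennreal_plus)
    also have "\<dots> \<le> 2 * (ennreal (norm (f x)))\<^sup>2 + 2 * (ennreal (norm (g x)))\<^sup>2" by (rule two_squares_ennreal)
    finally show "(ennreal (norm (f x + g x)))\<^sup>2 \<le> 2 * (ennreal (norm (f x)))\<^sup>2 + 2 * (ennreal (norm (g x)))\<^sup>2" .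
  qed
  also have "\<dots> = 2 * nsq f + 2 * nsq g"
    unfolding nsq_def by (subst nn_integral_add) (auto simp: nn_integral_cmult)
  finally show ?thesis .
qed

lemma nsq_sum:
  fixes f :: "'i \<Rightarrow> 'a::euclidean_space \<Rightarrow> complex"
  assumes "finite A" and f [measurable]: "\<And>i. i \<in> A \<Longrightarrow> f i \<in> borel_measurable borel"
  shows "nsq (\<lambda>x. \<Sum>i\<in>A. f i x) \<le> of_nat (card A) * (\<Sum>i\<in>A. nsq (f i))"
proof -
  have "(ennreal (norm (\<Sum>i\<in>A. f i x)))\<^sup>2 \<le> of_nat (card A) * (\<Sum>i\<in>A. (ennreal (norm (f i x)))\<^sup>2)" for x
  proof -
    have "(norm (\<Sum>i\<in>A. f i x))\<^sup>2 \<le> (\<Sum>i\<in>A. norm (f i x))\<^sup>2"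
      by (intro power_mono norm_sum) auto
    also have "\<dots> \<le> real (card A) * (\<Sum>i\<in>A. (norm (f i x))\<^sup>2)"
      using sum_squared_le_sum_of_squares[of "\<lambda>i. norm (f i x)" A] by (simp add: mult.commute)
    finally have "ennreal ((norm (\<Sum>i\<in>A. f i x))\<^sup>2) \<le> ennreal (real (card A) * (\<Sum>i\<in>A. (norm (f i x))\<^sup>2))"
      by (rule ennreal_leI)
    then show ?thesis by (simp add: ennreal_mult' sum_nonneg ennreal_power flip: sum_ennreal ennreal_of_nat_eq_real_of_nat)
  qed
  then have "nsq (\<lambda>x. \<Sum>i\<in>A. f i x) \<le> (\<integral>\<^sup>+x. of_nat (card A) * (\<Sum>i\<in>A. (ennreal (norm (f i x)))\<^sup>2) \<partial>lborel)"
    unfolding nsq_def by (intro nn_integral_mono)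
  also have "\<dots> = of_nat (card A) * (\<Sum>i\<in>A. nsq (f i))"
    unfolding nsq_def by (subst nn_integral_cmult) (auto simp: nn_integral_sum)
  finally show ?thesis .
qed

lemma L2_mult_integrable:
  fixes f g :: "'a::euclidean_space \<Rightarrow> complex"
  assumes [measurable]: "f \<in> borel_measurable borel" "g \<in> borel_measurable borel"
  shows "(\<integral>\<^sup>+x. norm (f x * g x) \<partial>lborel)\<^sup>2 \<le> nsq f * nsq g"
    and "nsq f < \<infinity> \<Longrightarrow> nsq g < \<infinity> \<Longrightarrow> integrable lborel (\<lambda>x. f x * g x)"
proof -
  show *: "(\<integral>\<^sup>+x. norm (f x * g x) \<partial>lborel)\<^sup>2 \<le> nsq f * nsq g"
    using Cauchy_Schwarz_nn_integral[of "\<lambda>x. ennreal (norm (f x))" lborel "\<lambda>x. ennreal (norm (g x))"]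
    by (simp add: nsq_def norm_mult ennreal_mult')
  assume "nsq f < \<infinity>" "nsq g < \<infinity>"
  then have "(\<integral>\<^sup>+x. norm (f x * g x) \<partial>lborel)\<^sup>2 < \<infinity>"
    using * by (auto intro: le_less_trans simp: ennreal_mult_less_top)
  then show "integrable lborel (\<lambda>x. f x * g x)"
    by (intro integrableI_bounded) (auto simp: power_less_top_ennreal)
qed

text \<open>The geometric weights replace Minkowski's inequality: \<open>(\<Sum>a\<^sub>k)\<^sup>2 \<le> \<Sum>2\<^bsup>k+1\<^esup>a\<^sub>k\<^sup>2\<close>.\<close>

lemma sum_power2_le_geometric:
  "(\<Sum>k<N. (a k :: ennreal))\<^sup>2 \<le> (\<Sum>k<N. 2 ^ Suc k * (a k)\<^sup>2)"
proof (induction N arbitrary: a)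
  case (Suc N)
  have "(\<Sum>k<Suc N. a k)\<^sup>2 = (a 0 + (\<Sum>k<N. a (Suc k)))\<^sup>2"
    by (simp only: sum.lessThan_Suc_shift)
  also have "\<dots> \<le> 2 * (a 0)\<^sup>2 + 2 * (\<Sum>k<N. a (Suc k))\<^sup>2" by (rule two_squares_ennreal)
  also have "\<dots> \<le> 2 * (a 0)\<^sup>2 + 2 * (\<Sum>k<N. 2 ^ Suc k * (a (Suc k))\<^sup>2)"
    by (intro add_left_mono mult_left_mono Suc.IH) auto
  also have "\<dots> = (\<Sum>k<Suc N. 2 ^ Suc k * (a k)\<^sup>2)"
    by (subst sum.lessThan_Suc_shift) (simp add: sum_distrib_left mult_ac)
  finally show ?case .
qed auto

text \<open>Completeness of \<open>L\<^sup>2\<close> in the form in which it is used: a series with geometrically decreasing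
  norms converges, and it may be paired termwise with square-integrable functions.\<close>

lemma L2_series:
  fixes f :: "nat \<Rightarrow> 'a::euclidean_space \<Rightarrow> complex"
  assumes f [measurable]: "\<And>k. f k \<in> borel_measurable borel"
    and C: "\<And>k. nsq (f k) \<le> ennreal (C * (1 / 8) ^ k)" and C0: "C \<ge> 0"
  shows "\<exists>g. g \<in> borel_measurable borel \<and> nsq g \<le> ennreal (4 * C) \<and>
    (\<forall>b\<in>borel_measurable borel. nsq b < \<infinity> \<longrightarrow>
        (\<lambda>k. LINT x|lborel. f k x * b x) sums (LINT x|lborel. g x * b x))"
proof -
  let ?a = "\<lambda>k x. ennreal (norm (f k x))"
  \<comment> \<open>The weights \<open>2\<^bsup>k+1\<^esup>\<close> turn the decay \<open>8\<^sup>-\<^sup>k\<close> into \<open>2 * 4\<^sup>-\<^sup>k\<close>, which is still summable.\<close>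
  have bound: "(\<integral>\<^sup>+x. (\<Sum>k. ?a k x)\<^sup>2 \<partial>lborel) \<le> ennreal (4 * C)"
  proof -
    have le: "(\<Sum>k. ?a k x)\<^sup>2 \<le> (\<Sum>k. 2 ^ Suc k * (?a k x)\<^sup>2)" for x
    proof -
      have "(\<lambda>N. (\<Sum>k<N. ?a k x)\<^sup>2) \<longlonglongrightarrow> (\<Sum>k. ?a k x)\<^sup>2"
        unfolding power2_eq_square by (intro tendsto_mult_ennreal summable_LIMSEQ) auto
      moreover have "(\<Sum>k<N. ?a k x)\<^sup>2 \<le> (\<Sum>k. 2 ^ Suc k * (?a k x)\<^sup>2)" for N
        using sum_power2_le_geometric sum_le_suminf[of "\<lambda>k. 2 ^ Suc k * (?a k x)\<^sup>2" "{..<N}"]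
        by (meson finite_lessThan order_trans summableI zero_le)
      ultimately show ?thesis by (meson LIMSEQ_le_const2)
    qed
    have "(\<integral>\<^sup>+x. (\<Sum>k. ?a k x)\<^sup>2 \<partial>lborel) \<le> (\<integral>\<^sup>+x. (\<Sum>k. 2 ^ Suc k * (?a k x)\<^sup>2) \<partial>lborel)"
      by (intro nn_integral_mono le)
    also have "\<dots> = (\<Sum>k. 2 ^ Suc k * nsq (f k))"
      unfolding nsq_def by (subst nn_integral_suminf) (auto simp: nn_integral_cmult)
    also have "\<dots> \<le> (\<Sum>k. ennreal (2 * C * (1 / 4) ^ k))"
    proof (intro suminf_le)
      fix k
      have "2 ^ Suc k * nsq (f k) \<le> ennreal (2 ^ Suc k) * ennreal (C * (1 / 8) ^ k)"
        by (intro mult_mono C) (simp_all del: power_Suc flip: ennreal_power)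
      also have "\<dots> = ennreal (2 * C * (1 / 4) ^ k)"
        using C0 by (simp add: power_divide mult_ac flip: ennreal_mult power_mult_distrib)
          (simp add: field_simps flip: power_mult_distrib)
      finally show "2 ^ Suc k * nsq (f k) \<le> ennreal (2 * C * (1 / 4) ^ k)" .
    qed auto
    also have "\<dots> = ennreal (\<Sum>k. 2 * C * (1 / 4) ^ k)"
      by (intro suminf_ennreal2) (use C0 in \<open>auto intro!: summable_mult summable_geometric\<close>)
    also have "\<dots> \<le> ennreal (4 * C)"
      using C0 by (intro ennreal_leI) (simp add: suminf_mult suminf_geometric summable_geometric)
    finally show ?thesis .
  qed
  have fin: "AE x in lborel. (\<Sum>k. ?a k x) < \<infinity>"
  proof -
    have "(\<integral>\<^sup>+x. (\<Sum>k. ?a k x)\<^sup>2 \<partial>lborel) \<noteq> \<infinity>"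
      using le_less_trans[OF bound ennreal_less_top] by simp
    then have "AE x in lborel. (\<Sum>k. ?a k x)\<^sup>2 \<noteq> \<infinity>"
      by (rule nn_integral_PInf_AE[rotated]) measurable
    then show ?thesis
    proof eventually_elim
      fix x assume "(\<Sum>k. ?a k x)\<^sup>2 \<noteq> \<infinity>"
      then show "(\<Sum>k. ?a k x) < \<infinity>"
        by (cases "(\<Sum>k. ?a k x) = \<infinity>") (simp_all add: less_top[symmetric])
    qed
  qed
  then have summ: "AE x in lborel. summable (\<lambda>k. norm (f k x))"
    by eventually_elim (auto intro!: summable_suminf_not_top)
  define g where "g x = (\<Sum>k. f k x)" for x
  have [measurable]: "g \<in> borel_measurable borel" unfolding g_def by measurable
  have "nsq g \<le> (\<integral>\<^sup>+x. (\<Sum>k. ?a k x)\<^sup>2 \<partial>lborel)"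
    unfolding nsq_def
  proof (rule nn_integral_mono_AE)
    show "AE x in lborel. (ennreal (norm (g x)))\<^sup>2 \<le> (\<Sum>k. ?a k x)\<^sup>2"
      using summ
    proof eventually_elim
      fix x assume s: "summable (\<lambda>k. norm (f k x))"
      have "ennreal (norm (g x)) \<le> ennreal (\<Sum>k. norm (f k x))"
        unfolding g_def by (intro ennreal_leI summable_norm s)
      also have "\<dots> = (\<Sum>k. ?a k x)" by (rule suminf_ennreal2[symmetric]) (use s in auto)
      finally show "(ennreal (norm (g x)))\<^sup>2 \<le> (\<Sum>k. ?a k x)\<^sup>2" by (intro power_mono) auto
    qed
  qed
  with bound have g: "nsq g \<le> ennreal (4 * C)" by (rule order_trans[rotated])
  show ?thesis
  proof (intro exI[of _ g] conjI ballI impI g)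
    fix b :: "'a \<Rightarrow> complex"
    assume [measurable]: "b \<in> borel_measurable borel" and b: "nsq b < \<infinity>"
    have fk: "nsq (f k) < \<infinity>" for k using C[of k] by (simp add: le_less_trans)
    obtain B where B: "nsq b = ennreal B" "B \<ge> 0" using b by (cases "nsq b") auto
    have int: "integrable lborel (\<lambda>x. f k x * b x)" for k
      by (rule L2_mult_integrable) (use fk b in auto)
    have le: "(LINT x|lborel. norm (f k x * b x)) \<le> sqrt (C * B) * (sqrt (1 / 8)) ^ k" for k
    proof -
      have "ennreal ((LINT x|lborel. norm (f k x * b x))\<^sup>2) = (\<integral>\<^sup>+x. norm (f k x * b x) \<partial>lborel)\<^sup>2"
        using int[of k] by (simp add: nn_integral_eq_integral integral_nonneg_AE ennreal_power)
      also have "\<dots> \<le> ennreal (C * (1 / 8) ^ k) * ennreal B"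
        using L2_mult_integrable(1)[of "f k" b] mult_right_mono[OF C[of k], of "nsq b"] B by (simp add: order_trans)
      finally have "(LINT x|lborel. norm (f k x * b x))\<^sup>2 \<le> C * (1 / 8) ^ k * B"
        using B C0 by (simp flip: ennreal_mult)
      then have "(LINT x|lborel. norm (f k x * b x)) \<le> sqrt (C * (1 / 8) ^ k * B)"
        by (rule real_le_rsqrt)
      then show ?thesis by (simp add: real_sqrt_mult real_sqrt_power real_sqrt_divide power_divide mult_ac)
    qed
    have "(\<lambda>k. LINT x|lborel. f k x * b x) sums (LINT x|lborel. (\<Sum>k. f k x * b x))"
    proof (rule sums_integral[OF int])
      show "AE x in lborel. summable (\<lambda>i. norm (f i x * b x))"
        using summ by eventually_elim (simp add: norm_mult summable_mult2)
      show "summable (\<lambda>i. LINT x|lborel. norm (f i x * b x))"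
        by (rule summable_comparison_test'[where g = "\<lambda>k. sqrt (C * B) * (sqrt (1 / 8)) ^ k" and N = 0])
           (use le in \<open>auto intro!: summable_mult summable_geometric simp: integral_nonneg_AE\<close>)
    qed
    also have "(LINT x|lborel. (\<Sum>k. f k x * b x)) = (LINT x|lborel. g x * b x)"
    proof (rule integral_cong_AE)
      show "AE x in lborel. (\<Sum>k. f k x * b x) = g x * b x"
        using summ unfolding g_def
        by eventually_elim (rule suminf_mult2[symmetric], rule summable_norm_cancel)
    qed auto
    finally show "(\<lambda>k. LINT x|lborel. f k x * b x) sums (LINT x|lborel. g x * b x)" .
  qed auto
qed

section \<open>Regularisation and uniqueness of densities\<close>

text \<open>A quadratic remainder is the form of differentiability that survives integration over a
  parameter, which is how it is used for the Fourier transform and for circle averages.\<close>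

lemma has_derivative_quadratic:
  fixes f :: "'a::real_normed_vector \<Rightarrow> 'b::real_normed_vector"
  assumes L: "bounded_linear L" and d: "d > 0"
    and bound: "\<And>h. norm h < d \<Longrightarrow> norm (f (x + h) - f x - L h) \<le> K * (norm h)\<^sup>2"
  shows "(f has_derivative L) (at x)"
proof (rule has_derivativeI_sandwich[OF d L, where H = "\<lambda>y. K * norm (y - x)"])
  fix y assume y: "y \<noteq> x" "dist y x < d"
  then have "norm (f y - f x - L (y - x)) \<le> K * (norm (y - x))\<^sup>2"
    using bound[of "y - x"] by (simp add: dist_norm)
  then show "norm (f y - f x - L (y - x)) / norm (y - x) \<le> K * norm (y - x)"
    using y by (simp add: divide_simps power2_eq_square)
next
  have "((\<lambda>y. K * norm (y - x)) \<longlongrightarrow> K * norm (x - x)) (at x)"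
    by (intro tendsto_intros)
  then show "((\<lambda>y. K * norm (y - x)) \<longlongrightarrow> 0) (at x)" by simp
qed

lemma bounded_linear_coords: "bounded_linear (\<lambda>h::real^'n::finite. \<Sum>i\<in>UNIV. (h $ i) *\<^sub>R (D i :: complex))"
  by (intro bounded_linear_sum bounded_linear_scaleR_const bounded_linear_vec_nth)

lemma coords_axis: "(\<Sum>i\<in>UNIV. (axis j 1 $ i) *\<^sub>R (D i :: complex)) = D (j::'n::finite)"
proof -
  have "(\<Sum>i\<in>UNIV. (axis j 1 $ i) *\<^sub>R D i) = (\<Sum>i\<in>UNIV. if i = j then D i else 0)"
    by (intro sum.cong) (auto simp: axis_def)
  then show ?thesis by simp
qed

lemma finite_family_bound:
  assumes "\<And>i j. \<exists>C\<ge>0. \<forall>x. F i j x \<le> (C::real)"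
  shows "\<exists>C\<ge>0. \<forall>i j x. F (i::'i::finite) (j::'j::finite) x \<le> C"
proof -
  obtain C where C: "\<And>i j. C i j \<ge> 0" "\<And>i j x. F i j x \<le> C i j" using assms by metis
  have "C i j \<le> (\<Sum>i\<in>UNIV. \<Sum>j\<in>UNIV. C i j)" for i j
  proof -
    have "C i j \<le> (\<Sum>j\<in>UNIV. C i j)" by (rule member_le_sum) (use C in auto)
    also have "\<dots> \<le> (\<Sum>i\<in>UNIV. \<Sum>j\<in>UNIV. C i j)" by (rule member_le_sum) (use C in \<open>auto intro: sum_nonneg\<close>)
    finally show ?thesis .
  qed
  then have "F i j x \<le> (\<Sum>i\<in>UNIV. \<Sum>j\<in>UNIV. C i j)" for i j x
    using C(2) order_trans by blast
  moreover have "(\<Sum>i\<in>UNIV. \<Sum>j\<in>UNIV. C i j) \<ge> 0" by (intro sum_nonneg C)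
  ultimately show ?thesis by blast
qed

text \<open>The convolution of \<open>p\<close> with the indicator of \<open>B\<close>.\<close>

definition smear :: "(real^'n::finite) set \<Rightarrow> (real^'n \<Rightarrow> complex) \<Rightarrow> real^'n \<Rightarrow> complex" where
  "smear B p x = (LINT z|lborel. indicator B z * p (x - z))"

lemma smear_integrable:
  assumes "compact B" "p \<in> test_functions"
  shows "integrable lborel (\<lambda>z. indicator B z * p (x - z))"
proof -
  obtain C where C: "\<And>x. norm (p x) \<le> C" using test_functions_bounded[OF assms(2)] by blast
  have [measurable]: "p \<in> borel_measurable borel" "B \<in> sets borel"
    using assms by (auto intro: smooth_measurable test_functions_smooth borel_compact)
  have "integrable lborel (\<lambda>z. indicator B z *\<^sub>R p (x - z))"
    by (rule integrableI_bounded_set_indicator[where B = C])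
       (use C emeasure_compact_finite[OF assms(1)] in auto)
  moreover have "indicator B z *\<^sub>R p (x - z) = indicator B z * p (x - z)" for z by (simp add: indicator_def)
  ultimately show ?thesis by simp
qed

lemma smear_has_derivative:
  fixes p :: "real^'n::finite \<Rightarrow> complex"
  assumes B: "compact B" and p: "p \<in> test_functions"
  shows "(smear B p has_derivative (\<lambda>h. \<Sum>i\<in>UNIV. (h $ i) *\<^sub>R smear B (partial i p) x)) (at x)"
proof -
  have "\<exists>C\<ge>0. \<forall>x. norm (partial j (partial i p) x) \<le> C" for i j
    using test_functions_bounded[OF test_functions_partial[OF test_functions_partial[OF p]], of j i] by metis
  from finite_family_bound[where F = "\<lambda>i j x. norm (partial j (partial i p) x)", OF this] obtain C where C: "C \<ge> 0" "\<And>i j x. norm (partial j (partial i p) x) \<le> C" by metis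
  let ?K = "(real CARD('n))\<^sup>2 * C"
  have int: "integrable lborel (\<lambda>z. indicator B z * p (x - z))" for x by (rule smear_integrable[OF B p])
  have int': "integrable lborel (\<lambda>z. indicator B z * partial i p (x - z))" for x i
    by (rule smear_integrable[OF B test_functions_partial[OF p]])
  show ?thesis
  proof (rule has_derivative_quadratic[OF bounded_linear_coords zero_less_one, where K = "?K * measure lborel B"])
    fix h :: "real^'n"
    let ?r = "\<lambda>z. p (x - z + h) - p (x - z) - (\<Sum>i\<in>UNIV. (h $ i) *\<^sub>R partial i p (x - z))"
    have r: "norm (?r z) \<le> ?K * (norm h)\<^sup>2" for z
      using smooth_quadratic_taylor[OF test_functions_smooth[OF p], of "x - z" h C] C by simp
    have eq: "smear B p (x + h) - smear B p x - (\<Sum>i\<in>UNIV. (h $ i) *\<^sub>R smear B (partial i p) x)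
        = (LINT z|lborel. indicator B z * ?r z)"
    proof -
      have "(LINT z|lborel. indicator B z * ?r z) =
        (LINT z|lborel. indicator B z * p ((x + h) - z) - indicator B z * p (x - z) - (\<Sum>i\<in>UNIV. (h $ i) *\<^sub>R (indicator B z * partial i p (x - z))))"
        by (intro Bochner_Integration.integral_cong refl)
           (simp add: algebra_simps sum_distrib_left)
      also have "\<dots> = smear B p (x + h) - smear B p x - (\<Sum>i\<in>UNIV. (h $ i) *\<^sub>R smear B (partial i p) x)"
        unfolding smear_def
        by (subst Bochner_Integration.integral_diff Bochner_Integration.integral_sum,
            auto intro!: int int' Bochner_Integration.integrable_diff Bochner_Integration.integrable_sum integrable_scaleR_right)+
      finally show ?thesis by simp
    qed
    have "norm (LINT z|lborel. indicator B z * ?r z) \<le> (LINT z|lborel. indicator B z * (?K * (norm h)\<^sup>2))"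
    proof (rule Bochner_Integration.integral_norm_bound_integral)
      have "indicator B z * ?r z = indicator B z * p ((x + h) - z) - indicator B z * p (x - z) - (\<Sum>i\<in>UNIV. (h $ i) *\<^sub>R (indicator B z * partial i p (x - z)))" for z
        by (simp add: algebra_simps sum_distrib_left)
      then show "integrable lborel (\<lambda>z. indicator B z * ?r z)"
        by (simp only:) (intro int int' Bochner_Integration.integrable_diff Bochner_Integration.integrable_sum integrable_scaleR_right)
      show "integrable lborel (\<lambda>z. indicator B z * (?K * (norm h)\<^sup>2))"
        using emeasure_compact_finite[OF B] B by (intro integrable_mult_left integrable_real_indicator) (auto intro: borel_compact)
      show "norm (indicator B z * ?r z) \<le> indicator B z * (?K * (norm h)\<^sup>2)" for z
        using r[of z] by (auto simp: indicator_def)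
    qed
    also have "\<dots> = ?K * measure lborel B * (norm h)\<^sup>2"
      using B by (simp add: borel_compact)
    finally show "norm (smear B p (x + h) - smear B p x - (\<Sum>i\<in>UNIV. (h $ i) *\<^sub>R smear B (partial i p) x)) \<le> ?K * measure lborel B * (norm h)\<^sup>2"
      unfolding eq .
  qed
qed

lemma smear_test_functions:
  fixes p :: "real^'n::finite \<Rightarrow> complex"
  assumes B: "compact B" and p: "p \<in> test_functions"
  shows "smear B p \<in> test_functions"
proof -
  have "smooth (smear B p)"
  proof (rule smooth_coinduct[where A = "smear B ` test_functions"])
    fix h i assume "h \<in> smear B ` test_functions"
    then obtain p where h: "h = smear B p" "p \<in> test_functions" by auto
    show "h differentiable_on UNIV"
      unfolding h differentiable_on_def using smear_has_derivative[OF B h(2)]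
      by (auto simp: differentiable_def)
    have "partial i h = smear B (partial i p)"
      unfolding h by (rule ext, subst partial_eq[OF smear_has_derivative[OF B h(2)]]) (rule coords_axis)
    then show "partial i h \<in> smear B ` test_functions"
      using test_functions_partial[OF h(2)] by auto
  qed (use p in auto)
  obtain R where R: "\<And>x. norm x > R \<Longrightarrow> p x = 0" using p by (auto simp: test_functions_iff)
  obtain R' where R': "\<And>x. x \<in> B \<Longrightarrow> norm x \<le> R'" using compact_imp_bounded[OF B] by (auto simp: bounded_iff)
  have "smear B p x = 0" if "norm x > R + R'" for x
  proof -
    have "indicator B z * p (x - z) = 0" for z
    proof (cases "z \<in> B")
      case True
      then have "norm (x - z) > R" using R'[OF True] that norm_triangle_ineq2[of x z] by linarith
      then show ?thesis by (simp add: R)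
    qed auto
    then have "(\<lambda>z. indicator B z * p (x - z)) = (\<lambda>z. 0)" by blast
    then show ?thesis by (simp add: smear_def)
  qed
  with \<open>smooth (smear B p)\<close> show ?thesis by (intro test_functionsI)
qed

lemma open_AE_notin_empty:
  fixes S :: "'a::euclidean_space set"
  assumes o: "open S" and ae: "AE x in lborel. x \<notin> S"
  shows "S = {}"
proof (rule ccontr)
  assume "S \<noteq> {}"
  have "S \<in> sets lborel" using o by simp
  then have "S \<in> null_sets lborel" using ae AE_iff_null_sets by blast
  then have "negligible S" unfolding negligible_iff_null_sets by (rule null_sets_completionI)
  with open_not_negligible[OF o \<open>S \<noteq> {}\<close>] show False by blast
qed

text \<open>The existence of any nonzero test function \<open>h\<close> yields mollifiers: normalise the integral of
  a dilation of \<open>\<bar>h\<bar>\<^sup>2\<close>. A uniformly local Sobolev distribution always comes with such an \<open>h\<close>,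
  so no explicit bump function has to be constructed.\<close>

lemma ex_mollifier:
  fixes h :: "real^'n::finite \<Rightarrow> complex"
  assumes h: "h \<in> test_functions" "h \<noteq> (\<lambda>x. 0)" and d: "\<delta> > 0"
  obtains p :: "real^'n \<Rightarrow> real" where "(\<lambda>x. complex_of_real (p x)) \<in> test_functions" "\<And>x. p x \<ge> 0" "(LINT x|lborel. p x) = (1::real)"
    "integrable lborel p" "\<And>x. norm x > \<delta> \<Longrightarrow> p x = 0"
proof -
  obtain R where R: "\<And>x. norm x > R \<Longrightarrow> h x = 0" using h by (auto simp: test_functions_iff)
  define c where "c = (max R 1) / \<delta>"
  have c: "c > 0" using d by (simp add: c_def)
  define q where "q x = (norm (h (c *\<^sub>R x)))\<^sup>2" for x
  have q: "(\<lambda>x. complex_of_real (q x)) \<in> test_functions"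
  proof -
    have "(\<lambda>x. h (c *\<^sub>R x)) \<in> test_functions" using test_functions_affine[OF h(1), of c 0] c by simp
    then have "(\<lambda>x. h (c *\<^sub>R x) * cnj (h (c *\<^sub>R x))) \<in> test_functions"
      by (intro test_functions_mult test_functions_smooth test_functions_cnj)
    then show ?thesis by (simp add: q_def complex_norm_square del: of_real_power)
  qed
  have int: "integrable lborel q"
    using test_functions_integrable[OF q] by (simp add: complex_of_real_integrable_eq)
  have cont: "continuous_on UNIV q"
    unfolding q_def by (intro continuous_intros continuous_on_compose2[OF smooth_continuous_on[OF test_functions_smooth[OF h(1)]]]) auto
  have q_nn: "AE x in lborel. 0 \<le> q x" by (simp add: q_def)
  obtain x0 where x0: "h x0 \<noteq> 0" using h(2) by auto
  have pos: "(LINT x|lborel. q x) > 0"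
  proof -
    have "(LINT x|lborel. q x) \<noteq> 0"
    proof
      assume "(LINT x|lborel. q x) = 0"
      then have "AE x in lborel. q x = 0"
        using integral_nonneg_eq_0_iff_AE[OF int] q_nn by simp
      moreover have "open {x. q x \<noteq> 0}"
        by (intro open_Collect_neq cont continuous_on_const)
      ultimately have "{x. q x \<noteq> 0} = {}" using open_AE_notin_empty[of "{x. q x \<noteq> 0}"] by simp
      moreover have "q (x0 /\<^sub>R c) \<noteq> 0" using x0 c by (simp add: q_def)
      ultimately show False by auto
    qed
    moreover have "(LINT x|lborel. q x) \<ge> 0" by (intro integral_nonneg_AE) (simp add: q_def)
    ultimately show ?thesis by linarith
  qed
  define I where "I = (LINT x|lborel. q x)"
  show ?thesis
  proof (rule that[of "\<lambda>x. q x / I"])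
    show "(\<lambda>x. complex_of_real (q x / I)) \<in> test_functions"
      using test_functions_cmult[OF q, of "inverse (of_real I)"] by (simp add: divide_inverse mult.commute)
    show "q x / I \<ge> 0" for x using pos by (simp add: I_def q_def)
    show "(LINT x|lborel. q x / I) = 1" using pos by (simp add: I_def)
    show "integrable lborel (\<lambda>x. q x / I)" using int by simp
    fix x :: "real^'n" assume x: "norm x > \<delta>"
    have "R \<le> c * \<delta>" using d by (simp add: c_def)
    also have "\<dots> < c * norm x" using x c by simp
    finally have "norm (c *\<^sub>R x) > R" using c by simp
    then show "q x / I = 0" by (simp add: q_def R)
  qed
qed

text \<open>A smooth cutoff function for a compact set is the convolution of the indicator of a
  neighbourhood with a mollifier.\<close>

lemma ex_cutoff:
  fixes h :: "real^'n::finite \<Rightarrow> complex" and B :: "(real^'n) set"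
  assumes h: "h \<in> test_functions" "h \<noteq> (\<lambda>x. 0)" and d: "\<delta> > 0" and B: "compact B"
  shows "\<exists>\<phi>. \<phi> \<in> test_functions \<and> (\<forall>x\<in>B. \<phi> x = 1) \<and> (\<forall>x. norm (\<phi> x) \<le> 1) \<and>
    (\<forall>x. \<phi> x \<noteq> 0 \<longrightarrow> (\<exists>b\<in>B. dist x b \<le> \<delta>))"
proof (rule ex_mollifier[OF h half_gt_zero[OF d]])
  fix p :: "real^'n \<Rightarrow> real"
  assume p: "(\<lambda>x. complex_of_real (p x)) \<in> test_functions" "\<And>x. p x \<ge> 0" "(LINT x|lborel. p x) = (1::real)"
    "integrable lborel p" "\<And>x. norm x > \<delta> / 2 \<Longrightarrow> p x = 0"
  let ?p = "\<lambda>x. complex_of_real (p x)"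
  define B' where "B' = {b + z |b z. b \<in> B \<and> z \<in> cball 0 (\<delta> / 2)}"
  have B': "compact B'" unfolding B'_def by (intro compact_sums B compact_cball)
  have [measurable]: "?p \<in> borel_measurable borel" "p \<in> borel_measurable borel" "B' \<in> sets borel"
    using p(1,4) B' by (auto intro: smooth_measurable test_functions_smooth borel_compact)
  have eq: "smear B' ?p x = (LINT z|lborel. indicator B' (x - z) * ?p z)" for x
    using integral_lborel_reflect[of "\<lambda>z. indicator B' (x - z) * ?p z" x] by (simp add: smear_def)
  have int: "(LINT z|lborel. ?p z) = 1" using p(3) by simp
  show ?thesis
  proof (intro exI[of _ "smear B' ?p"] conjI ballI allI impI)
    show "smear B' ?p \<in> test_functions" by (rule smear_test_functions[OF B' p(1)])
    show "smear B' ?p x = 1" if "x \<in> B" for x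
    proof -
      have "indicator B' (x - z) * ?p z = ?p z" for z
      proof (cases "norm z > \<delta> / 2")
        case False
        then have "x - z \<in> B'" unfolding B'_def mem_Collect_eq using that by (intro exI[of _ x] exI[of _ "- z"]) auto
        then show ?thesis by simp
      qed (use p(5) in auto)
      then have "(\<lambda>z. indicator B' (x - z) * ?p z) = ?p" by blast
      then show ?thesis using int by (simp only: eq)
    qed
    show "norm (smear B' ?p x) \<le> 1" for x
    proof -
      have "norm (smear B' ?p x) \<le> (LINT z|lborel. p z)"
        unfolding eq
      proof (rule Bochner_Integration.integral_norm_bound_integral)
        show "integrable lborel (\<lambda>z. indicator B' (x - z) * ?p z)"
          by (rule Bochner_Integration.integrable_bound[OF p(4)]) (auto simp: indicator_def p(2))
      qed (use p in \<open>auto simp: indicator_def\<close>)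
      then show ?thesis using p(3) by simp
    qed
    show "\<exists>b\<in>B. dist x b \<le> \<delta>" if "smear B' ?p x \<noteq> 0" for x
    proof -
      have "\<exists>z. indicator B' (x - z) * ?p z \<noteq> 0"
      proof (rule ccontr)
        assume "\<not> ?thesis"
        then have "(\<lambda>z. indicator B' (x - z) * ?p z) = (\<lambda>z. 0)" by blast
        then have "smear B' ?p x = 0" by (simp only: eq integral_zero)
        with that show False by simp
      qed
      then obtain z where z: "indicator B' (x - z) * ?p z \<noteq> 0" by blast
      then have "x - z \<in> B'" "norm z \<le> \<delta> / 2" using p(5)[of z] by (auto simp: indicator_def not_less[symmetric] split: if_splits)
      then obtain b y where bz: "x - z = b + y" "b \<in> B" "norm y \<le> \<delta> / 2" by (auto simp: B'_def)
      then have "x - b = y + z" by (simp add: algebra_simps)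
      then have "dist x b \<le> \<delta>" using norm_triangle_ineq[of y z] bz(3) \<open>norm z \<le> \<delta> / 2\<close> by (simp add: dist_norm)
      with bz show ?thesis by blast
    qed
  qed
qed

text \<open>Smooth cutoffs approximate the indicator of a compact set boundedly, so \<open>f\<close> has integral \<open>0\<close>
  over every compact set, and hence over every Borel subset of a ball.\<close>

lemma orthogonal_test_functions_AE_0:
  fixes f h :: "real^'n::finite \<Rightarrow> complex"
  assumes h: "h \<in> test_functions" "h \<noteq> (\<lambda>x. 0)"
    and [measurable]: "f \<in> borel_measurable borel"
    and loc: "\<And>R. integrable lborel (\<lambda>x. indicator (cball 0 R) x *\<^sub>R f x)"
    and orth: "\<And>\<phi>. \<phi> \<in> test_functions \<Longrightarrow> (LINT x|lborel. f x * \<phi> x) = 0"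
  shows "AE x in lborel. f x = 0"
proof -
  have compact0: "(LINT x|lborel. indicator B x *\<^sub>R f x) = 0" if B: "compact B" for B
  proof -
    obtain R where R: "\<And>x. x \<in> B \<Longrightarrow> norm x \<le> R" using compact_imp_bounded[OF B] by (auto simp: bounded_iff)
    have "\<exists>\<phi>. \<phi> \<in> test_functions \<and> (\<forall>x\<in>B. \<phi> x = 1) \<and> (\<forall>x. norm (\<phi> x) \<le> 1) \<and>
        (\<forall>x. \<phi> x \<noteq> 0 \<longrightarrow> (\<exists>b\<in>B. dist x b \<le> 1 / real (Suc m)))" for m
      by (rule ex_cutoff[OF h _ B]) simp
    then obtain \<phi> where \<phi>: "\<And>m. \<phi> m \<in> test_functions" "\<And>m x. x \<in> B \<Longrightarrow> \<phi> m x = 1" "\<And>m x. norm (\<phi> m x) \<le> 1"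
        "\<And>m x. \<phi> m x \<noteq> 0 \<Longrightarrow> \<exists>b\<in>B. dist x b \<le> 1 / real (Suc m)"
      by metis
    have [measurable]: "\<phi> m \<in> borel_measurable borel" "B \<in> sets borel" for m
      using \<phi>(1) B by (auto intro: smooth_measurable test_functions_smooth borel_compact)
    have "(\<lambda>m. LINT x|lborel. f x * \<phi> m x) \<longlonglongrightarrow> (LINT x|lborel. indicator B x *\<^sub>R f x)"
    proof (rule integral_dominated_convergence[where w = "\<lambda>x. norm (indicator (cball 0 (R + 1)) x *\<^sub>R f x)"])
      show "integrable lborel (\<lambda>x. norm (indicator (cball 0 (R + 1)) x *\<^sub>R f x))"
        using loc by (rule integrable_norm)
      show "AE x in lborel. (\<lambda>m. f x * \<phi> m x) \<longlonglongrightarrow> indicator B x *\<^sub>R f x"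
      proof (rule AE_I2)
        fix x
        show "(\<lambda>m. f x * \<phi> m x) \<longlonglongrightarrow> indicator B x *\<^sub>R f x"
        proof (cases "x \<in> B")
          case False
          have "closed B" using B by (rule compact_imp_closed)
          then obtain e where e: "e > 0" "\<And>b. b \<in> B \<Longrightarrow> dist x b \<ge> e"
            using False by (metis separate_point_closed)
          obtain M where M: "1 / real (Suc M) < e" using e(1) nat_approx_posE by blast
          have "\<phi> m x = 0" if "m \<ge> M" for m
          proof (rule ccontr)
            assume "\<phi> m x \<noteq> 0"
            then obtain b where "b \<in> B" "dist x b \<le> 1 / real (Suc m)" using \<phi>(4) by blast
            moreover have "1 / real (Suc m) \<le> 1 / real (Suc M)" using that by (simp add: field_simps)
            ultimately show False using e(2)[of b] M by linarith
          qed
          then have "\<forall>\<^sub>F m in sequentially. f x * \<phi> m x = 0"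
            unfolding eventually_sequentially by (intro exI[of _ M]) auto
          then show ?thesis using False by (simp add: tendsto_eventually)
        qed (simp add: \<phi>(2))
      qed
      show "AE x in lborel. norm (f x * \<phi> m x) \<le> norm (indicator (cball 0 (R + 1)) x *\<^sub>R f x)" for m
      proof (rule AE_I2)
        fix x
        show "norm (f x * \<phi> m x) \<le> norm (indicator (cball 0 (R + 1)) x *\<^sub>R f x)"
        proof (cases "\<phi> m x = 0")
          case False
          then obtain b where b: "b \<in> B" "dist x b \<le> 1 / real (Suc m)" using \<phi>(4) by blast
          have "1 / real (Suc m) \<le> 1" by simp
          with b(2) have "dist x b \<le> 1" by (rule order_trans)
          then have "norm x \<le> R + 1"
            using b R[OF b(1)] norm_triangle_ineq[of b "x - b"] by (simp add: dist_norm)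
          then show ?thesis using \<phi>(3)[of m x] by (simp add: norm_mult mult_left_le)
        qed simp
      qed
    qed auto
    then have "(\<lambda>m. 0) \<longlonglongrightarrow> (LINT x|lborel. indicator B x *\<^sub>R f x)" by (simp add: orth \<phi>(1))
    then show ?thesis by (simp add: LIMSEQ_const_iff)
  qed
  have "AE x in lborel. indicator (cball 0 (real k)) x *\<^sub>R f x = 0" for k
  proof (rule sigma_finite_measure.density_zero[OF sigma_finite_lborel])
    let ?g = "\<lambda>x. indicator (cball 0 (real k)) x *\<^sub>R f x"
    show int: "integrable lborel ?g" by (rule loc)
    fix A :: "(real^'n) set" assume "A \<in> sets lborel"
    then have "A \<in> sigma_sets UNIV (Collect closed)"
      unfolding sets_lborel borel_eq_closed by (simp add: sets_measure_of)
    have int_A: "integrable lborel (\<lambda>x. indicator A x *\<^sub>R ?g x)" if "A \<in> sigma_sets UNIV (Collect closed)" for A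
    proof -
      have "A \<in> sets lborel" using that unfolding sets_lborel borel_eq_closed by (simp add: sets_measure_of)
      then show ?thesis by (rule integrable_mult_indicator[OF _ int])
    qed
    have "Int_stable (Collect closed :: (real^'n) set set)" by (auto simp: Int_stable_def)
    moreover have "Collect closed \<subseteq> Pow (UNIV :: (real^'n) set)" by auto
    ultimately have "(LINT x|lborel. indicator A x *\<^sub>R ?g x) = 0"
      using \<open>A \<in> sigma_sets UNIV (Collect closed)\<close>
    proof (induction rule: sigma_sets_induct_disjoint)
      case (basic A)
      then have "compact (A \<inter> cball 0 (real k))" by (auto intro: closed_Int_compact)
      from compact0[OF this] show ?case by (simp add: indicator_inter_arith mult.commute)
    next
      case (compl A)
      have "compact (cball 0 (real k) :: (real^'n) set)" by simp
      have "(LINT x|lborel. indicator (UNIV - A) x *\<^sub>R ?g x) = (LINT x|lborel. ?g x - indicator A x *\<^sub>R ?g x)"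
        by (intro Bochner_Integration.integral_cong) (auto simp: indicator_def)
      also have "\<dots> = 0" using compl int int_A[OF compl(1)] compact0[OF \<open>compact (cball 0 (real k))\<close>]
        by (subst Bochner_Integration.integral_diff) auto
      finally show ?case .
    next
      case (union A)
      have d: "disjoint_family A" and m: "\<And>i. A i \<in> sets lborel"
        using union unfolding sets_lborel borel_eq_closed by (auto simp: sets_measure_of)
      from m have U: "(\<Union>i. A i) \<in> sets lborel" by auto
      have "(LINT x:(\<Union>i. A i)|lborel. ?g x) = (\<Sum>i. (LINT x:A i|lborel. ?g x))"
      proof (rule lebesgue_integral_countable_add[OF m])
        show "set_integrable lborel (\<Union>i. A i) ?g"
          unfolding set_integrable_def by (rule integrable_mult_indicator[OF U int])
      qed (use d in \<open>auto simp: disjoint_family_on_def\<close>)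
      then show ?case using union by (simp add: set_lebesgue_integral_def)
    qed auto
    then show "set_lebesgue_integral lborel A ?g = 0" by (simp add: set_lebesgue_integral_def)
  qed
  then have "AE x in lborel. \<forall>k. indicator (cball 0 (real k)) x *\<^sub>R f x = 0"
    unfolding AE_all_countable by blast
  then show ?thesis
  proof eventually_elim
    fix x assume 0: "\<forall>k. indicator (cball 0 (real k)) x *\<^sub>R f x = 0"
    obtain k where "norm x \<le> real k" using real_arch_simple by blast
    with 0[rule_format, of k] show "f x = 0" by simp
  qed
qed

lemma AE_0_continuous:
  fixes f :: "real^'n::finite \<Rightarrow> complex"
  assumes "AE x in lborel. f x = 0" "continuous_on UNIV f"
  shows "f x = 0"
proof (rule ccontr)
  assume x: "f x \<noteq> 0"
  have o: "open {x. f x \<noteq> 0}" by (intro open_Collect_neq assms continuous_on_const)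
  from open_AE_notin_empty[OF this] assms(1) x show False by auto
qed

lemma continuous_locally_integrable:
  fixes f :: "real^'n::finite \<Rightarrow> complex"
  assumes "continuous_on UNIV f"
  shows "integrable lborel (\<lambda>x. indicator (cball 0 R) x *\<^sub>R f x)"
  using borel_integrable_compact[OF compact_cball continuous_on_subset[OF assms], of 0 R]
  by (simp add: indicator_def if_distrib cong: if_cong)

lemma continuous_test_integrable:
  fixes f \<phi> :: "real^'n::finite \<Rightarrow> complex"
  assumes f: "continuous_on UNIV f" and \<phi>: "\<phi> \<in> test_functions"
  shows "integrable lborel (\<lambda>x. f x * \<phi> x)"
proof -
  obtain R where R: "\<And>x. norm x > R \<Longrightarrow> \<phi> x = 0" using \<phi> by (auto simp: test_functions_iff)
  have "(\<lambda>x. f x * \<phi> x) = (\<lambda>x. indicator (cball 0 R) x *\<^sub>R (f x * \<phi> x))"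
    using R by (auto simp: indicator_def fun_eq_iff not_le)
  moreover have "integrable lborel \<dots>"
    by (intro continuous_locally_integrable continuous_intros f smooth_continuous_on test_functions_smooth \<phi>)
  ultimately show ?thesis by simp
qed

lemma continuous_distr_unique:
  fixes f g h :: "real^'n::finite \<Rightarrow> complex"
  assumes h: "h \<in> test_functions" "h \<noteq> (\<lambda>x. 0)"
    and fg: "continuous_on UNIV f" "continuous_on UNIV g"
    and eq: "\<And>\<phi>. \<phi> \<in> test_functions \<Longrightarrow> distr_of_fun f \<phi> = distr_of_fun g \<phi>"
  shows "f = g"
proof -
  have c: "continuous_on UNIV (\<lambda>x. f x - g x)" by (intro continuous_intros fg)
  have "AE x in lborel. f x - g x = 0"
  proof (rule orthogonal_test_functions_AE_0[OF h])
    show "(\<lambda>x. f x - g x) \<in> borel_measurable borel" by (intro borel_measurable_continuous_onI c)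
    show "integrable lborel (\<lambda>x. indicator (cball 0 R) x *\<^sub>R (f x - g x))" for R
      by (rule continuous_locally_integrable[OF c])
    show "(LINT x|lborel. (f x - g x) * \<phi> x) = 0" if "\<phi> \<in> test_functions" for \<phi>
      using eq[OF that] continuous_test_integrable[OF fg(1) that] continuous_test_integrable[OF fg(2) that]
      by (simp add: distr_of_fun_def left_diff_distrib)
  qed
  from AE_0_continuous[OF this c] show ?thesis by (simp add: fun_eq_iff)
qed

section \<open>The Fourier transform\<close>

lemma cis_measurable [measurable]: "cis \<in> borel_measurable borel"
  by (intro borel_measurable_continuous_onI continuous_intros)

lemma integrable_unimodular:
  fixes f :: "'a \<Rightarrow> complex"
  assumes "integrable M f" "c \<in> borel_measurable M" "\<And>x. norm (c x) \<le> 1"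
  shows "integrable M (\<lambda>x. c x * f x)"
  by (rule Bochner_Integration.integrable_bound[OF assms(1)])
     (use assms in \<open>auto simp: norm_mult mult_left_le_one_le\<close>)

lemma fourier_integrable:
  "integrable lborel \<phi> \<Longrightarrow> integrable lborel (\<lambda>x. cis (- (x \<bullet> \<xi>)) * \<phi> x)"
  by (rule integrable_unimodular) auto

lemma fourier_norm_le: "integrable lborel \<phi> \<Longrightarrow> norm (fourier \<phi> \<xi>) \<le> (LINT x|lborel. norm (\<phi> x))"
  unfolding fourier_def
  by (rule order_trans[OF integral_norm_bound]) (simp add: norm_mult)

lemma fourier_norm_le_nn: "\<phi> \<in> borel_measurable borel \<Longrightarrow> ennreal (norm (fourier \<phi> \<xi>)) \<le> (\<integral>\<^sup>+x. norm (\<phi> x) \<partial>lborel)"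
  unfolding fourier_def
  by (rule order_trans[OF norm_integral_le_nn_integral]) (auto simp: norm_mult)

lemma fourier_continuous:
  fixes \<phi> :: "real^'n::finite \<Rightarrow> complex"
  assumes "integrable lborel \<phi>" shows "continuous_on S (fourier \<phi>)"
proof -
  have "isCont (fourier \<phi>) \<xi>" for \<xi>
    unfolding continuous_at_sequentially comp_def
  proof (intro allI impI)
    fix X assume X: "X \<longlonglongrightarrow> \<xi>"
    show "(\<lambda>k. fourier \<phi> (X k)) \<longlonglongrightarrow> fourier \<phi> \<xi>"
      unfolding fourier_def
    proof (rule integral_dominated_convergence[where w = "\<lambda>x. norm (\<phi> x)"])
      show "AE x in lborel. (\<lambda>k. cis (- (x \<bullet> X k)) * \<phi> x) \<longlonglongrightarrow> cis (- (x \<bullet> \<xi>)) * \<phi> x"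
      proof (rule AE_I2)
        fix x
        have "(\<lambda>k. cis (- (x \<bullet> X k))) \<longlonglongrightarrow> cis (- (x \<bullet> \<xi>))"
        proof (rule continuous_on_tendsto_compose[where f = cis and s = UNIV])
          show "(\<lambda>k. - (x \<bullet> X k)) \<longlonglongrightarrow> - (x \<bullet> \<xi>)" by (intro tendsto_minus tendsto_inner tendsto_const X)
        qed (auto intro!: continuous_intros)
        then show "(\<lambda>k. cis (- (x \<bullet> X k)) * \<phi> x) \<longlonglongrightarrow> cis (- (x \<bullet> \<xi>)) * \<phi> x"
          by (rule tendsto_mult_right)
      qed
    qed (use assms in \<open>auto simp: norm_mult\<close>)
  qed
  then show ?thesis by (simp add: continuous_at_imp_continuous_on)
qed

lemma fourier_measurable: "integrable lborel \<phi> \<Longrightarrow> fourier \<phi> \<in> borel_measurable borel"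
  by (intro borel_measurable_continuous_onI fourier_continuous)

lemma integrable_pair_product:
  fixes f g :: "'a::euclidean_space \<Rightarrow> complex"
  assumes f: "integrable lborel f" and g: "integrable lborel g"
  shows "integrable (lborel \<Otimes>\<^sub>M lborel) (\<lambda>(x, y). f x * g y)"
proof -
  have [measurable]: "f \<in> borel_measurable borel" "g \<in> borel_measurable borel" using f g by auto
  show ?thesis
  proof (rule lborel_pair.Fubini_integrable)
    show "integrable lborel (\<lambda>x. LINT y|lborel. norm (case (x, y) of (x, y) \<Rightarrow> f x * g y))"
      using f by (simp add: norm_mult)
    show "AE x in lborel. integrable lborel (\<lambda>y. case (x, y) of (x, y) \<Rightarrow> f x * g y)"
      using g by simp
  qed measurable
qed

text \<open>The transpose of the Fourier transform is the Fourier transform.\<close>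

lemma fourier_duality:
  fixes f g :: "real^'n::finite \<Rightarrow> complex"
  assumes f: "integrable lborel f" and g: "integrable lborel g"
  shows "(LINT \<xi>|lborel. fourier f \<xi> * g \<xi>) = (LINT x|lborel. f x * fourier g x)"
proof -
  have [measurable]: "f \<in> borel_measurable borel" "g \<in> borel_measurable borel" using f g by auto
  let ?k = "\<lambda>x \<xi>. cis (- (x \<bullet> \<xi>)) * (f x * g \<xi>)"
  have "integrable (lborel \<Otimes>\<^sub>M lborel) (\<lambda>p. cis (- (fst p \<bullet> snd p)) * (case p of (x, \<xi>) \<Rightarrow> f x * g \<xi>))"
    by (rule integrable_unimodular[OF integrable_pair_product[OF f g]]) auto
  then have int: "integrable (lborel \<Otimes>\<^sub>M lborel) (case_prod ?k)"
    by (simp add: case_prod_unfold)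
  have "(LINT \<xi>|lborel. fourier f \<xi> * g \<xi>) = (LINT \<xi>|lborel. (LINT x|lborel. ?k x \<xi>))"
    unfolding fourier_def by (simp add: mult.assoc flip: integral_mult_left_zero)
  also have "\<dots> = (LINT x|lborel. (LINT \<xi>|lborel. ?k x \<xi>))"
    by (rule lborel_pair.Fubini_integral[OF int])
  also have "\<dots> = (LINT x|lborel. f x * fourier g x)"
    unfolding fourier_def by (simp add: mult_ac inner_commute flip: integral_mult_right_zero)
  finally show ?thesis .
qed

lemma fourier_modulate: "fourier (\<lambda>x. cis (- (x \<bullet> a)) * f x) \<xi> = fourier f (\<xi> + a)"
  unfolding fourier_def by (simp add: inner_add_right mult.assoc[symmetric] cis_mult)

lemma fourier_cmult: "fourier (\<lambda>x. c * f x) \<xi> = c * fourier f \<xi>"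
  unfolding fourier_def by (simp add: mult.left_commute flip: integral_mult_right_zero)

lemma fourier_reflect:
  assumes "f \<in> borel_measurable borel"
  shows "fourier (\<lambda>x. f (- x)) \<xi> = fourier f (- \<xi>)"
  using integral_lborel_reflect[of "\<lambda>x. cis (- (x \<bullet> - \<xi>)) * f x" 0] assms
  by (simp add: fourier_def)

lemma fourier_cnj:
  assumes "integrable lborel f"
  shows "fourier (\<lambda>x. cnj (f x)) \<xi> = cnj (fourier f (- \<xi>))"
proof -
  have "(LINT x|lborel. cnj (cis (- (x \<bullet> - \<xi>)) * f x)) = cnj (LINT x|lborel. cis (- (x \<bullet> - \<xi>)) * f x)"
    by (rule Bochner_Integration.integral_cnj)
  then show ?thesis by (simp add: fourier_def cis_cnj)
qed

definition conv :: "(real^'n::finite \<Rightarrow> complex) \<Rightarrow> (real^'n \<Rightarrow> complex) \<Rightarrow> real^'n \<Rightarrow> complex" where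
  "conv P Q \<eta> = (LINT \<xi>|lborel. P (\<eta> - \<xi>) * Q \<xi>)"

lemma conv_measurable [measurable]:
  assumes [measurable]: "P \<in> borel_measurable borel" "Q \<in> borel_measurable borel"
  shows "conv P Q \<in> borel_measurable borel"
  unfolding conv_def by measurable

lemma conv_norm_le:
  assumes [measurable]: "P \<in> borel_measurable borel" "Q \<in> borel_measurable borel"
  shows "ennreal (norm (conv P Q \<eta>)) \<le> (\<integral>\<^sup>+\<xi>. ennreal (norm (P (\<eta> - \<xi>))) * ennreal (norm (Q \<xi>)) \<partial>lborel)"
  unfolding conv_def
  by (rule order_trans[OF norm_integral_le_nn_integral]) (auto simp: norm_mult ennreal_mult')

lemma fourier_conv:
  fixes P Q :: "real^'n::finite \<Rightarrow> complex"
  assumes P: "integrable lborel P" and Q: "integrable lborel Q"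
  shows "fourier (conv P Q) x = fourier P x * fourier Q x"
proof -
  have [measurable]: "P \<in> borel_measurable borel" "Q \<in> borel_measurable borel" using P Q by auto
  let ?k = "\<lambda>\<eta> \<xi>. cis (- (\<eta> \<bullet> x)) * (P (\<eta> - \<xi>) * Q \<xi>)"
  have "(\<integral>\<^sup>+p. norm (P (fst p - snd p) * Q (snd p)) \<partial>(lborel \<Otimes>\<^sub>M lborel))
      = (\<integral>\<^sup>+\<eta>. (\<integral>\<^sup>+\<xi>. ennreal (norm (P (\<eta> - \<xi>))) * ennreal (norm (Q \<xi>)) \<partial>lborel) \<partial>lborel)"
    by (subst lborel.nn_integral_fst[symmetric]) (auto simp: norm_mult ennreal_mult')
  also have "\<dots> = (\<integral>\<^sup>+\<xi>. norm (P \<xi>) \<partial>lborel) * (\<integral>\<^sup>+\<xi>. norm (Q \<xi>) \<partial>lborel)"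
    by (rule nn_integral_convolution) auto
  also have "\<dots> < \<infinity>" using P Q by (simp add: integrable_iff_bounded ennreal_mult_less_top)
  finally have "integrable (lborel \<Otimes>\<^sub>M lborel) (\<lambda>p. P (fst p - snd p) * Q (snd p))"
    by (intro integrableI_bounded) auto
  then have "integrable (lborel \<Otimes>\<^sub>M lborel) (\<lambda>p. cis (- (fst p \<bullet> x)) * (P (fst p - snd p) * Q (snd p)))"
    by (rule integrable_unimodular) auto
  then have int: "integrable (lborel \<Otimes>\<^sub>M lborel) (case_prod ?k)"
    by (simp add: case_prod_unfold)
  have "fourier (conv P Q) x = (LINT \<eta>|lborel. (LINT \<xi>|lborel. ?k \<eta> \<xi>))"
    unfolding fourier_def conv_def by (simp flip: integral_mult_right_zero)
  also have "\<dots> = (LINT \<xi>|lborel. (LINT \<eta>|lborel. ?k \<eta> \<xi>))"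
    by (rule lborel_pair.Fubini_integral[OF int, symmetric])
  also have "\<dots> = (LINT \<xi>|lborel. fourier P x * (cis (- (\<xi> \<bullet> x)) * Q \<xi>))"
  proof (rule Bochner_Integration.integral_cong[OF refl])
    fix \<xi> :: "real^'n"
    have "(LINT \<eta>|lborel. ?k \<eta> \<xi>) = (LINT \<eta>|lborel. ?k (\<eta> + \<xi>) \<xi>)"
      by (rule integral_lborel_shift[symmetric]) measurable
    also have "\<dots> = (LINT \<eta>|lborel. (cis (- (\<eta> \<bullet> x)) * P \<eta>) * (cis (- (\<xi> \<bullet> x)) * Q \<xi>))"
    proof (intro Bochner_Integration.integral_cong refl)
      fix \<eta>
      have "cis (- ((\<eta> + \<xi>) \<bullet> x)) = cis (- (\<eta> \<bullet> x)) * cis (- (\<xi> \<bullet> x))"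
        by (simp add: inner_add_left cis_mult)
      then show "?k (\<eta> + \<xi>) \<xi> = (cis (- (\<eta> \<bullet> x)) * P \<eta>) * (cis (- (\<xi> \<bullet> x)) * Q \<xi>)"
        by (simp add: mult_ac)
    qed
    also have "\<dots> = fourier P x * (cis (- (\<xi> \<bullet> x)) * Q \<xi>)"
      unfolding fourier_def by (rule integral_mult_left_zero)
    finally show "(LINT \<eta>|lborel. ?k \<eta> \<xi>) = fourier P x * (cis (- (\<xi> \<bullet> x)) * Q \<xi>)" .
  qed
  also have "\<dots> = fourier P x * fourier Q x"
    unfolding fourier_def by (rule integral_mult_right_zero)
  finally show ?thesis .
qed

lemma cis_second_order: "norm (cis t - 1 - \<i> * of_real t) \<le> t\<^sup>2"
proof -
  have "norm (iexp t - (\<Sum>k \<le> 1. (\<i> * t)^k / fact k)) \<le> \<bar>t\<bar>^(Suc 1) / fact (Suc 1)"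
    by (rule iexp_approx1)
  also have "\<dots> \<le> t\<^sup>2" by (simp add: numeral_2_eq_2 fact_reduce)
  finally show ?thesis by (simp add: cis_conv_exp algebra_simps)
qed

lemma rapid_integrable_mult:
  fixes f :: "real^'n::finite \<Rightarrow> complex"
  assumes "rapid f" "f \<in> borel_measurable borel" "m \<in> borel_measurable borel"
    "\<And>x. norm (m x) \<le> K * (1 + norm x) ^ N"
  shows "integrable lborel (\<lambda>x. m x * f x)"
  by (intro rapid_integrable rapid_mult[OF assms(1,4)] borel_measurable_times assms)

text \<open>Differentiation under the integral: the remainder of \<open>cis\<close> is quadratic in \<open>x \<bullet> h\<close>, and the
  second moments of \<open>\<phi>\<close> are finite.\<close>

lemma fourier_has_derivative:
  fixes \<phi> :: "real^'n::finite \<Rightarrow> complex"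
  assumes \<phi>: "\<phi> \<in> schwartz"
  shows "(fourier \<phi> has_derivative (\<lambda>h. \<Sum>i\<in>UNIV. (h $ i) *\<^sub>R fourier (\<lambda>x. - \<i> * (of_real (x $ i) * \<phi> x)) \<xi>)) (at \<xi>)"
proof -
  have [measurable]: "\<phi> \<in> borel_measurable borel" by (rule schwartz_measurable[OF \<phi>])
  have int: "integrable lborel \<phi>" by (rule schwartz_integrable[OF \<phi>])
  have int1: "integrable lborel (\<lambda>x. - \<i> * (of_real (x $ i) * \<phi> x))" for i
    by (intro schwartz_integrable schwartz_cmult schwartz_coord_mult \<phi>)
  have int2: "integrable lborel (\<lambda>x. of_real ((norm x)\<^sup>2) * \<phi> x)"
    by (rule rapid_integrable_mult[where K = 1 and N = 2]) (auto simp: schwartz_rapid \<phi> norm_power power_mono)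
  show ?thesis
  proof (rule has_derivative_quadratic[OF bounded_linear_coords zero_less_one,
        where K = "LINT x|lborel. norm (of_real ((norm x)\<^sup>2) * \<phi> x)"])
    fix h :: "real^'n"
    let ?r = "\<lambda>x. (cis (- (x \<bullet> h)) - 1 + \<i> * of_real (x \<bullet> h)) * (cis (- (x \<bullet> \<xi>)) * \<phi> x)"
    let ?d = "\<lambda>x. cis (- (x \<bullet> (\<xi> + h))) * \<phi> x - cis (- (x \<bullet> \<xi>)) * \<phi> x -
          (\<Sum>i\<in>UNIV. (h $ i) *\<^sub>R (cis (- (x \<bullet> \<xi>)) * (- \<i> * (of_real (x $ i) * \<phi> x))))"
    have d: "?r x = ?d x" for x
    proof -
      have "complex_of_real (x \<bullet> h) = (\<Sum>i\<in>UNIV. of_real (x $ i) * of_real (h $ i))"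
        by (simp add: inner_vec_def)
      moreover have "cis (- (x \<bullet> (\<xi> + h))) = cis (- (x \<bullet> \<xi>)) * cis (- (x \<bullet> h))"
        by (simp add: inner_add_right cis_mult)
      ultimately show ?thesis
        by (simp add: algebra_simps sum_distrib_left sum_distrib_right scaleR_conv_of_real sum_negf)
    qed
    have intd: "integrable lborel ?d"
      by (intro Bochner_Integration.integrable_diff Bochner_Integration.integrable_sum integrable_scaleR_right fourier_integrable int int1)
    have "fourier \<phi> (\<xi> + h) - fourier \<phi> \<xi> - (\<Sum>i\<in>UNIV. (h $ i) *\<^sub>R fourier (\<lambda>x. - \<i> * (of_real (x $ i) * \<phi> x)) \<xi>) = (LINT x|lborel. ?d x)"
      unfolding fourier_def
      by (subst Bochner_Integration.integral_diff, intro Bochner_Integration.integrable_diff fourier_integrable int,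
          intro Bochner_Integration.integrable_sum integrable_scaleR_right fourier_integrable int1,
          subst Bochner_Integration.integral_diff, intro fourier_integrable int, intro fourier_integrable int,
          subst Bochner_Integration.integral_sum, intro integrable_scaleR_right fourier_integrable int1,
          simp only: integral_scaleR_right)
    also have "norm \<dots> \<le> (LINT x|lborel. norm (of_real ((norm x)\<^sup>2) * \<phi> x) * (norm h)\<^sup>2)"
    proof (rule Bochner_Integration.integral_norm_bound_integral[OF intd])
      show "integrable lborel (\<lambda>x. norm (of_real ((norm x)\<^sup>2) * \<phi> x) * (norm h)\<^sup>2)"
        using int2 by (intro integrable_mult_left integrable_norm)
      fix x :: "real^'n"
      have "norm (cis (- (x \<bullet> h)) - 1 + \<i> * of_real (x \<bullet> h)) \<le> (x \<bullet> h)\<^sup>2"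
        using cis_second_order[of "- (x \<bullet> h)"] by simp
      also have "\<dots> \<le> (norm x * norm h)\<^sup>2"
        using Cauchy_Schwarz_ineq2[of x h] by (metis abs_ge_zero power2_abs power_mono)
      finally have "norm (?r x) \<le> (norm x * norm h)\<^sup>2 * norm (\<phi> x)"
        unfolding norm_mult by (simp add: mult_right_mono)
      then show "norm (?d x) \<le> norm (of_real ((norm x)\<^sup>2) * \<phi> x) * (norm h)\<^sup>2"
        unfolding d[symmetric] by (simp add: norm_mult norm_power power_mult_distrib mult_ac)
    qed
    finally show "norm (fourier \<phi> (\<xi> + h) - fourier \<phi> \<xi> - (\<Sum>i\<in>UNIV. (h $ i) *\<^sub>R fourier (\<lambda>x. - \<i> * (of_real (x $ i) * \<phi> x)) \<xi>))
        \<le> (LINT x|lborel. norm (of_real ((norm x)\<^sup>2) * \<phi> x)) * (norm h)\<^sup>2"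
      by simp
  qed
qed

text \<open>Integration by parts. It is proved by translation: the Fourier transform of
  \<open>\<phi> (x + t e\<^sub>j)\<close> is \<open>cis (t \<xi>\<^sub>j)\<close> times that of \<open>\<phi>\<close>, and both sides are expanded to first order
  in \<open>t\<close> with an error of order \<open>t\<^sup>2\<close>.\<close>

lemma fourier_partial:
  fixes \<phi> :: "real^'n::finite \<Rightarrow> complex"
  assumes \<phi>: "\<phi> \<in> schwartz"
  shows "fourier (partial j \<phi>) \<xi> = \<i> * of_real (\<xi> $ j) * fourier \<phi> \<xi>"
proof -
  let ?n = "CARD('n)"
  have "\<exists>C\<ge>0. \<forall>x. (1 + norm x) ^ (2 * ?n) * norm (partial k (partial i \<phi>) x) \<le> C" for i k
    using rapidE[OF schwartz_rapid[OF schwartz_partial[OF schwartz_partial[OF \<phi>]]], of "2 * ?n" k i] by metis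
  from finite_family_bound[where F = "\<lambda>i k x. (1 + norm x) ^ (2 * ?n) * norm (partial k (partial i \<phi>) x)", OF this]
  obtain C where C: "C \<ge> 0" "\<And>i k x. (1 + norm x) ^ (2 * ?n) * norm (partial k (partial i \<phi>) x) \<le> C" by metis
  define K where "K = (real ?n)\<^sup>2 * (C * 4 ^ ?n)"
  let ?w = "\<lambda>x::real^'n. (weight (- real ?n) x)\<^sup>2"
  have w: "integrable lborel ?w"
    using weight_square_integrable[where 'n = 'n, of "real ?n"] by (intro integrableI_bounded) auto
  have taylor: "norm (\<phi> (x + t *\<^sub>R axis j 1) - \<phi> x - t *\<^sub>R partial j \<phi> x) \<le> (K * ?w x) * t\<^sup>2"
    if t: "\<bar>t\<bar> \<le> 1" for t x
  proof -
    let ?h = "t *\<^sub>R axis j 1 :: real^'n"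
    have h: "norm ?h = \<bar>t\<bar>" by (simp add: norm_axis_1)
    have 2: "norm (partial k (partial i \<phi>) y) \<le> C * 4 ^ ?n * ?w x" if y: "y \<in> closed_segment x (x + ?h)" for y i k
    proof -
      have "norm (x - y) \<le> 1" using segment_bound1[OF y] h t by (simp add: norm_minus_commute)
      then show ?thesis by (rule decay_nearby[OF C(2) norm_ge_zero])
    qed
    have "(\<Sum>i\<in>UNIV. (?h $ i) *\<^sub>R partial i \<phi> x) = t *\<^sub>R partial j \<phi> x"
      using coords_axis[of j "\<lambda>i. partial i \<phi> x"] by (simp add: scaleR_sum_right[symmetric] flip: scaleR_scaleR)
    moreover have "norm (\<phi> (x + ?h) - \<phi> x - (\<Sum>i\<in>UNIV. (?h $ i) *\<^sub>R partial i \<phi> x)) \<le> (real ?n)\<^sup>2 * (C * 4 ^ ?n * ?w x) * (norm ?h)\<^sup>2"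
      by (rule smooth_quadratic_taylor[OF schwartz_smooth[OF \<phi>] 2])
    moreover have "(norm ?h)\<^sup>2 = t\<^sup>2" unfolding h by simp
    ultimately show ?thesis by (simp only: K_def mult.assoc)
  qed
  have int: "integrable lborel \<phi>" "integrable lborel (partial j \<phi>)"
    by (auto intro: schwartz_integrable schwartz_partial \<phi>)
  have [measurable]: "\<phi> \<in> borel_measurable borel" by (rule schwartz_measurable[OF \<phi>])
  define a where "a = fourier (partial j \<phi>) \<xi> - \<i> * of_real (\<xi> $ j) * fourier \<phi> \<xi>"
  define M where "M = K * (LINT x|lborel. ?w x) + (\<xi> $ j)\<^sup>2 * norm (fourier \<phi> \<xi>)"
  have est: "\<bar>t\<bar> * norm a \<le> M * t\<^sup>2" if t: "\<bar>t\<bar> \<le> 1" for t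
  proof -
    let ?h = "t *\<^sub>R axis j 1 :: real^'n"
    have int_h: "integrable lborel (\<lambda>x. \<phi> (x + ?h))"
      using integrable_lborel_affine[OF int(1), of 1 ?h] by (simp add: add.commute)
    have "fourier (\<lambda>x. \<phi> (x + ?h)) \<xi> = (LINT x|lborel. cis (- ((x + ?h - ?h) \<bullet> \<xi>)) * \<phi> (x + ?h))"
      by (simp add: fourier_def)
    also have "\<dots> = (LINT x|lborel. cis (- ((x - ?h) \<bullet> \<xi>)) * \<phi> x)"
      by (rule integral_lborel_shift) measurable
    also have "\<dots> = cis (t * \<xi> $ j) * fourier \<phi> \<xi>"
    proof -
      have *: "cis (- ((x - ?h) \<bullet> \<xi>)) * \<phi> x = cis (t * \<xi> $ j) * (cis (- (x \<bullet> \<xi>)) * \<phi> x)" for x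
        by (simp add: inner_diff_left inner_axis' cis_mult mult.assoc[symmetric] add.commute)
      show ?thesis unfolding fourier_def * by (rule integral_mult_right_zero)
    qed
    finally have shift: "fourier (\<lambda>x. \<phi> (x + ?h)) \<xi> = cis (t * \<xi> $ j) * fourier \<phi> \<xi>" .
    let ?r = "\<lambda>x. cis (- (x \<bullet> \<xi>)) * \<phi> (x + ?h) - cis (- (x \<bullet> \<xi>)) * \<phi> x - t *\<^sub>R (cis (- (x \<bullet> \<xi>)) * partial j \<phi> x)"
    have intr: "integrable lborel ?r"
      by (intro Bochner_Integration.integrable_diff integrable_scaleR_right fourier_integrable int int_h)
    have "cis (t * \<xi> $ j) * fourier \<phi> \<xi> - fourier \<phi> \<xi> - t *\<^sub>R fourier (partial j \<phi>) \<xi> = (LINT x|lborel. ?r x)"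
      unfolding shift[symmetric] unfolding fourier_def
      by (simp add: Bochner_Integration.integral_diff fourier_integrable[OF int(1)] fourier_integrable[OF int(2)] fourier_integrable[OF int_h])
    also have "norm \<dots> \<le> (LINT x|lborel. (K * ?w x) * t\<^sup>2)"
    proof (rule Bochner_Integration.integral_norm_bound_integral[OF intr])
      show "integrable lborel (\<lambda>x. (K * ?w x) * t\<^sup>2)" using w by simp
      fix x
      have "?r x = cis (- (x \<bullet> \<xi>)) * (\<phi> (x + ?h) - \<phi> x - t *\<^sub>R partial j \<phi> x)"
        by (simp add: algebra_simps)
      then show "norm (?r x) \<le> (K * ?w x) * t\<^sup>2" using taylor[OF t, of x] by (simp add: norm_mult)
    qed
    finally have 1: "norm (cis (t * \<xi> $ j) * fourier \<phi> \<xi> - fourier \<phi> \<xi> - t *\<^sub>R fourier (partial j \<phi>) \<xi>) \<le> K * (LINT x|lborel. ?w x) * t\<^sup>2"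
      by simp
    have 2: "norm ((cis (t * \<xi> $ j) - 1 - \<i> * of_real (t * \<xi> $ j)) * fourier \<phi> \<xi>) \<le> (t * \<xi> $ j)\<^sup>2 * norm (fourier \<phi> \<xi>)"
      unfolding norm_mult by (intro mult_right_mono cis_second_order) auto
    have "t *\<^sub>R a = (cis (t * \<xi> $ j) - 1 - \<i> * of_real (t * \<xi> $ j)) * fourier \<phi> \<xi>
         - (cis (t * \<xi> $ j) * fourier \<phi> \<xi> - fourier \<phi> \<xi> - t *\<^sub>R fourier (partial j \<phi>) \<xi>)"
      by (simp add: a_def algebra_simps scaleR_conv_of_real)
    then have "norm (t *\<^sub>R a) \<le> (t * \<xi> $ j)\<^sup>2 * norm (fourier \<phi> \<xi>) + K * (LINT x|lborel. ?w x) * t\<^sup>2"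
      using norm_triangle_ineq4 1 2 by (smt (verit))
    then show ?thesis by (simp add: M_def power_mult_distrib algebra_simps)
  qed
  have "norm a \<le> 0"
  proof (rule field_le_epsilon)
    fix e :: real assume e: "e > 0"
    have M: "M \<ge> 0" unfolding M_def K_def using C(1) by (intro add_nonneg_nonneg mult_nonneg_nonneg integral_nonneg_AE) auto
    define t where "t = min 1 (e / (M + 1))"
    have t: "t > 0" "t \<le> 1" using e M by (auto simp: t_def)
    then have "t * norm a \<le> t * (M * t)" using est[of t] by (simp add: power2_eq_square mult_ac)
    then have "norm a \<le> M * t" using t by simp
    also have "\<dots> \<le> M * (e / (M + 1))" using M by (intro mult_left_mono) (auto simp: t_def)
    also have "\<dots> \<le> e" using M e by (simp add: field_simps)
    finally show "norm a \<le> 0 + e" by simp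
  qed
  then show ?thesis by (simp add: a_def)
qed

text \<open>Integration by parts trades one power of \<open>\<bar>\<xi>\<bar> \<le> \<Sum>\<^sub>j \<bar>\<xi>\<^sub>j\<bar>\<close> for one derivative of \<open>\<phi>\<close>, so the
  power in the decay estimate is raised by induction over all Schwartz functions at once.\<close>

lemma fourier_rapid:
  fixes \<phi> :: "real^'n::finite \<Rightarrow> complex"
  assumes "\<phi> \<in> schwartz" shows "rapid (fourier \<phi>)"
  unfolding rapid_def
proof
  fix k
  show "\<exists>C. \<forall>\<xi>. (1 + norm \<xi>) ^ k * norm (fourier \<phi> \<xi>) \<le> C"
    using assms
  proof (induction k arbitrary: \<phi>)
    case 0
    then show ?case using fourier_norm_le[OF schwartz_integrable] by auto
  next
    case (Suc k)
    obtain C where C: "\<And>\<xi>. (1 + norm \<xi>) ^ k * norm (fourier \<phi> \<xi>) \<le> C" using Suc by blast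
    have "\<forall>j. \<exists>D. \<forall>\<xi>. (1 + norm \<xi>) ^ k * norm (fourier (partial j \<phi>) \<xi>) \<le> D"
      using Suc schwartz_partial by blast
    then obtain D where D: "\<And>j \<xi>. (1 + norm \<xi>) ^ k * norm (fourier (partial j \<phi>) \<xi>) \<le> D j" by metis
    have "(1 + norm \<xi>) ^ Suc k * norm (fourier \<phi> \<xi>) \<le> C + (\<Sum>j\<in>UNIV. D j)" for \<xi>
    proof -
      let ?p = "(1 + norm \<xi>) ^ k" and ?f = "norm (fourier \<phi> \<xi>)"
      have "(1 + norm \<xi>) * ?f \<le> (1 + (\<Sum>j\<in>UNIV. \<bar>\<xi> $ j\<bar>)) * ?f"
        by (intro mult_right_mono add_left_mono norm_le_l1_cart) auto
      also have "\<dots> = ?f + (\<Sum>j\<in>UNIV. norm (fourier (partial j \<phi>) \<xi>))"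
        using Suc.prems by (simp add: fourier_partial norm_mult distrib_right sum_distrib_right)
      finally have "?p * ((1 + norm \<xi>) * ?f) \<le> ?p * (?f + (\<Sum>j\<in>UNIV. norm (fourier (partial j \<phi>) \<xi>)))"
        by (intro mult_left_mono) auto
      also have "\<dots> = ?p * ?f + (\<Sum>j\<in>UNIV. ?p * norm (fourier (partial j \<phi>) \<xi>))"
        by (simp add: distrib_left sum_distrib_left)
      also have "\<dots> \<le> C + (\<Sum>j\<in>UNIV. D j)" by (intro add_mono C sum_mono D)
      finally show ?thesis by (simp add: mult_ac)
    qed
    then show ?case by blast
  qed
qed

lemma fourier_schwartz:
  fixes \<phi> :: "real^'n::finite \<Rightarrow> complex"
  assumes "\<phi> \<in> schwartz" shows "fourier \<phi> \<in> schwartz"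
proof (rule schwartz_coinduct[where A = "fourier ` schwartz"])
  fix h i assume "h \<in> fourier ` (schwartz :: (real^'n \<Rightarrow> complex) set)"
  then obtain \<phi> where h: "h = fourier \<phi>" "\<phi> \<in> schwartz" by auto
  show "h differentiable_on UNIV" unfolding h differentiable_on_def
    using fourier_has_derivative[OF h(2)] by (auto simp: differentiable_def)
  show "rapid h" unfolding h by (rule fourier_rapid[OF h(2)])
  have "partial i h = fourier (\<lambda>x. - \<i> * (of_real (x $ i) * \<phi> x))"
    unfolding h by (rule ext, subst partial_eq[OF fourier_has_derivative[OF h(2)]]) (rule coords_axis)
  then show "partial i h \<in> fourier ` schwartz"
    using schwartz_cmult[OF schwartz_coord_mult[OF h(2)], of "-\<i>" i] by blast
qed (use assms in auto)

section \<open>Gaussians, Fourier inversion and the Plancherel inequality\<close>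

lemma lborel_product_integral:
  fixes f :: "'a::euclidean_space \<Rightarrow> real \<Rightarrow> complex"
  assumes f: "\<And>b. b \<in> Basis \<Longrightarrow> integrable lborel (f b)"
  shows "(LINT x|lborel. (\<Prod>b\<in>Basis. f b (x \<bullet> b))) = (\<Prod>b\<in>Basis. (LINT t|lborel. f b t))"
proof -
  interpret product_sigma_finite "\<lambda>b::'a. lborel :: real measure" ..
  have [measurable]: "f b \<in> borel_measurable borel" if "b \<in> Basis" for b
    using f[OF that] by auto
  have "(LINT x|lborel. (\<Prod>b\<in>Basis. f b (x \<bullet> b)))
      = (LINT x|distr (\<Pi>\<^sub>M b\<in>(Basis::'a set). lborel) borel (\<lambda>g. \<Sum>b\<in>Basis. g b *\<^sub>R b). (\<Prod>b\<in>Basis. f b (x \<bullet> b)))"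
    by (simp flip: lborel_eq)
  also have "\<dots> = (LINT g|(\<Pi>\<^sub>M b\<in>(Basis::'a set). lborel). (\<Prod>b\<in>Basis. f b (g b)))"
    by (subst integral_distr) (auto intro!: Bochner_Integration.integral_cong prod.cong)
  also have "\<dots> = (\<Prod>b\<in>Basis. (LINT t|lborel. f b t))"
    by (rule product_integral_prod) (auto intro: f)
  finally show ?thesis .
qed

lemma gauss_1d:
  "integrable lborel (\<lambda>t. cis (- (t * a)) * complex_of_real (exp (- t\<^sup>2 / 2)))"
  "(LINT t|lborel. cis (- (t * a)) * complex_of_real (exp (- t\<^sup>2 / 2))) = of_real (sqrt (2 * pi) * exp (- a\<^sup>2 / 2))"
proof -
  have e: "complex_of_real (exp (- t\<^sup>2 / 2)) = of_real (sqrt (2 * pi)) * of_real (std_normal_density t)" for t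
    by (simp add: std_normal_density_def)
  have "integrable lborel std_normal_density" by simp
  then have "integrable lborel (\<lambda>t. complex_of_real (std_normal_density t))" by (rule integrable_of_real)
  then show 1: "integrable lborel (\<lambda>t. cis (- (t * a)) * complex_of_real (exp (- t\<^sup>2 / 2)))"
    unfolding e by (intro integrable_unimodular integrable_mult_right) auto
  have "complex_of_real (exp (- a\<^sup>2 / 2)) = char std_normal_distribution (- a)"
    by (simp add: char_std_normal_distribution)
  also have "\<dots> = (LINT t|lborel. std_normal_density t *\<^sub>R iexp (- a * t))"
    unfolding char_def by (subst integral_density) auto
  also have "\<dots> = (LINT t|lborel. cis (- (t * a)) * of_real (std_normal_density t))"
    by (intro Bochner_Integration.integral_cong refl) (simp add: cis_conv_exp scaleR_conv_of_real mult_ac)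
  finally have "(LINT t|lborel. cis (- (t * a)) * of_real (std_normal_density t)) = complex_of_real (exp (- a\<^sup>2 / 2))" ..
  then show "(LINT t|lborel. cis (- (t * a)) * complex_of_real (exp (- t\<^sup>2 / 2))) = of_real (sqrt (2 * pi) * exp (- a\<^sup>2 / 2))"
  proof -
    assume *: "(LINT t|lborel. cis (- (t * a)) * of_real (std_normal_density t)) = complex_of_real (exp (- a\<^sup>2 / 2))"
    have "(LINT t|lborel. cis (- (t * a)) * complex_of_real (exp (- t\<^sup>2 / 2)))
       = (LINT t|lborel. of_real (sqrt (2 * pi)) * (cis (- (t * a)) * of_real (std_normal_density t)))"
      by (intro Bochner_Integration.integral_cong refl) (simp only: e mult.left_commute)
    also have "\<dots> = of_real (sqrt (2 * pi)) * complex_of_real (exp (- a\<^sup>2 / 2))"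
      by (simp only: integral_mult_right_zero *)
    finally show ?thesis by simp
  qed
qed

definition gauss :: "real \<Rightarrow> real^'n::finite \<Rightarrow> complex" where
  "gauss \<epsilon> x = of_real (exp (- (\<epsilon> * norm x)\<^sup>2 / 2))"

lemma gauss_measurable [measurable]: "gauss \<epsilon> \<in> borel_measurable borel"
  unfolding gauss_def by measurable

lemma norm_gauss_le: "norm (gauss \<epsilon> x) \<le> 1" by (simp add: gauss_def)

lemma gauss_scale: "gauss \<epsilon> (c *\<^sub>R x) = gauss (\<epsilon> * c) x"
  by (simp add: gauss_def power_mult_distrib mult_ac)

text \<open>Both the Gaussian and the character factor over the coordinates, and in dimension one the
  integral is the characteristic function of the standard normal distribution.\<close>

lemma fourier_gauss_1:
  "fourier (gauss 1 :: real^'n::finite \<Rightarrow> complex) \<xi> = of_real (sqrt (2 * pi) ^ CARD('n)) * gauss 1 \<xi>"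
proof -
  let ?f = "\<lambda>b t. cis (- (t * (\<xi> \<bullet> b))) * complex_of_real (exp (- t\<^sup>2 / 2))"
  have sq: "(norm x)\<^sup>2 = (\<Sum>b\<in>Basis. (x \<bullet> b)\<^sup>2)" for x :: "real^'n"
    unfolding power2_norm_eq_inner by (subst euclidean_inner) (simp add: power2_eq_square)
  have prod_gauss: "gauss 1 x = (\<Prod>b\<in>Basis. complex_of_real (exp (- (x \<bullet> b)\<^sup>2 / 2)))" for x :: "real^'n"
    by (simp add: gauss_def sq exp_sum sum_negf sum_divide_distrib flip: of_real_prod sum_negf)
  have cis_prod: "cis (- (x \<bullet> \<xi>)) = (\<Prod>b\<in>Basis. cis (- ((x \<bullet> b) * (\<xi> \<bullet> b))))" for x
    by (subst euclidean_inner) (simp add: cis_conv_exp exp_sum sum_distrib_left sum_negf flip: sum_negf exp_sum)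
  have "fourier (gauss 1) \<xi> = (LINT x|lborel. (\<Prod>b\<in>Basis. ?f b (x \<bullet> b)))"
    unfolding fourier_def by (simp add: prod.distrib cis_prod prod_gauss)
  also have "\<dots> = (\<Prod>b\<in>Basis. (LINT t|lborel. ?f b t))"
    by (rule lborel_product_integral) (rule gauss_1d)
  also have "\<dots> = (\<Prod>b\<in>(Basis::(real^'n) set). of_real (sqrt (2 * pi)) * of_real (exp (- (\<xi> \<bullet> b)\<^sup>2 / 2)))"
    by (simp only: gauss_1d of_real_mult)
  also have "\<dots> = of_real (sqrt (2 * pi) ^ CARD('n)) * gauss 1 \<xi>"
    unfolding prod.distrib by (simp add: prod_gauss)
  finally show ?thesis .
qed

lemma gauss_integrable:
  assumes "\<epsilon> > 0" shows "integrable lborel (gauss \<epsilon> :: real^'n::finite \<Rightarrow> complex)"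
proof -
  have "fourier (gauss 1 :: real^'n \<Rightarrow> complex) 0 \<noteq> 0"
    unfolding fourier_gauss_1 by (simp add: gauss_def)
  then have "(LINT x|lborel. (gauss 1 :: real^'n \<Rightarrow> complex) x) \<noteq> 0" by (simp add: fourier_def)
  \<comment> \<open>The integral of a function that is not integrable is \<open>0\<close> by convention.\<close>
  then have "integrable lborel (gauss 1 :: real^'n \<Rightarrow> complex)" using not_integrable_integral_eq by blast
  from integrable_lborel_affine[OF this, of \<epsilon> 0] show ?thesis using assms by (simp add: gauss_scale)
qed

lemma integral_gauss_1: "(LINT x|lborel. (gauss 1 :: real^'n::finite \<Rightarrow> complex) x) = of_real (sqrt (2 * pi) ^ CARD('n))"
  using fourier_gauss_1[of "0::real^'n"] by (simp add: fourier_def gauss_def)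

lemma fourier_gauss:
  fixes \<xi> :: "real^'n::finite"
  assumes e: "\<epsilon> > 0"
  shows "fourier (gauss \<epsilon>) \<xi> = of_real ((sqrt (2 * pi) / \<epsilon>) ^ CARD('n)) * gauss (1 / \<epsilon>) \<xi>"
proof -
  have "fourier (gauss \<epsilon>) \<xi> = of_real (\<bar>1 / \<epsilon>\<bar> ^ CARD('n)) * (LINT x|lborel. cis (- ((0 + (1 / \<epsilon>) *\<^sub>R x) \<bullet> \<xi>)) * gauss \<epsilon> (0 + (1 / \<epsilon>) *\<^sub>R x))"
    unfolding fourier_def
    using integral_lborel_affine[of "\<lambda>x. cis (- (x \<bullet> \<xi>)) * gauss \<epsilon> x" "1 / \<epsilon>" 0] e by simp
  also have "\<dots> = of_real ((1 / \<epsilon>) ^ CARD('n)) * fourier (gauss 1) ((1 / \<epsilon>) *\<^sub>R \<xi>)"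
    using e unfolding fourier_def by (simp add: gauss_scale)
  also have "\<dots> = of_real ((sqrt (2 * pi) / \<epsilon>) ^ CARD('n)) * gauss (1 / \<epsilon>) \<xi>"
    unfolding fourier_gauss_1 by (simp add: gauss_scale power_divide)
  finally show ?thesis .
qed

definition eps :: "nat \<Rightarrow> real" where "eps k = 1 / real (Suc k)"
lemma eps_pos [simp]: "eps k > 0" by (simp add: eps_def)
lemma eps_nz [simp]: "eps k \<noteq> 0" by (simp add: eps_def)
lemma eps_tendsto: "eps \<longlonglongrightarrow> 0" unfolding eps_def by (rule LIMSEQ_Suc[OF lim_1_over_n])

lemma gauss_tendsto: "(\<lambda>k. gauss (eps k) x) \<longlonglongrightarrow> 1"
proof -
  have "(\<lambda>k. complex_of_real (exp (- (eps k * norm x)\<^sup>2 / 2))) \<longlonglongrightarrow> of_real (exp (- (0 * norm x)\<^sup>2 / 2))"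
    by (intro tendsto_intros eps_tendsto) auto
  then show ?thesis by (simp add: gauss_def)
qed

lemma sqrt_power_mult_self: "(a::real) \<ge> 0 \<Longrightarrow> sqrt a ^ n * sqrt a ^ n = a ^ n"
  by (subst power_mult_distrib[symmetric]) (simp only: real_sqrt_mult_self abs_of_nonneg)

text \<open>Fourier inversion: regularise the iterated integral by a Gaussian and use the duality
  formula, which turns the regularised integral into an average of \<open>\<phi>\<close> near \<open>-x\<close>.\<close>

lemma fourier_inversion:
  fixes \<phi> :: "real^'n::finite \<Rightarrow> complex"
  assumes int: "integrable lborel \<phi>" and cont: "continuous_on UNIV \<phi>" and bdd: "\<And>x. norm (\<phi> x) \<le> B"
    and int': "integrable lborel (fourier \<phi>)"
  shows "fourier (fourier \<phi>) x = of_real ((2 * pi) ^ CARD('n)) * \<phi> (- x)"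
proof -
  let ?c = "sqrt (2 * pi) ^ CARD('n)"
  have [measurable]: "\<phi> \<in> borel_measurable borel" "fourier \<phi> \<in> borel_measurable borel" using int int' by auto
  let ?A = "\<lambda>k. LINT \<xi>|lborel. fourier \<phi> \<xi> * (cis (- (\<xi> \<bullet> x)) * gauss (eps k) \<xi>)"
  have "?A \<longlonglongrightarrow> (LINT \<xi>|lborel. cis (- (\<xi> \<bullet> x)) * fourier \<phi> \<xi>)"
  proof (rule integral_dominated_convergence[where w = "\<lambda>\<xi>. norm (fourier \<phi> \<xi>)"])
    show "AE \<xi> in lborel. (\<lambda>k. fourier \<phi> \<xi> * (cis (- (\<xi> \<bullet> x)) * gauss (eps k) \<xi>)) \<longlonglongrightarrow> cis (- (\<xi> \<bullet> x)) * fourier \<phi> \<xi>"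
    proof (rule AE_I2)
      fix \<xi>
      have "(\<lambda>k. fourier \<phi> \<xi> * (cis (- (\<xi> \<bullet> x)) * gauss (eps k) \<xi>)) \<longlonglongrightarrow> fourier \<phi> \<xi> * (cis (- (\<xi> \<bullet> x)) * 1)"
        by (intro tendsto_intros gauss_tendsto)
      then show "(\<lambda>k. fourier \<phi> \<xi> * (cis (- (\<xi> \<bullet> x)) * gauss (eps k) \<xi>)) \<longlonglongrightarrow> cis (- (\<xi> \<bullet> x)) * fourier \<phi> \<xi>"
        by (simp add: mult.commute)
    qed
    show "AE \<xi> in lborel. norm (fourier \<phi> \<xi> * (cis (- (\<xi> \<bullet> x)) * gauss (eps k) \<xi>)) \<le> norm (fourier \<phi> \<xi>)" for k
      by (intro AE_I2) (simp add: norm_mult mult_left_le norm_gauss_le)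
  qed (use int' in auto)
  moreover have "?A \<longlonglongrightarrow> of_real ?c * (\<phi> (- x) * of_real ?c)"
  proof -
    have A: "?A k = of_real ?c * (LINT y|lborel. \<phi> (- x + eps k *\<^sub>R y) * gauss 1 y)" for k
    proof -
      have "?A k = (LINT z|lborel. \<phi> z * fourier (\<lambda>\<xi>. cis (- (\<xi> \<bullet> x)) * gauss (eps k) \<xi>) z)"
        by (intro fourier_duality int fourier_integrable gauss_integrable) simp
      also have "\<dots> = (LINT z|lborel. \<phi> z * (of_real ((sqrt (2 * pi) / eps k) ^ CARD('n)) * gauss (1 / eps k) (z + x)))"
        by (simp add: fourier_modulate fourier_gauss)
      also have "\<dots> = of_real (\<bar>eps k\<bar> ^ DIM(real^'n)) * (LINT y|lborel. \<phi> (- x + eps k *\<^sub>R y) *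
            (of_real ((sqrt (2 * pi) / eps k) ^ CARD('n)) * gauss (1 / eps k) ((- x + eps k *\<^sub>R y) + x)))"
        by (rule integral_lborel_affine) (use eps_pos[of k] in \<open>auto simp del: eps_pos\<close>)
      also have "\<dots> = of_real (eps k ^ CARD('n)) * (LINT y|lborel. of_real ((sqrt (2 * pi) / eps k) ^ CARD('n)) * (\<phi> (- x + eps k *\<^sub>R y) * gauss 1 y))"
        using eps_pos[of k] abs_of_pos[OF eps_pos[of k]] by (simp add: gauss_scale mult_ac less_imp_neq[THEN not_sym])
      also have "\<dots> = of_real (eps k ^ CARD('n)) * of_real ((sqrt (2 * pi) / eps k) ^ CARD('n)) * (LINT y|lborel. \<phi> (- x + eps k *\<^sub>R y) * gauss 1 y)"
        by (simp only: integral_mult_right_zero mult.assoc)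
      also have "of_real (eps k ^ CARD('n)) * of_real ((sqrt (2 * pi) / eps k) ^ CARD('n)) = complex_of_real ?c"
        unfolding of_real_mult[symmetric] using eps_pos[of k] by (simp add: power_divide)
      finally show ?thesis .
    qed
    have "(\<lambda>k. LINT y|lborel. \<phi> (- x + eps k *\<^sub>R y) * gauss 1 y) \<longlonglongrightarrow> (LINT y|lborel. \<phi> (- x) * gauss 1 (y::real^'n))"
    proof (rule integral_dominated_convergence[where w = "\<lambda>y::real^'n. B * norm (gauss 1 y)"])
      show "AE y in lborel. (\<lambda>k. \<phi> (- x + eps k *\<^sub>R y) * gauss 1 y) \<longlonglongrightarrow> \<phi> (- x) * gauss 1 y"
      proof (rule AE_I2)
        fix y :: "real^'n"
        have "(\<lambda>k. - x + eps k *\<^sub>R y) \<longlonglongrightarrow> - x + 0 *\<^sub>R y" by (intro tendsto_intros eps_tendsto)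
        then have "(\<lambda>k. - x + eps k *\<^sub>R y) \<longlonglongrightarrow> - x" by simp
        then have "(\<lambda>k. \<phi> (- x + eps k *\<^sub>R y)) \<longlonglongrightarrow> \<phi> (- x)"
          by (rule continuous_on_tendsto_compose[OF cont]) auto
        then show "(\<lambda>k. \<phi> (- x + eps k *\<^sub>R y) * gauss 1 y) \<longlonglongrightarrow> \<phi> (- x) * gauss 1 y" by (intro tendsto_intros)
      qed
      show "integrable lborel (\<lambda>y::real^'n. B * norm (gauss 1 y))"
        by (intro integrable_mult_right integrable_norm gauss_integrable) simp
      show "AE y in lborel. norm (\<phi> (- x + eps k *\<^sub>R y) * gauss 1 y) \<le> B * norm (gauss 1 y)" for k
        by (intro AE_I2) (simp add: norm_mult mult_right_mono bdd)
    qed measurable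
    then have "(\<lambda>k. LINT y|lborel. \<phi> (- x + eps k *\<^sub>R y) * gauss 1 y) \<longlonglongrightarrow> \<phi> (- x) * of_real ?c"
      by (simp add: integral_gauss_1)
    then show ?thesis unfolding A by (rule tendsto_mult_left)
  qed
  ultimately have "(LINT \<xi>|lborel. cis (- (\<xi> \<bullet> x)) * fourier \<phi> \<xi>) = of_real ?c * (\<phi> (- x) * of_real ?c)"
    by (rule LIMSEQ_unique)
  moreover have "?c * ?c = (2 * pi) ^ CARD('n)" by (rule sqrt_power_mult_self) simp
  then have "of_real ?c * (\<phi> (- x) * of_real ?c) = of_real ((2 * pi) ^ CARD('n)) * \<phi> (- x)"
    by (simp only: of_real_mult[symmetric] mult.commute[of "\<phi> (- x)"] mult.assoc[symmetric])
  ultimately show ?thesis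
    unfolding fourier_def[of "fourier \<phi>"] by (simp only:)
qed

lemma nn_integral_fourier_gauss:
  assumes "\<epsilon> > 0"
  shows "(\<integral>\<^sup>+\<xi>. norm (fourier (gauss \<epsilon>) (\<xi>::real^'n::finite)) \<partial>lborel) = ennreal ((2 * pi) ^ CARD('n))"
proof -
  let ?c = "sqrt (2 * pi) ^ CARD('n)"
  have g1: "(\<integral>\<^sup>+x. norm (gauss 1 (x::real^'n)) \<partial>lborel) = ennreal ?c"
  proof -
    have "integrable lborel (\<lambda>x. norm (gauss 1 (x::real^'n)))" by (intro integrable_norm gauss_integrable) simp
    then have "(\<integral>\<^sup>+x. norm (gauss 1 (x::real^'n)) \<partial>lborel) = ennreal (LINT x|lborel. norm (gauss 1 (x::real^'n)))"
      by (rule nn_integral_eq_integral) simp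
    moreover have "complex_of_real (LINT x|lborel. norm (gauss 1 (x::real^'n))) = of_real ?c"
    proof -
      have "complex_of_real (LINT x|lborel. norm (gauss 1 (x::real^'n))) = (LINT x|lborel. complex_of_real (norm (gauss 1 (x::real^'n))))"
        by (rule integral_complex_of_real[symmetric])
      also have "\<dots> = (LINT x|lborel. gauss 1 (x::real^'n))"
        by (rule Bochner_Integration.integral_cong) (simp_all add: gauss_def)
      finally show ?thesis unfolding integral_gauss_1 .
    qed
    then have "(LINT x|lborel. norm (gauss 1 (x::real^'n))) = ?c" by (simp only: of_real_eq_iff)
    ultimately show ?thesis by simp
  qed
  have "(\<integral>\<^sup>+\<xi>. norm (fourier (gauss \<epsilon>) (\<xi>::real^'n)) \<partial>lborel) = (\<integral>\<^sup>+\<xi>. ennreal ((sqrt (2 * pi) / \<epsilon>) ^ CARD('n)) * norm (gauss (1 / \<epsilon>) (\<xi>::real^'n)) \<partial>lborel)"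
    using assms by (intro nn_integral_cong, subst ennreal_mult'[symmetric])
      (simp_all add: fourier_gauss norm_mult norm_power norm_divide)
  also have "\<dots> = ennreal ((sqrt (2 * pi) / \<epsilon>) ^ CARD('n)) * (\<integral>\<^sup>+\<xi>. norm (gauss (1 / \<epsilon>) (\<xi>::real^'n)) \<partial>lborel)"
    by (rule nn_integral_cmult) measurable
  also have "(\<integral>\<^sup>+\<xi>. norm (gauss (1 / \<epsilon>) (\<xi>::real^'n)) \<partial>lborel) = ennreal (\<epsilon> ^ CARD('n)) * ennreal ?c"
    using nn_integral_lborel_affine[of "\<lambda>\<xi>. ennreal (norm (gauss (1 / \<epsilon>) (\<xi>::real^'n)))" \<epsilon> 0] assms g1
    by (simp add: gauss_scale)
  also have "ennreal ((sqrt (2 * pi) / \<epsilon>) ^ CARD('n)) * (ennreal (\<epsilon> ^ CARD('n)) * ennreal ?c) = ennreal ((2 * pi) ^ CARD('n))"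
  proof -
    have "((sqrt (2 * pi) / \<epsilon>) ^ CARD('n)) * (\<epsilon> ^ CARD('n) * ?c) = ?c * ?c"
      unfolding power_divide using assms by (simp only: times_divide_eq_left nonzero_mult_div_cancel_left mult.assoc[symmetric]) simp
    also have "\<dots> = (2 * pi) ^ CARD('n)" by (rule sqrt_power_mult_self) simp
    finally have "((sqrt (2 * pi) / \<epsilon>) ^ CARD('n)) * (\<epsilon> ^ CARD('n) * ?c) = (2 * pi) ^ CARD('n)" .
    moreover have "((sqrt (2 * pi) / \<epsilon>) ^ CARD('n)) \<ge> 0" "\<epsilon> ^ CARD('n) \<ge> 0" using assms by simp_all
    ultimately show ?thesis by (metis ennreal_mult')
  qed
  finally show ?thesis .
qed

lemma ennreal_power2_le_iff: "(a::ennreal)\<^sup>2 \<le> b\<^sup>2 \<Longrightarrow> a \<le> b"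
  by (cases a; cases b) (auto simp: ennreal_power ennreal_le_iff top_unique dest: power2_le_imp_le)

text \<open>Half of Plancherel's theorem suffices here. Against a Gaussian regularisation the integral
  of \<open>\<bar>fourier G\<bar>\<^sup>2\<close> is a quadratic form in \<open>G\<close> whose kernel is a convolution
  kernel of mass \<open>(2\<pi>)\<^sup>n\<close>; Young's inequality bounds it and Fatou's lemma removes the Gaussian.\<close>

lemma Plancherel_le:
  fixes G :: "real^'n::finite \<Rightarrow> complex"
  assumes int: "integrable lborel G" and fin: "nsq G < \<infinity>"
  shows "nsq (fourier G) \<le> ennreal ((2 * pi) ^ CARD('n)) * nsq G"
proof -
  let ?C = "ennreal ((2 * pi) ^ CARD('n))"
  have [measurable]: "G \<in> borel_measurable borel" using int by auto
  have Gm [measurable]: "fourier G \<in> borel_measurable borel" by (rule fourier_measurable[OF int])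
  define G' where "G' y = cnj (G (- y))" for y
  have intG': "integrable lborel G'"
    unfolding G'_def using integrable_lborel_affine[OF int, of "-1" 0] by simp
  then have [measurable]: "G' \<in> borel_measurable borel" by auto
  have cnjG: "cnj (fourier G \<xi>) = fourier G' \<xi>" for \<xi>
  proof -
    have "fourier G' \<xi> = cnj (fourier (\<lambda>y. G (- y)) (- \<xi>))"
      unfolding G'_def using integrable_lborel_affine[OF int, of "-1" 0] by (intro fourier_cnj) simp
    then show ?thesis by (simp add: fourier_reflect)
  qed
  have main: "(\<integral>\<^sup>+\<xi>. (ennreal (norm (fourier G \<xi>)))\<^sup>2 * norm (gauss (eps k) \<xi>) \<partial>lborel) \<le> ?C * nsq G" for k
  proof -
    let ?\<gamma> = "gauss (eps k) :: real^'n \<Rightarrow> complex"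
    have intg: "integrable lborel ?\<gamma>" by (rule gauss_integrable) simp
    obtain B where B: "\<And>\<xi>. norm (fourier G \<xi>) \<le> B" using fourier_norm_le[OF int] by blast
    have B0: "B \<ge> 0" using B[of 0] norm_ge_zero order_trans by blast
    have bnd: "integrable lborel (\<lambda>\<xi>. F \<xi> * ?\<gamma> \<xi>)" if [measurable]: "F \<in> borel_measurable borel" and F: "\<And>\<xi>. norm (F \<xi>) \<le> D" for F and D :: real
      by (rule Bochner_Integration.integrable_bound[OF integrable_mult_right[OF intg, of "of_real D"]])
         (use F in \<open>auto simp: norm_mult intro!: mult_right_mono order_trans[OF F] \<close>)
    define \<psi> where "\<psi> \<xi> = fourier G' \<xi> * ?\<gamma> \<xi>" for \<xi>
    have int\<psi>: "integrable lborel \<psi>"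
      unfolding \<psi>_def
    proof (rule bnd[where D = B])
      show "norm (fourier G' \<xi>) \<le> B" for \<xi> using B[of \<xi>] by (simp flip: cnjG)
    qed (rule fourier_measurable[OF intG'])
    have \<psi>m [measurable]: "\<psi> \<in> borel_measurable borel" using int\<psi> by auto
    have f\<psi>: "ennreal (norm (fourier \<psi> x)) \<le> (\<integral>\<^sup>+y. ennreal (norm (fourier ?\<gamma> (x - y))) * ennreal (norm (G y)) \<partial>lborel)" for x
    proof -
      have [measurable]: "fourier ?\<gamma> \<in> borel_measurable borel" by (rule fourier_measurable[OF intg])
      have "fourier \<psi> x = (LINT \<xi>|lborel. fourier G' \<xi> * (cis (- (\<xi> \<bullet> x)) * ?\<gamma> \<xi>))"
        unfolding fourier_def[of \<psi>] \<psi>_def by (simp add: mult.left_commute)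
      also have "\<dots> = (LINT y|lborel. G' y * fourier (\<lambda>\<xi>. cis (- (\<xi> \<bullet> x)) * ?\<gamma> \<xi>) y)"
        by (intro fourier_duality intG' fourier_integrable intg)
      also have "\<dots> = (LINT y|lborel. G' y * fourier ?\<gamma> (y + x))" by (simp add: fourier_modulate)
      finally have "ennreal (norm (fourier \<psi> x)) \<le> (\<integral>\<^sup>+y. norm (G' y * fourier ?\<gamma> (y + x)) \<partial>lborel)"
        by (simp only:) (rule norm_integral_le_nn_integral, measurable)
      also have "\<dots> = (\<integral>\<^sup>+y. norm (G' (0 - y) * fourier ?\<gamma> ((0 - y) + x)) \<partial>lborel)"
        by (rule nn_integral_lborel_reflect[symmetric]) measurable
      also have "\<dots> = (\<integral>\<^sup>+y. ennreal (norm (fourier ?\<gamma> (x - y))) * ennreal (norm (G y)) \<partial>lborel)"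
        by (intro nn_integral_cong) (simp add: G'_def norm_mult ennreal_mult' mult.commute)
      finally show ?thesis .
    qed
    have sq: "(LINT \<xi>|lborel. fourier G \<xi> * \<psi> \<xi>) = of_real (LINT \<xi>|lborel. (norm (fourier G \<xi>))\<^sup>2 * norm (?\<gamma> \<xi>))"
    proof -
      have "fourier G \<xi> * \<psi> \<xi> = of_real ((norm (fourier G \<xi>))\<^sup>2 * norm (?\<gamma> \<xi>))" for \<xi>
        unfolding \<psi>_def cnjG[symmetric] mult.assoc[symmetric] complex_norm_square[symmetric]
        by (simp add: gauss_def)
      then show ?thesis by (simp only: integral_complex_of_real)
    qed
    have "integrable lborel (\<lambda>\<xi>. (norm (fourier G \<xi>))\<^sup>2 * norm (?\<gamma> \<xi>))"
    proof (rule Bochner_Integration.integrable_bound[OF integrable_mult_right[OF integrable_norm[OF intg], of "B\<^sup>2"]])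
      show "AE \<xi> in lborel. norm ((norm (fourier G \<xi>))\<^sup>2 * norm (?\<gamma> \<xi>)) \<le> norm (B\<^sup>2 * norm (?\<gamma> \<xi>))"
        using B by (intro AE_I2) (auto intro!: mult_right_mono power_mono)
    qed measurable
    then have "(\<integral>\<^sup>+\<xi>. ennreal ((norm (fourier G \<xi>))\<^sup>2 * norm (?\<gamma> \<xi>)) \<partial>lborel) = ennreal (LINT \<xi>|lborel. (norm (fourier G \<xi>))\<^sup>2 * norm (?\<gamma> \<xi>))"
      by (rule nn_integral_eq_integral) simp
    also have "\<dots> \<le> ennreal (norm (LINT \<xi>|lborel. fourier G \<xi> * \<psi> \<xi>))"
      unfolding sq by (intro ennreal_leI) simp
    also have "(LINT \<xi>|lborel. fourier G \<xi> * \<psi> \<xi>) = (LINT x|lborel. G x * fourier \<psi> x)"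
      by (rule fourier_duality[OF int int\<psi>])
    also have "ennreal (norm \<dots>) \<le> (\<integral>\<^sup>+x. norm (G x * fourier \<psi> x) \<partial>lborel)"
      by (rule norm_integral_le_nn_integral) (use fourier_measurable[OF int\<psi>] in auto)
    also have "\<dots> \<le> ?C * nsq G"
    proof (rule ennreal_power2_le_iff)
      have 1: "(\<integral>\<^sup>+x. norm (G x * fourier \<psi> x) \<partial>lborel)\<^sup>2 \<le> nsq G * nsq (fourier \<psi>)"
        by (rule L2_mult_integrable) (use fourier_measurable[OF int\<psi>] in auto)
      have "nsq (fourier \<psi>) \<le> (\<integral>\<^sup>+x. (\<integral>\<^sup>+y. ennreal (norm (fourier ?\<gamma> (x - y))) * ennreal (norm (G y)) \<partial>lborel)\<^sup>2 \<partial>lborel)"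
        unfolding nsq_def by (intro nn_integral_mono power_mono f\<psi>) auto
      also have "\<dots> \<le> (\<integral>\<^sup>+\<xi>. norm (fourier ?\<gamma> \<xi>) \<partial>lborel)\<^sup>2 * (\<integral>\<^sup>+y. (ennreal (norm (G y)))\<^sup>2 \<partial>lborel)"
        by (rule Young_L1_L2) (use fourier_measurable[OF intg] in auto)
      also have "\<dots> = ?C\<^sup>2 * nsq G" by (simp add: nn_integral_fourier_gauss nsq_def)
      finally have "nsq G * nsq (fourier \<psi>) \<le> nsq G * (?C\<^sup>2 * nsq G)" by (rule mult_left_mono) simp
      also have "\<dots> = (?C * nsq G)\<^sup>2" by (simp only: power2_eq_square mult_ac)
      finally show "(\<integral>\<^sup>+x. norm (G x * fourier \<psi> x) \<partial>lborel)\<^sup>2 \<le> (?C * nsq G)\<^sup>2"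
        using 1 by (rule order_trans[rotated])
    qed
    finally show ?thesis by (simp add: ennreal_mult' ennreal_power)
  qed
  have lim: "liminf (\<lambda>k. (ennreal (norm (fourier G \<xi>)))\<^sup>2 * norm (gauss (eps k) \<xi>)) = (ennreal (norm (fourier G \<xi>)))\<^sup>2" for \<xi>
  proof -
    have "(\<lambda>k. ennreal ((norm (fourier G \<xi>))\<^sup>2 * norm (gauss (eps k) \<xi>))) \<longlonglongrightarrow> ennreal ((norm (fourier G \<xi>))\<^sup>2 * norm (1::complex))"
      by (intro tendsto_ennrealI tendsto_intros gauss_tendsto)
    then have "(\<lambda>k. (ennreal (norm (fourier G \<xi>)))\<^sup>2 * norm (gauss (eps k) \<xi>)) \<longlonglongrightarrow> (ennreal (norm (fourier G \<xi>)))\<^sup>2"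
      by (simp add: ennreal_mult' ennreal_power)
    then show ?thesis by (rule lim_imp_Liminf[OF sequentially_bot])
  qed
  have "nsq (fourier G) = (\<integral>\<^sup>+\<xi>. liminf (\<lambda>k. (ennreal (norm (fourier G \<xi>)))\<^sup>2 * norm (gauss (eps k) \<xi>)) \<partial>lborel)"
    unfolding nsq_def lim ..
  also have "\<dots> \<le> liminf (\<lambda>k. \<integral>\<^sup>+\<xi>. (ennreal (norm (fourier G \<xi>)))\<^sup>2 * norm (gauss (eps k) \<xi>) \<partial>lborel)"
    by (rule nn_integral_liminf) measurable
  also have "\<dots> \<le> ?C * nsq G"
    by (rule Liminf_le) (use main in auto)
  finally show ?thesis .
qed

section \<open>The Fourier transform on square-integrable functions\<close>

lemma rapid_nsq:
  fixes f :: "real^'n::finite \<Rightarrow> complex"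
  assumes "rapid f" and [measurable]: "f \<in> borel_measurable borel" shows "nsq f < \<infinity>"
proof -
  have "integrable lborel (\<lambda>x. f x * f x)"
    by (intro rapid_integrable rapid_square assms) simp
  then show ?thesis
    by (simp add: integrable_iff_bounded nsq_def norm_mult ennreal_mult' power2_eq_square)
qed

lemma schwartz_nsq: "\<phi> \<in> schwartz \<Longrightarrow> nsq \<phi> < \<infinity>"
  by (rule rapid_nsq[OF schwartz_rapid schwartz_measurable])

lemma tail_tendsto_0:
  fixes G :: "real^'n::finite \<Rightarrow> complex"
  assumes [measurable]: "G \<in> borel_measurable borel" and fin: "nsq G < \<infinity>"
  shows "(\<lambda>k. nsq (\<lambda>x. indicator (- cball 0 (real k)) x * G x)) \<longlonglongrightarrow> 0"
proof -
  have "(\<lambda>k. \<integral>\<^sup>+x. (ennreal (norm (indicator (- cball 0 (real k)) x * G x)))\<^sup>2 \<partial>lborel) \<longlonglongrightarrow> (\<integral>\<^sup>+x. (0::ennreal) \<partial>(lborel :: (real^'n) measure))"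
  proof (rule nn_integral_dominated_convergence[where w = "\<lambda>x. (ennreal (norm (G x)))\<^sup>2"])
    show "AE x in lborel. (ennreal (norm (indicator (- cball 0 (real k)) x * G x)))\<^sup>2 \<le> (ennreal (norm (G x)))\<^sup>2" for k
      by (intro AE_I2 power_mono ennreal_leI) (auto simp: indicator_def)
    show "AE x in lborel. (\<lambda>k. (ennreal (norm (indicator (- cball 0 (real k)) x * G x)))\<^sup>2) \<longlonglongrightarrow> 0"
    proof (rule AE_I2, rule tendsto_eventually)
      fix x :: "real^'n"
      obtain K where K: "norm x \<le> real K" using real_arch_simple by blast
      show "\<forall>\<^sub>F k in sequentially. (ennreal (norm (indicator (- cball 0 (real k)) x * G x)))\<^sup>2 = 0"
        unfolding eventually_sequentially
      proof (intro exI[of _ K] allI impI)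
        fix k assume "K \<le> k"
        then have "norm x \<le> real k" using K by (meson of_nat_mono order_trans)
        then show "(ennreal (norm (indicator (- cball 0 (real k)) x * G x)))\<^sup>2 = 0" by simp
      qed
    qed
  qed (use fin in \<open>auto simp: nsq_def\<close>)
  then show ?thesis by (simp add: nsq_def)
qed

lemma bounded_support_integrable:
  fixes G :: "real^'n::finite \<Rightarrow> complex"
  assumes [measurable]: "G \<in> borel_measurable borel" and fin: "nsq G < \<infinity>"
  shows "integrable lborel (\<lambda>x. indicator (cball 0 r) x * G x)"
proof (rule L2_mult_integrable(2)[OF _ _ _ fin])
  have "nsq (indicator (cball 0 r) :: real^'n \<Rightarrow> complex) = (\<integral>\<^sup>+x. indicator (cball 0 r :: (real^'n) set) x \<partial>lborel)"
    unfolding nsq_def by (intro nn_integral_cong) (auto simp: indicator_def)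
  also have "\<dots> < \<infinity>" using emeasure_lborel_cball_finite[of "0::real^'n" r] by simp
  finally show "nsq (indicator (cball 0 r) :: real^'n \<Rightarrow> complex) < \<infinity>" .
qed (auto intro!: borel_measurable_indicator)

text \<open>The Fourier transform of \<open>G \<in> L\<^sup>2\<close> is the sum of the transforms of the pieces of \<open>G\<close> that
  live between balls whose radii are so large that the norms of the pieces decrease geometrically.\<close>

lemma L2_fourier:
  fixes G :: "real^'n::finite \<Rightarrow> complex"
  assumes [measurable]: "G \<in> borel_measurable borel" and fin: "nsq G < \<infinity>"
  shows "\<exists>g. g \<in> borel_measurable borel \<and> nsq g \<le> ennreal (64 * (2 * pi) ^ CARD('n)) * nsq G \<and>
    (\<forall>\<phi>\<in>schwartz. (LINT x|lborel. g x * \<phi> x) = (LINT \<xi>|lborel. G \<xi> * fourier \<phi> \<xi>))"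
proof -
  \<comment> \<open>Relative to the squared norm of \<open>G\<close>, the ball \<open>B k\<close> leaves a tail of size \<open>8\<^sup>-\<^sup>k\<close>. The piece \<open>F k\<close> of \<open>G\<close>
    between the balls \<open>B (k - 1)\<close> and \<open>B k\<close> is bounded by the tails of index \<open>k - 1\<close> and \<open>k\<close>, so
    its size is at most \<open>9 * 8\<^sup>-\<^sup>k\<close>, which \<open>16 * 8\<^sup>-\<^sup>k\<close> majorises. The signs of \<open>D k\<close> make the
    pieces telescope even if the radii are not increasing.\<close>
  obtain N where N: "nsq G = ennreal N" "N \<ge> 0" using fin by (cases "nsq G") auto
  let ?T = "\<lambda>r::nat. nsq (\<lambda>x. indicator (- cball 0 (real r)) x * G x)"
  have tails: "\<exists>r. ?T r \<le> ennreal (N * (1 / 8) ^ k)" for k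
  proof (cases "N = 0")
    case True
    have "?T 0 \<le> nsq G" by (rule nsq_mono) (auto simp: indicator_def)
    then have "?T 0 \<le> ennreal (N * (1 / 8) ^ k)" using N True by (simp only: mult_zero_left)
    then show ?thesis by (rule exI)
  next
    case False
    then have "0 < ennreal (N * (1 / 8) ^ k)" using N by simp
    then have "\<forall>\<^sub>F r in sequentially. ?T r < ennreal (N * (1 / 8) ^ k)"
      by (rule order_tendstoD(2)[OF tail_tendsto_0[OF assms]])
    then show ?thesis by (meson eventually_sequentially less_imp_le order.refl)
  qed
  then obtain R where R: "\<And>k. ?T (R k) \<le> ennreal (N * (1 / 8) ^ k)" by metis
  define B where "B k = (cball 0 (real (R k)) :: (real^'n) set)" for k
  have [measurable]: "B k \<in> sets borel" for k by (simp add: B_def)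
  define D where "D k x = (indicator (B k) x - (if k = 0 then 0 else indicator (B (k - 1)) x) :: complex)" for k x
  define F where "F k x = D k x * G x" for k x
  have [measurable]: "D k \<in> borel_measurable borel" for k unfolding D_def by (cases "k = 0") auto
  have Fm [measurable]: "F k \<in> borel_measurable borel" for k unfolding F_def by measurable
  have telescope: "(\<Sum>k<Suc m. F k x) = indicator (B m) x * G x" for m x
  proof -
    have "(\<Sum>k<Suc m. D k x) = indicator (B m) x" by (induction m) (auto simp: D_def)
    then show ?thesis by (simp add: F_def flip: sum_distrib_right)
  qed
  have intB: "integrable lborel (\<lambda>x. indicator (B k) x * G x)" for k
    unfolding B_def by (rule bounded_support_integrable[OF assms])
  have intF: "integrable lborel (F k)" for k
  proof (cases k)
    case 0
    then show ?thesis using intB[of 0] by (simp add: F_def [abs_def] D_def)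
  next
    case (Suc j)
    then have "F k = (\<lambda>x. indicator (B k) x * G x - indicator (B j) x * G x)"
      by (auto simp: F_def D_def left_diff_distrib)
    then show ?thesis using intB by simp
  qed
  have F: "nsq (F k) \<le> ennreal (16 * N * (1 / 8) ^ k)" for k
  proof (cases k)
    case 0
    have "nsq (F 0) \<le> nsq G" by (rule nsq_mono) (auto simp: F_def D_def indicator_def)
    also have "\<dots> \<le> ennreal (16 * N * (1 / 8) ^ 0)" using N by (simp add: ennreal_leI)
    finally show ?thesis using 0 by simp
  next
    case (Suc j)
    have "nsq (F k) \<le> (\<integral>\<^sup>+x. (ennreal (norm (indicator (- B k) x * G x)))\<^sup>2 + (ennreal (norm (indicator (- B j) x * G x)))\<^sup>2 \<partial>lborel)"
      unfolding nsq_def F_def D_def using Suc by (intro nn_integral_mono) (auto simp: indicator_def)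
    also have "\<dots> = ?T (R k) + ?T (R j)"
      unfolding nsq_def B_def[symmetric] by (rule nn_integral_add) auto
    also have "\<dots> \<le> ennreal (N * (1 / 8) ^ k) + ennreal (N * (1 / 8) ^ j)" by (intro add_mono R)
    also have "\<dots> \<le> ennreal (16 * N * (1 / 8) ^ k)"
      using N Suc by (simp flip: ennreal_plus add: ennreal_leI mult_left_mono)
    finally show ?thesis .
  qed
  let ?C = "(2 * pi) ^ CARD('n)"
  have "nsq (fourier (F k)) \<le> ennreal ((16 * ?C * N) * (1 / 8) ^ k)" for k
  proof -
    have "nsq (fourier (F k)) \<le> ennreal ?C * nsq (F k)"
      by (rule Plancherel_le[OF intF le_less_trans[OF F]]) simp
    also have "\<dots> \<le> ennreal ?C * ennreal (16 * N * (1 / 8) ^ k)" by (intro mult_left_mono F) auto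
    finally show ?thesis using N by (simp add: mult_ac flip: ennreal_mult)
  qed
  moreover have "0 \<le> 16 * ?C * N" using N by simp
  ultimately obtain g where g: "g \<in> borel_measurable borel" "nsq g \<le> ennreal (4 * (16 * ?C * N))"
    "\<forall>b\<in>borel_measurable borel. nsq b < \<infinity> \<longrightarrow>
        (\<lambda>k. LINT x|lborel. fourier (F k) x * b x) sums (LINT x|lborel. g x * b x)"
    using L2_series[of "\<lambda>k. fourier (F k)" "16 * ?C * N", OF fourier_measurable[OF intF]] by blast
  show ?thesis
  proof (intro exI[of _ g] conjI ballI g(1))
    show "nsq g \<le> ennreal (64 * ?C) * nsq G" using g(2) N by (simp add: mult_ac flip: ennreal_mult)
    fix \<phi> :: "real^'n \<Rightarrow> complex" assume \<phi>: "\<phi> \<in> schwartz"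
    let ?f = "fourier \<phi>"
    have [measurable]: "?f \<in> borel_measurable borel" by (rule schwartz_measurable[OF fourier_schwartz[OF \<phi>]])
    have f: "nsq ?f < \<infinity>" by (rule schwartz_nsq[OF fourier_schwartz[OF \<phi>]])
    have intGf: "integrable lborel (\<lambda>x. G x * ?f x)" by (rule L2_mult_integrable(2)[OF _ _ fin f]) auto
    have nF: "nsq (F k) < \<infinity>" for k by (rule le_less_trans[OF F]) simp
    have "(\<lambda>k. LINT x|lborel. fourier (F k) x * \<phi> x) sums (LINT x|lborel. g x * \<phi> x)"
      using g(3) schwartz_measurable[OF \<phi>] schwartz_nsq[OF \<phi>] by blast
    then have "(\<lambda>m. \<Sum>k<Suc m. LINT x|lborel. fourier (F k) x * \<phi> x) \<longlonglongrightarrow> (LINT x|lborel. g x * \<phi> x)"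
      unfolding sums_def by (rule LIMSEQ_Suc)
    moreover have "(\<Sum>k<Suc m. LINT x|lborel. fourier (F k) x * \<phi> x) = (LINT x|lborel. indicator (B m) x * G x * ?f x)" for m
    proof -
      have "(\<Sum>k<Suc m. LINT x|lborel. fourier (F k) x * \<phi> x) = (\<Sum>k<Suc m. LINT x|lborel. F k x * ?f x)"
        by (intro sum.cong refl fourier_duality intF schwartz_integrable \<phi>)
      also have "\<dots> = (LINT x|lborel. (\<Sum>k<Suc m. F k x * ?f x))"
        by (rule Bochner_Integration.integral_sum[symmetric]) (rule L2_mult_integrable(2)[OF _ _ nF f]; measurable)
      also have "\<dots> = (LINT x|lborel. indicator (B m) x * G x * ?f x)"
        by (simp only: telescope flip: sum_distrib_right)
      finally show ?thesis .
    qed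
    moreover have "(\<lambda>m. LINT x|lborel. indicator (B m) x * G x * ?f x) \<longlonglongrightarrow> (LINT x|lborel. G x * ?f x)"
    proof -
      obtain M where M: "nsq ?f = ennreal M" "M \<ge> 0" using f by (cases "nsq ?f") auto
      have "(\<lambda>m. norm ((LINT x|lborel. indicator (B m) x * G x * ?f x) - (LINT x|lborel. G x * ?f x))) \<longlonglongrightarrow> 0"
      proof (rule tendsto_sandwich[OF _ _ tendsto_const])
        show "\<forall>\<^sub>F m in sequentially. norm ((LINT x|lborel. indicator (B m) x * G x * ?f x) - (LINT x|lborel. G x * ?f x)) \<le> sqrt (N * (1 / 8) ^ m * M)"
        proof (rule always_eventually, rule allI, rule real_le_rsqrt)
          fix m
          let ?h = "\<lambda>x. indicator (- B m) x * G x"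
          have i: "integrable lborel (\<lambda>x. indicator (B m) x * G x * ?f x)"
            unfolding mult.assoc by (rule integrable_unimodular[OF intGf]) (auto simp: indicator_def)
          have "(LINT x|lborel. G x * ?f x) - (LINT x|lborel. indicator (B m) x * G x * ?f x) = (LINT x|lborel. ?h x * ?f x)"
            unfolding Bochner_Integration.integral_diff[OF intGf i, symmetric]
            by (intro Bochner_Integration.integral_cong refl) (auto simp: indicator_def)
          then have "ennreal (norm ((LINT x|lborel. indicator (B m) x * G x * ?f x) - (LINT x|lborel. G x * ?f x))) = ennreal (norm (LINT x|lborel. ?h x * ?f x))"
            by (simp add: norm_minus_commute)
          also have "\<dots> \<le> (\<integral>\<^sup>+x. norm (?h x * ?f x) \<partial>lborel)" by (rule norm_integral_le_nn_integral) measurable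
          finally have "(ennreal (norm ((LINT x|lborel. indicator (B m) x * G x * ?f x) - (LINT x|lborel. G x * ?f x))))\<^sup>2 \<le> (\<integral>\<^sup>+x. norm (?h x * ?f x) \<partial>lborel)\<^sup>2"
            by (intro power_mono) auto
          also have "\<dots> \<le> nsq ?h * nsq ?f" by (rule L2_mult_integrable) auto
          also have "\<dots> \<le> ennreal (N * (1 / 8) ^ m) * ennreal M"
            using R[of m] M by (intro mult_mono) (auto simp: B_def)
          finally show "(norm ((LINT x|lborel. indicator (B m) x * G x * ?f x) - (LINT x|lborel. G x * ?f x)))\<^sup>2 \<le> N * (1 / 8) ^ m * M"
            using N M by (simp add: ennreal_power flip: ennreal_mult)
        qed
        have "(\<lambda>m. sqrt (N * (1 / 8) ^ m * M)) \<longlonglongrightarrow> sqrt (N * 0 * M)"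
          by (intro tendsto_intros LIMSEQ_power_zero) auto
        then show "(\<lambda>m. sqrt (N * (1 / 8) ^ m * M)) \<longlonglongrightarrow> 0" by simp
      qed auto
      then show ?thesis by (simp add: LIM_zero_iff tendsto_norm_zero_iff)
    qed
    ultimately show "(LINT x|lborel. g x * \<phi> x) = (LINT \<xi>|lborel. G \<xi> * ?f \<xi>)"
      by (simp only: LIMSEQ_unique)
  qed
qed

section \<open>Sobolev distributions and their Fourier densities\<close>

lemma inv_fourier_fourier_minus: "inv_fourier \<phi> x = fourier \<phi> (- x) / of_real ((2 * pi) ^ CARD('n))"
  for x :: "real^'n::finite"
  unfolding inv_fourier_def fourier_def by (simp add: inner_commute)

lemma fourier_inversion_schwartz:
  fixes \<phi> :: "real^'n::finite \<Rightarrow> complex"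
  assumes \<phi>: "\<phi> \<in> schwartz"
  shows "fourier (fourier \<phi>) x = of_real ((2 * pi) ^ CARD('n)) * \<phi> (- x)"
proof -
  obtain C where C: "\<And>x. (1 + norm x) ^ 0 * norm (\<phi> x) \<le> C" using rapidE[OF schwartz_rapid[OF \<phi>]] by blast
  show ?thesis
  proof (rule fourier_inversion)
    show "norm (\<phi> x) \<le> C" for x using C[of x] by simp
  qed (auto intro: \<phi> schwartz_integrable smooth_continuous_on schwartz_smooth fourier_schwartz)
qed

lemma inv_fourier_schwartz:
  fixes \<phi> :: "real^'n::finite \<Rightarrow> complex"
  assumes "\<phi> \<in> schwartz" shows "inv_fourier \<phi> \<in> schwartz"
  using schwartz_cmult[OF schwartz_uminus_arg[OF fourier_schwartz[OF assms]], of "inverse (of_real ((2 * pi) ^ CARD('n)))"]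
  by (simp add: inv_fourier_fourier_minus[abs_def] divide_inverse mult.commute)

lemma inv_fourier_fourier:
  fixes \<phi> :: "real^'n::finite \<Rightarrow> complex"
  assumes "\<phi> \<in> schwartz" shows "inv_fourier (fourier \<phi>) = \<phi>"
  by (rule ext) (simp add: inv_fourier_fourier_minus fourier_inversion_schwartz[OF assms])

lemma fourier_inv_fourier:
  fixes \<phi> :: "real^'n::finite \<Rightarrow> complex"
  assumes "\<phi> \<in> schwartz" shows "fourier (inv_fourier \<phi>) = \<phi>"
proof
  fix x
  have "inv_fourier \<phi> = (\<lambda>x. inverse (of_real ((2 * pi) ^ CARD('n))) * fourier \<phi> (- x))"
    by (simp add: inv_fourier_fourier_minus[abs_def] divide_inverse mult.commute)
  then have "fourier (inv_fourier \<phi>) x = inverse (of_real ((2 * pi) ^ CARD('n))) * fourier (fourier \<phi>) (- x)"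
    by (simp only: fourier_cmult fourier_reflect[OF schwartz_measurable[OF fourier_schwartz[OF assms]]])
  then show "fourier (inv_fourier \<phi>) x = \<phi> x"
    by (simp add: fourier_inversion_schwartz[OF assms] del: of_real_power of_real_mult)
qed

lemma bessel_weight: "bessel s \<phi> = inv_fourier (\<lambda>\<xi>. of_real (weight s \<xi>) * fourier \<phi> \<xi>)"
  by (simp add: bessel_def weight_def)

lemma bessel_schwartz: "\<phi> \<in> schwartz \<Longrightarrow> bessel s \<phi> \<in> schwartz"
  unfolding bessel_weight by (intro inv_fourier_schwartz schwartz_weight_mult fourier_schwartz)

text \<open>The squared \<open>\<H>\<^sup>s\<close>-norm (up to a constant) of the function with Fourier density \<open>P\<close>.\<close>

definition hsq :: "real \<Rightarrow> (real^'n::finite \<Rightarrow> complex) \<Rightarrow> ennreal" where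
  "hsq s P = nsq (\<lambda>\<xi>. of_real (weight s \<xi>) * P \<xi>)"

text \<open>The norm of \<open>fourier P\<close> in the Wiener algebra of absolutely convergent Fourier integrals.\<close>

definition wnorm :: "(real^'n::finite \<Rightarrow> complex) \<Rightarrow> ennreal" where
  "wnorm P = (\<integral>\<^sup>+\<xi>. norm (P \<xi>) \<partial>lborel)"

text \<open>The square of the constant in the embedding of \<open>\<H>\<^sup>s\<close> into the Wiener algebra.\<close>

definition wmass :: "real \<Rightarrow> 'n::finite itself \<Rightarrow> real" where
  "wmass s _ = enn2real (\<integral>\<^sup>+\<xi>. ennreal ((weight (- s) (\<xi>::real^'n))\<^sup>2) \<partial>lborel)"

lemma wmass_nonneg [simp]: "wmass s T \<ge> 0" by (simp add: wmass_def)

lemma ennreal_wmass: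
  assumes "s > real CARD('n::finite) / 2"
  shows "ennreal (wmass s TYPE('n)) = (\<integral>\<^sup>+\<xi>. ennreal ((weight (- s) (\<xi>::real^'n))\<^sup>2) \<partial>lborel)"
  unfolding wmass_def using weight_square_integrable[OF assms] by (intro ennreal_enn2real) auto

lemma nsq_weight:
  assumes "s > real CARD('n::finite) / 2"
  shows "nsq (\<lambda>\<xi>::real^'n. complex_of_real (weight (- s) \<xi>)) = ennreal (wmass s TYPE('n))"
  unfolding nsq_def ennreal_wmass[OF assms] by (simp add: ennreal_power)

text \<open>The embedding into the Wiener algebra, by the Cauchy--Schwarz inequality.\<close>

lemma wnorm_le_hsq:
  fixes P :: "real^'n::finite \<Rightarrow> complex"
  assumes s: "s > real CARD('n) / 2" and [measurable]: "P \<in> borel_measurable borel"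
  shows "(wnorm P)\<^sup>2 \<le> ennreal (wmass s TYPE('n)) * hsq s P"
proof -
  have "wnorm P = (\<integral>\<^sup>+\<xi>. norm (complex_of_real (weight (- s) \<xi>) * (of_real (weight s \<xi>) * P \<xi>)) \<partial>lborel)"
    unfolding wnorm_def by (simp add: norm_mult weight_uminus mult.assoc[symmetric])
  also have "\<dots>\<^sup>2 \<le> nsq (\<lambda>\<xi>::real^'n. complex_of_real (weight (- s) \<xi>)) * nsq (\<lambda>\<xi>. of_real (weight s \<xi>) * P \<xi>)"
    by (rule L2_mult_integrable) measurable
  finally show ?thesis by (simp add: nsq_weight[OF s] hsq_def)
qed

lemma hsq_integrable:
  fixes P :: "real^'n::finite \<Rightarrow> complex"
  assumes s: "s > real CARD('n) / 2" and P [measurable]: "P \<in> borel_measurable borel" and fin: "hsq s P < \<infinity>"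
  shows "integrable lborel P"
proof -
  have "(wnorm P)\<^sup>2 < \<infinity>" using wnorm_le_hsq[OF s P] fin by (auto simp: ennreal_mult_less_top intro: le_less_trans)
  then have "wnorm P < \<infinity>" by (simp add: power_less_top_ennreal)
  then show ?thesis unfolding wnorm_def by (intro integrableI_bounded) auto
qed

text \<open>The constant of \<open>L2_fourier\<close>, by which \<open>L\<^sup>2\<close>-norms of distributions and of their Fourier
  densities are compared.\<close>

definition Cn :: "'n::finite itself \<Rightarrow> real" where
  "Cn _ = 64 * (2 * pi) ^ CARD('n)"

text \<open>A distribution in \<open>\<H>\<^sup>s\<close> with \<open>s > n/2\<close> is a function whose Fourier density has finite
  \<open>\<H>\<^sup>s\<close>-norm. The density is found without a Fourier transform of distributions: the identity
  defining \<open>g\<close> is transported by Fourier inversion on Schwartz functions.\<close>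

lemma sobolev_imp_fourier_density:
  fixes u :: "'n::finite functional"
  assumes s: "s > real CARD('n) / 2" and g: "L2_density (bessel_distr s u) g"
  shows "\<exists>P. P \<in> borel_measurable borel \<and> hsq s P \<le> ennreal (Cn TYPE('n)) * nsq g \<and>
    (\<forall>\<phi>\<in>schwartz. u \<phi> = distr_of_fun (fourier P) \<phi>)"
proof -
  have g': "g \<in> borel_measurable borel" "nsq g < \<infinity>" and
    gu: "\<And>\<phi>. \<phi> \<in> schwartz \<Longrightarrow> u (bessel s \<phi>) = (LINT x|lborel. g x * \<phi> x)"
    using g by (auto simp: L2_density_def L2_iff bessel_distr_def distr_of_fun_def)
  let ?c = "(2 * pi) ^ CARD('n)"
  obtain G where [measurable]: "G \<in> borel_measurable borel" and nG: "nsq G \<le> ennreal (64 * ?c) * nsq g" and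
    G: "\<forall>\<phi>\<in>schwartz. (LINT x|lborel. G x * \<phi> x) = (LINT \<xi>|lborel. g \<xi> * fourier \<phi> \<xi>)"
    using L2_fourier[OF g'] by blast
  define P where "P \<xi> = of_real (weight (- s) \<xi>) * G (- \<xi>) / of_real ?c" for \<xi>
  have Pm [measurable]: "P \<in> borel_measurable borel" unfolding P_def by measurable
  have pi1: "?c \<ge> 1" using pi_ge_two by (intro one_le_power) linarith
  have hP: "hsq s P \<le> ennreal (Cn TYPE('n)) * nsq g"
  proof -
    have "hsq s P \<le> nsq (\<lambda>\<xi>. G (- \<xi>))"
      unfolding hsq_def
    proof (rule nsq_mono)
      fix \<xi> :: "real^'n"
      have "norm (of_real (weight s \<xi>) * P \<xi>) = norm (G (- \<xi>)) / ?c"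
        by (simp add: P_def norm_mult norm_divide norm_inverse weight_uminus norm_power)
      also have "\<dots> \<le> norm (G (- \<xi>)) / 1" by (intro divide_left_mono pi1) auto
      finally show "norm (of_real (weight s \<xi>) * P \<xi>) \<le> norm (G (- \<xi>))" by simp
    qed
    also have "\<dots> = nsq G" unfolding nsq_def
      using nn_integral_lborel_reflect[of "\<lambda>x. (ennreal (norm (G x)))\<^sup>2" 0] by simp
    finally show ?thesis using nG by (simp add: Cn_def)
  qed
  have intP: "integrable lborel P"
    by (rule hsq_integrable[OF s Pm le_less_trans[OF hP]]) (use g' in \<open>auto simp: ennreal_mult_less_top\<close>)
  show ?thesis
  proof (intro exI[of _ P] conjI ballI Pm hP)
    fix \<phi> :: "real^'n \<Rightarrow> complex" assume \<phi>: "\<phi> \<in> schwartz"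
    \<comment> \<open>The function \<open>fourier \<eta>\<close> is the image of \<open>\<phi>\<close> under \<open>(1 - \<Delta>)\<^bsup>-s/2\<^esup>\<close>: the reflection in
      \<open>inv_fourier\<close> is undone by the second Fourier transform.\<close>
    define \<eta> where "\<eta> \<xi> = of_real (weight (- s) \<xi>) * inv_fourier \<phi> \<xi>" for \<xi>
    have \<eta>: "\<eta> \<in> schwartz" unfolding \<eta>_def by (intro schwartz_weight_mult inv_fourier_schwartz \<phi>)
    have "bessel s (fourier \<eta>) = inv_fourier (\<lambda>\<xi>. of_real (weight s \<xi>) * (of_real ?c * \<eta> (- \<xi>)))"
      unfolding bessel_weight by (simp only: fourier_inversion_schwartz[OF \<eta>])
    also have "(\<lambda>\<xi>. of_real (weight s \<xi>) * (of_real ?c * \<eta> (- \<xi>))) = fourier \<phi>"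
      by (rule ext) (simp add: \<eta>_def inv_fourier_fourier_minus weight_uminus)
    finally have b: "bessel s (fourier \<eta>) = \<phi>" by (simp add: inv_fourier_fourier[OF \<phi>])
    have "u \<phi> = (LINT x|lborel. g x * fourier \<eta> x)" using gu[OF fourier_schwartz[OF \<eta>]] b by simp
    also have "\<dots> = (LINT x|lborel. G x * \<eta> x)" by (rule G[rule_format, OF \<eta>, symmetric])
    also have "\<dots> = (LINT x|lborel. G (0 - x) * \<eta> (0 - x))"
      by (rule integral_lborel_reflect[symmetric]) (use schwartz_measurable[OF \<eta>] in measurable)
    also have "\<dots> = (LINT x|lborel. P x * fourier \<phi> x)"
      by (intro Bochner_Integration.integral_cong refl) (simp add: P_def \<eta>_def inv_fourier_fourier_minus)
    also have "\<dots> = (LINT x|lborel. fourier P x * \<phi> x)"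
      by (rule fourier_duality[OF intP schwartz_integrable[OF \<phi>], symmetric])
    finally show "u \<phi> = distr_of_fun (fourier P) \<phi>" by (simp add: distr_of_fun_def)
  qed
qed

text \<open>The norm of a Sobolev distribution is defined through a choice of the density; this
  transfers an estimate for one density to the chosen one.\<close>

lemma L2_density_norm_unique:
  fixes v :: "'n::finite functional" and h :: "real^'n \<Rightarrow> complex"
  assumes h: "h \<in> test_functions" "h \<noteq> (\<lambda>x. 0)" and f: "L2_density v f" and g: "L2_density v g"
  shows "nsq f = nsq g"
proof -
  have m [measurable]: "f \<in> borel_measurable borel" "g \<in> borel_measurable borel" and fin: "nsq f < \<infinity>" "nsq g < \<infinity>"
    using f g by (auto simp: L2_density_def L2_iff)
  have "AE x in lborel. f x - g x = 0"
  proof (rule orthogonal_test_functions_AE_0[OF h])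
    fix R
    have "integrable lborel (\<lambda>x. indicator (cball 0 R) x * f x - indicator (cball 0 R) x * g x)"
      using bounded_support_integrable[OF m(1) fin(1)] bounded_support_integrable[OF m(2) fin(2)] by (rule Bochner_Integration.integrable_diff)
    moreover have "indicator (cball 0 R) x * f x - indicator (cball 0 R) x * g x = indicator (cball 0 R) x *\<^sub>R (f x - g x)" for x
      by (simp add: indicator_def)
    ultimately show "integrable lborel (\<lambda>x. indicator (cball 0 R) x *\<^sub>R (f x - g x))" by simp
  next
    fix \<phi> :: "real^'n \<Rightarrow> complex" assume "\<phi> \<in> test_functions"
    then have \<phi>: "\<phi> \<in> schwartz" by (rule test_functions_schwartz)
    have [measurable]: "\<phi> \<in> borel_measurable borel" by (rule schwartz_measurable[OF \<phi>])
    have "integrable lborel (\<lambda>x. f x * \<phi> x)" "integrable lborel (\<lambda>x. g x * \<phi> x)"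
      using L2_mult_integrable(2)[OF m(1) _ fin(1) schwartz_nsq[OF \<phi>]] L2_mult_integrable(2)[OF m(2) _ fin(2) schwartz_nsq[OF \<phi>]] by auto
    then have "(LINT x|lborel. (f x - g x) * \<phi> x) = distr_of_fun f \<phi> - distr_of_fun g \<phi>"
      by (simp add: left_diff_distrib distr_of_fun_def)
    then show "(LINT x|lborel. (f x - g x) * \<phi> x) = 0" using f g \<phi> by (simp add: L2_density_def)
  qed auto
  then show ?thesis unfolding nsq_def by (intro nn_integral_cong_AE) auto
qed

text \<open>The distribution \<open>(1 - \<Delta>)\<^bsup>s/2\<^esup> u\<close> has the Fourier density \<open>\<langle>\<xi>\<rangle>\<^sup>s P \<xi>\<close>, which is
  square-integrable.\<close>

lemma fourier_density_imp_sobolev: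
  fixes u :: "'n::finite functional"
  assumes s: "s > real CARD('n) / 2" and P [measurable]: "P \<in> borel_measurable borel" and fin: "hsq s P < \<infinity>"
    and u: "\<And>\<phi>. \<phi> \<in> schwartz \<Longrightarrow> u \<phi> = distr_of_fun (fourier P) \<phi>"
  shows "\<exists>g. L2_density (bessel_distr s u) g \<and> nsq g \<le> ennreal (Cn TYPE('n)) * hsq s P"
proof -
  let ?G = "\<lambda>\<xi>. of_real (weight s \<xi>) * P \<xi>"
  have "nsq ?G < \<infinity>" "?G \<in> borel_measurable borel" using fin by (auto simp: hsq_def)
  from L2_fourier[OF this(2,1)] obtain g where g: "g \<in> borel_measurable borel"
    "nsq g \<le> ennreal (64 * (2 * pi) ^ CARD('n)) * nsq ?G"
    "\<forall>\<phi>\<in>schwartz. (LINT x|lborel. g x * \<phi> x) = (LINT \<xi>|lborel. ?G \<xi> * fourier \<phi> \<xi>)" by blast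
  have ng: "nsq g \<le> ennreal (Cn TYPE('n)) * hsq s P" using g(2) by (simp add: hsq_def Cn_def)
  have intP: "integrable lborel P" by (rule hsq_integrable[OF s P fin])
  show ?thesis
  proof (intro exI[of _ g] conjI ng)
    show "L2_density (bessel_distr s u) g"
      unfolding L2_density_def
    proof (intro conjI ballI)
      show "g \<in> L2" using g(1) le_less_trans[OF ng] fin by (simp add: L2_iff ennreal_mult_less_top)
      fix \<phi> :: "real^'n \<Rightarrow> complex" assume \<phi>: "\<phi> \<in> schwartz"
      have b: "bessel s \<phi> \<in> schwartz" by (rule bessel_schwartz[OF \<phi>])
      have "bessel_distr s u \<phi> = (LINT x|lborel. fourier P x * bessel s \<phi> x)"
        using u[OF b] by (simp add: bessel_distr_def distr_of_fun_def)
      also have "\<dots> = (LINT \<xi>|lborel. P \<xi> * fourier (bessel s \<phi>) \<xi>)"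
        by (rule fourier_duality[OF intP schwartz_integrable[OF b]])
      also have "\<dots> = (LINT \<xi>|lborel. ?G \<xi> * fourier \<phi> \<xi>)"
        unfolding bessel_weight fourier_inv_fourier[OF schwartz_weight_mult[OF fourier_schwartz[OF \<phi>]]]
        by (simp only: mult_ac)
      also have "\<dots> = distr_of_fun g \<phi>" using g(3)[rule_format, OF \<phi>] by (simp add: distr_of_fun_def)
      finally show "bessel_distr s u \<phi> = distr_of_fun g \<phi>" .
    qed
  qed
qed

section \<open>Taylor series of holomorphic functions of several variables\<close>

lemma norm_vector_smult: "norm (c *s (w :: complex^'d::finite)) = norm c * norm w"
  by (simp add: norm_vec_def norm_mult L2_set_right_distrib)

lemma bounded_linear_smult: "bounded_linear (\<lambda>t. t *s (w :: complex^'d::finite))"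
proof (rule bounded_linear_intro[where K = "norm w"])
  show "(r *\<^sub>R x) *s w = r *\<^sub>R (x *s w)" for r x
    by (simp add: vec_eq_iff)
qed (simp_all add: vec_eq_iff norm_vector_smult distrib_right)

lemma has_derivative_line: "((\<lambda>t. z + t *s w) has_derivative (\<lambda>h. h *s w)) (at t)"
  for z w :: "complex^'d::finite"
  using has_derivative_add[OF has_derivative_const bounded_linear.has_derivative[OF bounded_linear_smult has_derivative_ident]]
  by simp

lemma continuous_on_line: "continuous_on T (\<lambda>t. z + t *s (w :: complex^'d::finite))"
  by (rule has_derivative_continuous_on) (rule has_derivative_at_withinI[OF has_derivative_line])

lemma open_line_preimage:
  assumes "open S" shows "open {t. z + t *s (w :: complex^'d::finite) \<in> S}"
  using open_vimage[OF assms continuous_on_line[of UNIV z w]] by (simp add: vimage_def)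

lemma norm_axis_complex: "norm (axis j (1::complex) :: complex^'d::finite) = 1"
proof -
  have "(\<Sum>i\<in>UNIV. (norm (axis j (1::complex) $ i))\<^sup>2) = (\<Sum>i\<in>(UNIV::'d set). if i = j then 1 else 0)"
    by (intro sum.cong) (auto simp: axis_def)
  then show ?thesis by (simp add: norm_vec_def L2_set_def)
qed

text \<open>The derivative of \<open>\<Phi>\<close> at \<open>z\<close> in the direction \<open>w\<close>, as a complex derivative in one variable, so
  that Cauchy's estimates apply to it.\<close>

definition pd :: "(complex^'d::finite \<Rightarrow> complex) \<Rightarrow> complex^'d \<Rightarrow> complex^'d \<Rightarrow> complex" where
  "pd \<Phi> w z = deriv (\<lambda>t. \<Phi> (z + t *s w)) 0"

lemma several_derivative:
  assumes \<Phi>: "holomorphic_several \<Phi> S" and z: "z \<in> S"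
  shows "(\<Phi> has_derivative (\<lambda>w. pd \<Phi> w z)) (at z)" "pd \<Phi> (c *s w) z = c * pd \<Phi> w z"
    "pd \<Phi> (v + w) z = pd \<Phi> v z + pd \<Phi> w z"
proof -
  obtain L where L: "(\<Phi> has_derivative L) (at z)" "\<And>c w. L (c *s w) = c * L w"
    using \<Phi> z unfolding holomorphic_several_def by blast
  have *: "pd \<Phi> w z = L w" for w
  proof -
    have "((\<lambda>t. \<Phi> (z + t *s w)) has_derivative (\<lambda>h. L (h *s w))) (at 0)"
      by (rule has_derivative_compose[OF has_derivative_line]) (use L in simp)
    then have "((\<lambda>t. \<Phi> (z + t *s w)) has_field_derivative L w) (at 0)"
      unfolding has_field_derivative_def L(2) by (simp add: mult.commute[of _ "L w"])
    then show ?thesis unfolding pd_def by (rule DERIV_imp_deriv)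
  qed
  then have "(\<lambda>w. pd \<Phi> w z) = L" by blast
  with L * show "(\<Phi> has_derivative (\<lambda>w. pd \<Phi> w z)) (at z)" "pd \<Phi> (c *s w) z = c * pd \<Phi> w z" by auto
  show "pd \<Phi> (v + w) z = pd \<Phi> v z + pd \<Phi> w z"
    unfolding * using has_derivative_linear[OF L(1)] by (rule linear_add)
qed

lemma several_line_derivative:
  assumes "holomorphic_several \<Phi> S" and z: "z + t *s w \<in> S"
  shows "((\<lambda>t. \<Phi> (z + t *s w)) has_field_derivative pd \<Phi> w (z + t *s w)) (at t)"
proof -
  have "((\<lambda>t. \<Phi> (z + t *s w)) has_derivative (\<lambda>h. pd \<Phi> (h *s w) (z + t *s w))) (at t)"
    by (rule has_derivative_compose[OF has_derivative_line]) (rule several_derivative[OF assms])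
  then show ?thesis
    unfolding has_field_derivative_def several_derivative(2)[OF assms]
    by (simp add: mult.commute[of _ "pd \<Phi> w _"])
qed

lemma several_line_holomorphic:
  assumes "holomorphic_several \<Phi> S" "\<And>t. t \<in> T \<Longrightarrow> z + t *s w \<in> S"
  shows "(\<lambda>t. \<Phi> (z + t *s w)) holomorphic_on T"
  unfolding holomorphic_on_def field_differentiable_def
  using several_line_derivative[OF assms(1)] assms(2) by (blast intro: has_field_derivative_at_within)

lemma several_continuous_on:
  assumes "holomorphic_several \<Phi> S" shows "continuous_on S \<Phi>"
  by (rule has_derivative_continuous_on, rule has_derivative_at_withinI, rule several_derivative[OF assms])

lemma pd_bound:
  assumes \<Phi>: "holomorphic_several \<Phi> S" and S: "cball z \<rho> \<subseteq> S" and \<rho>: "\<rho> > 0"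
    and M: "\<And>x. x \<in> cball z \<rho> \<Longrightarrow> norm (\<Phi> x) \<le> M" and w: "norm w \<le> 1"
  shows "norm (pd \<Phi> w z) \<le> M / \<rho>"
proof -
  have in_ball: "z + t *s w \<in> cball z \<rho>" if "t \<in> cball 0 \<rho>" for t
    using that w mult_mono[of "norm t" \<rho> "norm w" 1] \<rho> by (simp add: dist_norm norm_vector_smult)
  have hol: "(\<lambda>t. \<Phi> (z + t *s w)) holomorphic_on cball 0 \<rho>"
    by (rule several_line_holomorphic[OF \<Phi>]) (use in_ball S in blast)
  have "norm ((deriv ^^ 1) (\<lambda>t. \<Phi> (z + t *s w)) 0) \<le> fact 1 * M / \<rho> ^ 1"
  proof (rule Cauchy_inequality)
    show "(\<lambda>t. \<Phi> (z + t *s w)) holomorphic_on ball 0 \<rho>"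
      using hol by (rule holomorphic_on_subset) auto
    show "continuous_on (cball 0 \<rho>) (\<lambda>t. \<Phi> (z + t *s w))" using hol by (rule holomorphic_on_imp_continuous_on)
    show "norm (\<Phi> (z + t *s w)) \<le> M" if "norm (0 - t) = \<rho>" for t
      using that by (intro M in_ball) simp
  qed (rule \<rho>)
  then show ?thesis by (simp add: pd_def)
qed

text \<open>On the complex line through \<open>z\<close> in the direction \<open>w\<close>, the points of parameter \<open>t\<close> in the unit
  disc have around them discs of radius \<open>r / (2 \<bar>w\<bar>)\<close> that are mapped into the ball of radius \<open>r\<close>.
  Cauchy's estimate bounds the second derivative in \<open>t\<close> there, and the remainder of the
  first-order expansion from \<open>t = 0\<close> to \<open>t = 1\<close> is at most that bound.\<close>

lemma several_quadratic:
  assumes \<Phi>: "holomorphic_several \<Phi> S" and S: "open S" "cball z r \<subseteq> S" and r: "r > 0"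
    and M: "\<And>x. x \<in> cball z r \<Longrightarrow> norm (\<Phi> x) \<le> M" and w: "norm w \<le> r / 2"
  shows "norm (\<Phi> (z + w) - \<Phi> z - pd \<Phi> w z) \<le> 8 * M / r\<^sup>2 * (norm w)\<^sup>2"
proof (cases "w = 0")
  case True
  have "z \<in> S" using subsetD[OF S(2), of z] r by simp
  then have "pd \<Phi> 0 z = 0" using several_derivative(2)[OF \<Phi>, of z 0 0] by simp
  then show ?thesis using True by simp
next
  case False
  define g where "g t = \<Phi> (z + t *s w)" for t
  define T where "T = {t. z + t *s w \<in> S}"
  define \<rho> where "\<rho> = r / (2 * norm w)"
  have \<rho>: "\<rho> > 0" using False r by (simp add: \<rho>_def)
  have T: "open T" unfolding T_def by (rule open_line_preimage[OF S(1)])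
  have g: "g holomorphic_on T" unfolding g_def by (rule several_line_holomorphic[OF \<Phi>]) (simp add: T_def)
  have in_ball: "z + t' *s w \<in> cball z r" if t: "t \<in> cball 0 1" "t' \<in> cball t \<rho>" for t t'
  proof -
    have "norm t' \<le> 1 + \<rho>" using t norm_triangle_ineq[of t "t' - t"] by (simp add: dist_norm norm_minus_commute)
    then have "norm t' * norm w \<le> (1 + \<rho>) * norm w" by (rule mult_right_mono) simp
    also have "\<dots> = norm w + r / 2" using False by (simp add: \<rho>_def field_simps)
    also have "\<dots> \<le> r" using w by simp
    finally show ?thesis by (simp add: dist_norm norm_vector_smult)
  qed
  have sub: "cball t \<rho> \<subseteq> T" if "t \<in> cball 0 1" for t
    using in_ball[OF that] S(2) by (auto simp: T_def)
  have dT: "t \<in> T" if "t \<in> cball 0 1" for t using sub[OF that] \<rho> by auto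
  have "norm ((deriv ^^ 0) g 1 - (\<Sum>i\<le>1. (deriv ^^ i) g 0 * (1 - 0) ^ i / fact i)) \<le> (8 * M / r\<^sup>2 * (norm w)\<^sup>2) * norm (1 - 0 :: complex) ^ Suc 1 / fact 1"
  proof (rule field_Taylor[where S = "cball 0 1"])
    fix i t assume t: "t \<in> cball (0::complex) 1"
    have "(deriv ^^ i) g holomorphic_on T" by (rule holomorphic_higher_deriv[OF g T])
    then show "((deriv ^^ i) g has_field_derivative (deriv ^^ Suc i) g t) (at t within cball 0 1)"
      using holomorphic_derivI[OF _ T dT[OF t]] by (auto intro: has_field_derivative_at_within)
  next
    fix t assume t: "t \<in> cball (0::complex) 1"
    have "norm ((deriv ^^ 2) g t) \<le> fact 2 * M / \<rho> ^ 2"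
    proof (rule Cauchy_inequality[OF _ _ \<rho>])
      show "g holomorphic_on ball t \<rho>" using g sub[OF t] by (meson ball_subset_cball holomorphic_on_subset)
      show "continuous_on (cball t \<rho>) g" using g sub[OF t] by (meson holomorphic_on_imp_continuous_on holomorphic_on_subset)
      show "norm (g t') \<le> M" if "norm (t - t') = \<rho>" for t'
        unfolding g_def by (intro M in_ball[OF t]) (use that in \<open>simp add: dist_norm\<close>)
    qed
    also have "fact 2 * M / \<rho> ^ 2 = 8 * M / r\<^sup>2 * (norm w)\<^sup>2"
      using False r by (simp add: \<rho>_def power_divide power_mult_distrib field_simps)
    finally show "norm ((deriv ^^ Suc 1) g t) \<le> 8 * M / r\<^sup>2 * (norm w)\<^sup>2" by (simp add: numeral_2_eq_2)
  qed auto
  then show ?thesis by (simp add: g_def [abs_def] pd_def diff_diff_eq)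
qed

lemma several_local_bound:
  assumes \<Phi>: "holomorphic_several \<Phi> S" and S: "open S" and z: "z \<in> S"
  shows "\<exists>r M. r > 0 \<and> cball z r \<subseteq> S \<and> (\<forall>x\<in>cball z r. norm (\<Phi> x) \<le> M)"
proof -
  obtain r where r: "r > 0" "cball z r \<subseteq> S" using open_contains_cball S z by blast
  have "compact (\<Phi> ` cball z r)"
    by (intro compact_continuous_image continuous_on_subset[OF several_continuous_on[OF \<Phi>] r(2)]) simp
  then have "bounded (\<Phi> ` cball z r)" by (rule compact_imp_bounded)
  then obtain M where "\<forall>x\<in>cball z r. norm (\<Phi> x) \<le> M"
    unfolding bounded_iff by blast
  with r show ?thesis by blast
qed

lemma pd_continuous_on:
  assumes \<Phi>: "holomorphic_several \<Phi> S" and S: "open S"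
  shows "continuous_on S (pd \<Phi> w)"
proof -
  have "continuous (at z) (pd \<Phi> w)" if z: "z \<in> S" for z
  proof -
    obtain r M where r: "r > 0" "cball z r \<subseteq> S" and M: "\<And>x. x \<in> cball z r \<Longrightarrow> norm (\<Phi> x) \<le> M"
      using several_local_bound[OF \<Phi> S z] by metis
    define \<rho> where "\<rho> = r / 2"
    have \<rho>: "\<rho> > 0" using r by (simp add: \<rho>_def)
    have sub: "cball x \<rho> \<subseteq> cball z r" if "x \<in> ball z \<rho>" for x
    proof
      fix y assume "y \<in> cball x \<rho>"
      then show "y \<in> cball z r" using that dist_triangle[of z y x] by (simp add: \<rho>_def)
    qed
    define e where "e n = \<rho> / (2 * real (Suc n) * (1 + norm w))" for n
    have e0: "e n > 0" for n using \<rho> by (auto simp: e_def intro!: divide_pos_pos mult_pos_pos add_pos_nonneg)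
    have ew: "e n * norm w \<le> \<rho> / 2" for n
    proof -
      define q where "q = real (Suc n) * (1 + norm w)"
      have q: "q > 0" unfolding q_def by (intro mult_pos_pos add_pos_nonneg) auto
      have "norm w \<le> q"
        using mult_mono[of 1 "real (Suc n)" "norm w" "1 + norm w"] by (simp add: q_def)
      then have "e n * norm w \<le> e n * q" using e0[of n] by (intro mult_left_mono) auto
      also have "\<dots> = \<rho> / (2 * q) * q" by (simp only: e_def q_def mult.assoc)
      also have "\<dots> = \<rho> / 2" using q by simp
      finally show ?thesis .
    qed
    have elim: "e \<longlonglongrightarrow> 0"
    proof -
      have "(\<lambda>n. (\<rho> / (2 * (1 + norm w))) * (1 / real (Suc n))) \<longlonglongrightarrow> (\<rho> / (2 * (1 + norm w))) * 0"
        by (intro tendsto_mult_left LIMSEQ_Suc[OF lim_1_over_n])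
      moreover have "(\<lambda>n. (\<rho> / (2 * (1 + norm w))) * (1 / real (Suc n))) = e"
        unfolding e_def by (rule ext) (simp only: times_divide_times_eq mult_1_right mult.assoc mult.commute[of "1 + norm w"])
      ultimately show ?thesis by simp
    qed
    define Q where "Q n x = (\<Phi> (x + complex_of_real (e n) *s w) - \<Phi> x) / of_real (e n)" for n x
    have sh: "x + complex_of_real (e n) *s w \<in> cball x \<rho>" for n x
      using ew[of n] e0[of n] \<rho> by (simp add: dist_norm norm_vector_smult)
    have "continuous_on (ball z \<rho>) (Q n)" for n
      unfolding Q_def
    proof (intro continuous_intros)
      show "continuous_on (ball z \<rho>) \<Phi>"
        by (rule continuous_on_subset[OF several_continuous_on[OF \<Phi>]]) (use sub r \<rho> in force)
      show "continuous_on (ball z \<rho>) (\<lambda>x. \<Phi> (x + complex_of_real (e n) *s w))"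
      proof (rule continuous_on_compose2[OF several_continuous_on[OF \<Phi>]])
        show "(\<lambda>x. x + complex_of_real (e n) *s w) ` ball z \<rho> \<subseteq> S"
        proof (rule image_subsetI)
          fix x assume "x \<in> ball z \<rho>"
          from subsetD[OF sub[OF this] sh] r(2) show "x + complex_of_real (e n) *s w \<in> S" by blast
        qed
      qed (intro continuous_intros)
      show "\<forall>x\<in>ball z \<rho>. complex_of_real (e n) \<noteq> 0" using e0[of n] by simp
    qed
    moreover have "uniform_limit (ball z \<rho>) Q (pd \<Phi> w) sequentially"
    proof (rule uniform_limitI)
      fix \<epsilon> :: real assume \<epsilon>: "\<epsilon> > 0"
      let ?C = "8 * M / \<rho>\<^sup>2 * (norm w)\<^sup>2"
      have "(\<lambda>n. ?C * e n) \<longlonglongrightarrow> ?C * 0" by (intro tendsto_mult_left elim)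
      then have "\<forall>\<^sub>F n in sequentially. ?C * e n < \<epsilon>" using \<epsilon> by (intro order_tendstoD) auto
      then show "\<forall>\<^sub>F n in sequentially. \<forall>x\<in>ball z \<rho>. dist (Q n x) (pd \<Phi> w x) < \<epsilon>"
      proof eventually_elim
        fix n assume n: "?C * e n < \<epsilon>"
        show "\<forall>x\<in>ball z \<rho>. dist (Q n x) (pd \<Phi> w x) < \<epsilon>"
        proof
          fix x assume x: "x \<in> ball z \<rho>"
          let ?w = "complex_of_real (e n) *s w"
          have "x \<in> S" using x sub r \<rho> by force
          then have "pd \<Phi> ?w x = of_real (e n) * pd \<Phi> w x" by (rule several_derivative(2)[OF \<Phi>])
          then have "Q n x - pd \<Phi> w x = (\<Phi> (x + ?w) - \<Phi> x - pd \<Phi> ?w x) / of_real (e n)"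
            using e0[of n] by (simp add: Q_def field_simps)
          then have "norm (Q n x - pd \<Phi> w x) = norm (\<Phi> (x + ?w) - \<Phi> x - pd \<Phi> ?w x) / e n"
            using e0[of n] by (simp add: norm_divide)
          also have "\<dots> \<le> (8 * M / \<rho>\<^sup>2 * (norm ?w)\<^sup>2) / e n"
          proof (rule divide_right_mono)
            show "norm (\<Phi> (x + ?w) - \<Phi> x - pd \<Phi> ?w x) \<le> 8 * M / \<rho>\<^sup>2 * (norm ?w)\<^sup>2"
              by (rule several_quadratic[OF \<Phi> S _ \<rho>])
                 (use sub[OF x] r M ew[of n] e0[of n] in \<open>auto simp: norm_vector_smult\<close>)
          qed (use e0[of n] in simp)
          also have "\<dots> = ?C * e n" using e0[of n] by (simp add: norm_vector_smult power2_eq_square)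
          finally show "dist (Q n x) (pd \<Phi> w x) < \<epsilon>" using n by (simp add: dist_norm)
        qed
      qed
    qed
    ultimately have "continuous_on (ball z \<rho>) (pd \<Phi> w)"
      by (intro uniform_limit_theorem[of _ Q sequentially]) auto
    then show ?thesis using \<rho> by (simp add: continuous_on_eq_continuous_at)
  qed
  then show ?thesis by (simp add: continuous_at_imp_continuous_on)
qed

text \<open>Directional derivatives are again holomorphic. By Cauchy's formula the derivative in
  direction \<open>v\<close> is a circle average of \<open>\<Phi>\<close>, so its derivative is the average of the derivatives
  of \<open>\<Phi>\<close>; the uniform quadratic bound justifies the differentiation under the integral.\<close>

lemma pd_holomorphic_several:
  fixes \<Phi> :: "complex^'d::finite \<Rightarrow> complex"
  assumes \<Phi>: "holomorphic_several \<Phi> S" and S: "open S"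
  shows "holomorphic_several (pd \<Phi> v) S"
  unfolding holomorphic_several_def
proof
  fix z assume z: "z \<in> S"
  obtain r M where r: "r > 0" "cball z r \<subseteq> S" and M: "\<And>x. x \<in> cball z r \<Longrightarrow> norm (\<Phi> x) \<le> M"
    using several_local_bound[OF \<Phi> S z] by metis
  define \<rho> where "\<rho> = r / (4 * (1 + norm v))"
  have nv: "1 + norm v > 0" by (rule add_pos_nonneg) auto
  have \<rho>: "\<rho> > 0" using r nv by (simp add: \<rho>_def)
  have \<rho>v: "\<rho> * norm v \<le> r / 4"
  proof -
    have "\<rho> * norm v \<le> \<rho> * (1 + norm v)" using \<rho> by (intro mult_left_mono) auto
    also have "\<dots> = r / 4"
    proof -
      have "r / (4 * c) * c = r / 4" if "c > 0" for c using that by simp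
      from this[OF nv] show ?thesis by (simp only: \<rho>_def)
    qed
    finally show ?thesis .
  qed
  have in_ball: "z + h + \<zeta> *s v \<in> cball z (r / 2)" if "norm h \<le> r / 4" "norm \<zeta> \<le> \<rho>" for h \<zeta>
  proof -
    have "norm (h + \<zeta> *s v) \<le> norm h + norm \<zeta> * norm v" by (metis norm_triangle_ineq norm_vector_smult)
    also have "\<dots> \<le> r / 4 + \<rho> * norm v" by (intro add_mono mult_right_mono that) auto
    also have "\<dots> \<le> r / 2" using \<rho>v by simp
    finally have "norm (h + \<zeta> *s v) \<le> r / 2" .
    moreover have "z - (z + h + \<zeta> *s v) = - (h + \<zeta> *s v)" by simp
    ultimately show ?thesis unfolding mem_cball dist_norm by (simp only: norm_minus_cancel)
  qed
  have inS: "z + h + \<zeta> *s v \<in> S" if "norm h \<le> r / 4" "norm \<zeta> \<le> \<rho>" for h \<zeta>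
  proof -
    have "z + h + \<zeta> *s v \<in> cball z r" using in_ball[OF that] r by simp
    then show ?thesis using r by blast
  qed
  let ?\<gamma> = "circlepath 0 \<rho>" and ?k = "1 / (2 * of_real pi * \<i>)"
  have Cauchy: "(\<lambda>u. \<Phi> (z + h + u *s v) / u\<^sup>2) contour_integrable_on ?\<gamma>"
     "pd \<Phi> v (z + h) = ?k * contour_integral ?\<gamma> (\<lambda>u. \<Phi> (z + h + u *s v) / u\<^sup>2)" if h: "norm h \<le> r / 4" for h
  proof -
    have hol: "(\<lambda>u. \<Phi> (z + h + u *s v)) holomorphic_on cball 0 \<rho>"
      by (rule several_line_holomorphic[OF \<Phi>]) (use inS[OF h] in auto)
    then have c: "continuous_on (cball 0 \<rho>) (\<lambda>u. \<Phi> (z + h + u *s v))" by (rule holomorphic_on_imp_continuous_on)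
    have b: "(\<lambda>u. \<Phi> (z + h + u *s v)) holomorphic_on ball 0 \<rho>" using hol by (rule holomorphic_on_subset) auto
    have 0: "(0::complex) \<in> ball 0 \<rho>" using \<rho> by simp
    show "(\<lambda>u. \<Phi> (z + h + u *s v) / u\<^sup>2) contour_integrable_on ?\<gamma>"
      using Cauchy_derivative_integral_circlepath(1)[OF c b 0] by simp
    show "pd \<Phi> v (z + h) = ?k * contour_integral ?\<gamma> (\<lambda>u. \<Phi> (z + h + u *s v) / u\<^sup>2)"
      using DERIV_imp_deriv[OF Cauchy_derivative_integral_circlepath(2)[OF c b 0]] by (simp add: pd_def)
  qed
  have z0: "z + u *s v \<in> S" if "norm u \<le> \<rho>" for u using inS[of 0 u] that r by simp
  have int: "(\<lambda>u. pd \<Phi> h (z + u *s v) / u\<^sup>2) contour_integrable_on ?\<gamma>" for h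
  proof (rule contour_integrable_continuous_circlepath)
    show "continuous_on (path_image ?\<gamma>) (\<lambda>u. pd \<Phi> h (z + u *s v) / u\<^sup>2)"
      using \<rho> by (intro continuous_intros continuous_on_compose2[OF pd_continuous_on[OF \<Phi> S] continuous_on_line])
        (auto simp: z0)
  qed
  define L where "L h = ?k * contour_integral ?\<gamma> (\<lambda>u. pd \<Phi> h (z + u *s v) / u\<^sup>2)" for h
  have L_smult: "L (c *s h) = c * L h" for c h
  proof -
    have "contour_integral ?\<gamma> (\<lambda>u. pd \<Phi> (c *s h) (z + u *s v) / u\<^sup>2) = contour_integral ?\<gamma> (\<lambda>u. c * (pd \<Phi> h (z + u *s v) / u\<^sup>2))"
      using \<rho> by (intro contour_integral_cong refl) (auto simp: several_derivative(2)[OF \<Phi>] z0)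
    also have "\<dots> = c * contour_integral ?\<gamma> (\<lambda>u. pd \<Phi> h (z + u *s v) / u\<^sup>2)"
      by (rule contour_integral_lmul[OF int])
    finally show ?thesis by (simp add: L_def)
  qed
  have L_add: "L (h + h') = L h + L h'" for h h'
  proof -
    have "contour_integral ?\<gamma> (\<lambda>u. pd \<Phi> (h + h') (z + u *s v) / u\<^sup>2) = contour_integral ?\<gamma> (\<lambda>u. pd \<Phi> h (z + u *s v) / u\<^sup>2 + pd \<Phi> h' (z + u *s v) / u\<^sup>2)"
      using \<rho> by (intro contour_integral_cong refl) (auto simp: several_derivative(3)[OF \<Phi>] z0 add_divide_distrib)
    also have "\<dots> = contour_integral ?\<gamma> (\<lambda>u. pd \<Phi> h (z + u *s v) / u\<^sup>2) + contour_integral ?\<gamma> (\<lambda>u. pd \<Phi> h' (z + u *s v) / u\<^sup>2)"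
      by (rule contour_integral_add[OF int int])
    finally show ?thesis by (simp add: L_def distrib_left)
  qed
  have "linear L"
  proof (rule linearI[OF L_add])
    fix c :: real and h :: "complex^'d"
    have "c *\<^sub>R h = complex_of_real c *s h"
      by (simp only: vec_eq_iff vector_scaleR_component vector_smult_component) (simp add: scaleR_conv_of_real)
    then show "L (c *\<^sub>R h) = c *\<^sub>R L h" by (simp add: L_smult scaleR_conv_of_real)
  qed
  then have L: "bounded_linear L" by (rule linear_conv_bounded_linear[THEN iffD1])
  have M0: "M \<ge> 0" using M[of z] r norm_ge_zero[of "\<Phi> z"] by (smt (verit) centre_in_cball)
  define K where "K = 8 * M / (r / 2)\<^sup>2"
  have K0: "K \<ge> 0" using M0 by (simp add: K_def)
  have "(pd \<Phi> v has_derivative L) (at z)"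
  proof (rule has_derivative_quadratic[OF L, of "r / 4" _ _ "norm ?k * (K / \<rho>\<^sup>2) * (2 * pi * \<rho>)"])
    show "r / 4 > 0" using r by simp
    fix h :: "complex^'d" assume h: "norm h < r / 4"
    let ?R = "\<lambda>u. \<Phi> (z + h + u *s v) / u\<^sup>2 - \<Phi> (z + u *s v) / u\<^sup>2 - pd \<Phi> h (z + u *s v) / u\<^sup>2"
    have i0: "(\<lambda>u. \<Phi> (z + u *s v) / u\<^sup>2) contour_integrable_on ?\<gamma>" and ih: "(\<lambda>u. \<Phi> (z + h + u *s v) / u\<^sup>2) contour_integrable_on ?\<gamma>"
      using Cauchy(1)[of 0] Cauchy(1)[of h] h r by simp_all
    have eq: "pd \<Phi> v (z + h) - pd \<Phi> v z - L h = ?k * contour_integral ?\<gamma> ?R"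
      using Cauchy(2)[of 0] Cauchy(2)[of h] h r
      by (simp add: L_def contour_integral_diff contour_integrable_diff i0 ih int right_diff_distrib)
    have "norm (contour_integral ?\<gamma> ?R) \<le> (K * (norm h)\<^sup>2 / \<rho>\<^sup>2) * (2 * pi * \<rho>)"
    proof (rule has_contour_integral_bound_circlepath)
      show "(?R has_contour_integral contour_integral ?\<gamma> ?R) ?\<gamma>"
        by (intro has_contour_integral_integral contour_integrable_diff i0 ih int)
      fix u :: complex assume u: "norm (u - 0) = \<rho>"
      have "norm (\<Phi> ((z + u *s v) + h) - \<Phi> (z + u *s v) - pd \<Phi> h (z + u *s v)) \<le> K * (norm h)\<^sup>2"
        unfolding K_def
      proof (rule several_quadratic[OF \<Phi> S])
        have "cball (z + u *s v) (r / 2) \<subseteq> cball z r"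
        proof
          fix y assume y: "y \<in> cball (z + u *s v) (r / 2)"
          have "dist z (z + u *s v) \<le> r / 2" using in_ball[of 0 u] u r by simp
          then show "y \<in> cball z r" using y dist_triangle[of z y "z + u *s v"] by simp
        qed
        then show "cball (z + u *s v) (r / 2) \<subseteq> S" "\<And>x. x \<in> cball (z + u *s v) (r / 2) \<Longrightarrow> norm (\<Phi> x) \<le> M"
          using r M by blast+
      qed (use r h in auto)
      then have "norm (\<Phi> ((z + u *s v) + h) - \<Phi> (z + u *s v) - pd \<Phi> h (z + u *s v)) / \<rho>\<^sup>2 \<le> K * (norm h)\<^sup>2 / \<rho>\<^sup>2"
        by (rule divide_right_mono) simp
      moreover have "?R u = (\<Phi> ((z + u *s v) + h) - \<Phi> (z + u *s v) - pd \<Phi> h (z + u *s v)) / u\<^sup>2"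
        by (simp add: diff_divide_distrib add_ac)
      ultimately show "norm (?R u) \<le> K * (norm h)\<^sup>2 / \<rho>\<^sup>2" using u by (simp add: norm_divide norm_power)
    qed (use \<rho> K0 in auto)
    then have "norm (pd \<Phi> v (z + h) - pd \<Phi> v z - L h) \<le> norm ?k * ((K * (norm h)\<^sup>2 / \<rho>\<^sup>2) * (2 * pi * \<rho>))"
      unfolding eq norm_mult by (rule mult_left_mono) simp
    then show "norm (pd \<Phi> v (z + h) - pd \<Phi> v z - L h) \<le> norm ?k * (K / \<rho>\<^sup>2) * (2 * pi * \<rho>) * (norm h)\<^sup>2"
      by (simp add: mult_ac)
  qed
  then show "\<exists>L. (pd \<Phi> v has_derivative L) (at z) \<and> (\<forall>c w. L (c *s w) = c * L w)"
    using L_smult by blast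
qed

primrec pds :: "'d::finite list \<Rightarrow> (complex^'d \<Rightarrow> complex) \<Rightarrow> complex^'d \<Rightarrow> complex" where
  "pds [] \<Phi> = \<Phi>"
| "pds (j # js) \<Phi> = pd (pds js \<Phi>) (axis j 1)"

lemma pds_holomorphic_several:
  "holomorphic_several \<Phi> S \<Longrightarrow> open S \<Longrightarrow> holomorphic_several (pds js \<Phi>) S"
  by (induction js) (auto intro: pd_holomorphic_several)

text \<open>Each derivative costs a ball of radius \<open>\<rho>\<close> in Cauchy's estimate; \<open>m\<close> derivatives therefore
  need a ball of radius \<open>m \<rho>\<close>.\<close>

lemma pds_bound:
  fixes \<rho> :: real
  assumes \<Phi>: "holomorphic_several \<Phi> S" and S: "open S" and \<rho>: "\<rho> > 0"
    and sub: "cball z (length js * \<rho>) \<subseteq> T" "T \<subseteq> S" and M: "\<And>x. x \<in> T \<Longrightarrow> norm (\<Phi> x) \<le> M"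
  shows "norm (pds js \<Phi> z) \<le> M / \<rho> ^ length js"
  using sub(1)
proof (induction js arbitrary: z)
  case (Cons j js)
  have le: "norm (pds js \<Phi> x) \<le> M / \<rho> ^ length js" if x: "x \<in> cball z \<rho>" for x
  proof (rule Cons.IH)
    show "cball x (length js * \<rho>) \<subseteq> T"
    proof
      fix y assume "y \<in> cball x (length js * \<rho>)"
      then have "dist z y \<le> length (j # js) * \<rho>"
        using x dist_triangle[of z y x] by (simp add: algebra_simps)
      then show "y \<in> T" using Cons.prems by auto
    qed
  qed
  have "\<rho> \<le> length (j # js) * \<rho>" using \<rho> by (simp add: distrib_right)
  then have "cball z \<rho> \<subseteq> cball z (length (j # js) * \<rho>)" by (rule subset_cball)
  then have "cball z \<rho> \<subseteq> S" using Cons.prems sub(2) by blast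
  then have "norm (pd (pds js \<Phi>) (axis j 1) z) \<le> (M / \<rho> ^ length js) / \<rho>"
    by (intro pd_bound[OF pds_holomorphic_several[OF \<Phi> S] _ \<rho> le]) (auto simp: norm_axis_complex)
  then show ?case by (simp add: mult.commute)
qed (use M in auto)

text \<open>The monomial in \<open>w\<close> that goes with the iterated derivative \<open>pds js\<close>.\<close>

definition monom_val :: "'d::finite list \<Rightarrow> complex^'d \<Rightarrow> complex" where
  "monom_val js w = prod_list (map (\<lambda>j. w $ j) js)"

lemma sum_lists_Suc:
  fixes f :: "'d::finite list \<Rightarrow> complex"
  shows "(\<Sum>js | length js = Suc m. f js) = (\<Sum>js | length js = m. \<Sum>j\<in>UNIV. f (j # js))"
proof -
  have eq: "{js :: 'd list. length js = Suc m} = (\<lambda>(js, j). j # js) ` ({js. length js = m} \<times> UNIV)"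
    by (auto simp: length_Suc_conv image_iff)
  have inj: "inj_on (\<lambda>(js, j). j # js) ({js :: 'd list. length js = m} \<times> UNIV)" by (auto simp: inj_on_def)
  show ?thesis unfolding eq sum.reindex[OF inj] by (simp add: sum.cartesian_product case_prod_unfold)
qed

lemma pd_coords:
  assumes "holomorphic_several \<Phi> S" "z \<in> S"
  shows "pd \<Phi> w z = (\<Sum>j\<in>UNIV. w $ j * pd \<Phi> (axis j 1) z)"
proof -
  have "linear (\<lambda>w. pd \<Phi> w z)" by (rule has_derivative_linear[OF several_derivative(1)[OF assms]])
  then have "pd \<Phi> (\<Sum>j\<in>UNIV. w $ j *s axis j 1) z = (\<Sum>j\<in>UNIV. pd \<Phi> (w $ j *s axis j 1) z)"
    by (rule linear_sum)
  then show ?thesis by (simp add: basis_expansion several_derivative(2)[OF assms])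
qed

lemma higher_deriv_line:
  fixes \<Phi> :: "complex^'d::finite \<Rightarrow> complex"
  assumes \<Phi>: "holomorphic_several \<Phi> S" and S: "open S" and t: "a + t *s w \<in> S"
  shows "(deriv ^^ m) (\<lambda>t. \<Phi> (a + t *s w)) t = (\<Sum>js | length js = m. pds js \<Phi> (a + t *s w) * monom_val js w)"
  using t
proof (induction m arbitrary: t)
  case 0
  have "{js :: 'd list. length js = 0} = {[]}" by auto
  then show ?case by (simp add: monom_val_def)
next
  case (Suc m)
  let ?F = "\<lambda>t. \<Sum>js | length js = m. pds js \<Phi> (a + t *s w) * monom_val js w"
  have "(?F has_field_derivative (\<Sum>js | length js = m. pd (pds js \<Phi>) w (a + t *s w) * monom_val js w)) (at t)"
    by (intro DERIV_sum DERIV_cmult_right several_line_derivative[OF pds_holomorphic_several[OF \<Phi> S] Suc.prems])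
  also have "(\<Sum>js | length js = m. pd (pds js \<Phi>) w (a + t *s w) * monom_val js w)
      = (\<Sum>js | length js = Suc m. pds js \<Phi> (a + t *s w) * monom_val js w)"
    unfolding sum_lists_Suc
    by (intro sum.cong refl, subst pd_coords[OF pds_holomorphic_several[OF \<Phi> S] Suc.prems])
       (simp add: sum_distrib_left sum_distrib_right monom_val_def mult_ac)
  finally have "((deriv ^^ m) (\<lambda>t. \<Phi> (a + t *s w)) has_field_derivative (\<Sum>js | length js = Suc m. pds js \<Phi> (a + t *s w) * monom_val js w)) (at t)"
    by (rule has_field_derivative_transform_within_open[OF _ open_line_preimage[OF S, of a w]])
       (use Suc in auto)
  then show ?case by (simp add: DERIV_imp_deriv)
qed

text \<open>The Taylor series, organised by lists of coordinate directions instead of multi-indices;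
  the factor \<open>1/m!\<close> accounts for the permutations of a list.\<close>

lemma several_Taylor:
  fixes \<Phi> :: "complex^'d::finite \<Rightarrow> complex"
  assumes \<Phi>: "holomorphic_several \<Phi> S" and S: "open S" "cball a R \<subseteq> S" and w: "norm w < R"
  shows "(\<lambda>m. (\<Sum>js | length js = m. pds js \<Phi> a * monom_val js w) / fact m) sums \<Phi> (a + w)"
proof (cases "w = 0")
  case True
  have "(\<Sum>js | length js = m. pds js \<Phi> a * monom_val js w) / fact m = (if m = 0 then \<Phi> a else 0)" for m
  proof (cases m)
    case 0
    have "{js :: 'd list. length js = 0} = {[]}" by auto
    then show ?thesis using 0 by (simp add: monom_val_def)
  next
    case (Suc k)
    have "monom_val js w = 0" if "length js = m" for js
      using that Suc True by (cases js) (auto simp: monom_val_def)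
    then show ?thesis using Suc by simp
  qed
  then show ?thesis using True sums_single[of 0 "\<lambda>_. \<Phi> a"] by simp
next
  case False
  define \<rho> where "\<rho> = R / norm w"
  have \<rho>: "\<rho> > 1" using False w by (simp add: \<rho>_def)
  have "(\<lambda>t. \<Phi> (a + t *s w)) holomorphic_on ball 0 \<rho>"
  proof (rule several_line_holomorphic[OF \<Phi>])
    fix t :: complex assume "t \<in> ball 0 \<rho>"
    then have "norm t * norm w \<le> R" using False by (simp add: \<rho>_def field_simps)
    then have "a + t *s w \<in> cball a R" by (simp add: dist_norm norm_vector_smult)
    then show "a + t *s w \<in> S" using S by blast
  qed
  moreover have "(1::complex) \<in> ball 0 \<rho>" using \<rho> by simp
  ultimately have "(\<lambda>n. (deriv ^^ n) (\<lambda>t. \<Phi> (a + t *s w)) 0 / fact n * (1 - 0) ^ n) sums \<Phi> (a + 1 *s w)"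
    by (rule holomorphic_power_series)
  moreover have "a \<in> S" using subsetD[OF S(2), of a] w order_trans[OF norm_ge_zero less_imp_le[OF w]] by simp
  ultimately show ?thesis using higher_deriv_line[OF \<Phi> S(1), of a 0 w] by simp
qed

text \<open>Distributing the radius \<open>R\<close> over \<open>m\<close> equal steps loses a factor \<open>m\<^sup>m\<close> against Cauchy's estimate
  for polydiscs, which \<open>1/m!\<close> compensates up to \<open>e\<^sup>m\<close>. A smaller radius of convergence is
  sufficient, as the arguments of the series are going to be small.\<close>

lemma pds_coefficient_bound:
  fixes \<Phi> :: "complex^'d::finite \<Rightarrow> complex"
  assumes \<Phi>: "holomorphic_several \<Phi> S" and S: "open S" "cball a R \<subseteq> S" and R: "R > 0"
    and M: "\<And>x. x \<in> cball a R \<Longrightarrow> norm (\<Phi> x) \<le> M"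
  shows "norm (pds js \<Phi> a / fact (length js)) \<le> M * (exp 1 / R) ^ length js"
proof (cases "js = []")
  case True
  then show ?thesis using M[of a] R by simp
next
  case False
  let ?m = "length js"
  have m: "real ?m > 0" using False by simp
  have M0: "M \<ge> 0" using order_trans[OF norm_ge_zero M[of a]] R by simp
  have "norm (pds js \<Phi> a) \<le> M / (R / ?m) ^ ?m"
    by (rule pds_bound[OF \<Phi> S(1), where T = "cball a R"]) (use R m S M in auto)
  also have "\<dots> = M * (real ?m ^ ?m / R ^ ?m)" by (simp add: power_divide)
  finally have "norm (pds js \<Phi> a) / fact ?m \<le> M * (real ?m ^ ?m / R ^ ?m) / fact ?m"
    by (rule divide_right_mono) simp
  also have "\<dots> = M * (real ?m ^ ?m / fact ?m) / R ^ ?m" by simp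
  also have "\<dots> \<le> M * exp 1 ^ ?m / R ^ ?m"
  proof (intro divide_right_mono mult_left_mono M0)
    have "real ?m ^ ?m / fact ?m \<le> (\<Sum>k. real ?m ^ k / fact k)"
      using sum_le_suminf[of "\<lambda>k. real ?m ^ k / fact k" "{?m}"] summable_exp[of "real ?m"]
      by (simp add: divide_inverse mult.commute)
    also have "\<dots> = exp (real ?m)" by (simp add: exp_def divide_inverse mult.commute)
    finally show "real ?m ^ ?m / fact ?m \<le> exp 1 ^ ?m" by (simp flip: exp_of_nat_mult)
  qed (use R in simp)
  finally show ?thesis by (simp add: norm_divide power_divide)
qed

section \<open>The Banach algebra estimate\<close>

lemma weight_add:
  assumes s: "s \<ge> 0"
  shows "weight s (\<xi> + \<eta>) \<le> 2 powr s * (weight s \<xi> + weight s \<eta>)"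
proof -
  define m where "m = max (1 + (norm \<xi>)\<^sup>2) (1 + (norm \<eta>)\<^sup>2)"
  have m: "m \<ge> 1" by (simp add: m_def le_max_iff_disj)
  have "(norm (\<xi> + \<eta>))\<^sup>2 \<le> (norm \<xi> + norm \<eta>)\<^sup>2" by (intro power_mono norm_triangle_ineq) auto
  also have "\<dots> \<le> 2 * (norm \<xi>)\<^sup>2 + 2 * (norm \<eta>)\<^sup>2"
    using zero_le_power2[of "norm \<xi> - norm \<eta>"] by (simp add: power2_eq_square algebra_simps)
  finally have "1 + (norm (\<xi> + \<eta>))\<^sup>2 \<le> 2 * (1 + (norm \<xi>)\<^sup>2) + 2 * (1 + (norm \<eta>)\<^sup>2)" by simp
  also have "\<dots> \<le> 2 * m + 2 * m" unfolding m_def by (intro add_mono mult_left_mono) auto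
  finally have "weight s (\<xi> + \<eta>) \<le> (4 * m) powr (s / 2)"
    unfolding weight_def using s by (intro powr_mono2) auto
  also have "\<dots> = 2 powr s * m powr (s / 2)"
    using m powr_powr[of 2 2 "s / 2"] by (simp add: powr_mult)
  also have "m powr (s / 2) \<le> weight s \<xi> + weight s \<eta>"
    unfolding m_def weight_def by (cases "(norm \<xi>)\<^sup>2 \<le> (norm \<eta>)\<^sup>2") (auto simp: max_def)
  finally show ?thesis by simp
qed

lemma half_dim_nonneg: "s > real CARD('n::finite) / 2 \<Longrightarrow> s \<ge> 0"
  by (meson divide_nonneg_nonneg less_imp_le order_trans of_nat_0_le_iff zero_le_numeral)

text \<open>The Sobolev norm of a product is controlled by the Sobolev norm of one factor and the Wiener
  norm of the other. This form, rather than the plain algebra inequality, makes the Wiener norm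
  decide about the convergence of power series.\<close>

lemma hsq_conv:
  fixes P Q :: "real^'n::finite \<Rightarrow> complex"
  assumes s: "s \<ge> 0" and [measurable]: "P \<in> borel_measurable borel" "Q \<in> borel_measurable borel"
  shows "hsq s (conv P Q) \<le> ennreal (2 * 4 powr s) * (hsq s P * (wnorm Q)\<^sup>2 + (wnorm P)\<^sup>2 * hsq s Q)"
proof -
  let ?p = "\<lambda>\<xi>. ennreal (norm (P \<xi>))" and ?q = "\<lambda>\<xi>. ennreal (norm (Q \<xi>))"
  let ?wp = "\<lambda>\<xi>. ennreal (norm (of_real (weight s \<xi>) * P \<xi>))" and ?wq = "\<lambda>\<xi>. ennreal (norm (of_real (weight s \<xi>) * Q \<xi>))"
  let ?A = "\<lambda>\<eta>. \<integral>\<^sup>+\<xi>. ?q (\<eta> - \<xi>) * ?wp \<xi> \<partial>lborel" and ?B = "\<lambda>\<eta>. \<integral>\<^sup>+\<xi>. ?p (\<eta> - \<xi>) * ?wq \<xi> \<partial>lborel"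
  have pt: "ennreal (norm (of_real (weight s \<eta>) * conv P Q \<eta>)) \<le> ennreal (2 powr s) * (?A \<eta> + ?B \<eta>)" for \<eta>
  proof -
    have "ennreal (norm (of_real (weight s \<eta>) * conv P Q \<eta>)) = ennreal (weight s \<eta>) * ennreal (norm (conv P Q \<eta>))"
      by (simp add: norm_mult ennreal_mult')
    also have "\<dots> \<le> ennreal (weight s \<eta>) * (\<integral>\<^sup>+\<xi>. ?p (\<eta> - \<xi>) * ?q \<xi> \<partial>lborel)"
      by (intro mult_left_mono conv_norm_le) auto
    also have "\<dots> = (\<integral>\<^sup>+\<xi>. ennreal (weight s \<eta>) * (?p (\<eta> - \<xi>) * ?q \<xi>) \<partial>lborel)"
      by (rule nn_integral_cmult[symmetric]) measurable
    also have "\<dots> \<le> (\<integral>\<^sup>+\<xi>. ennreal (2 powr s) * (?wp (\<eta> - \<xi>) * ?q \<xi> + ?p (\<eta> - \<xi>) * ?wq \<xi>) \<partial>lborel)"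
    proof (rule nn_integral_mono)
      fix \<xi>
      have "weight s \<eta> * (norm (P (\<eta> - \<xi>)) * norm (Q \<xi>))
         \<le> (2 powr s * (weight s (\<eta> - \<xi>) + weight s \<xi>)) * (norm (P (\<eta> - \<xi>)) * norm (Q \<xi>))"
        using weight_add[OF s, of "\<eta> - \<xi>" \<xi>] by (intro mult_right_mono) auto
      also have "\<dots> = 2 powr s * ((weight s (\<eta> - \<xi>) * norm (P (\<eta> - \<xi>))) * norm (Q \<xi>) + norm (P (\<eta> - \<xi>)) * (weight s \<xi> * norm (Q \<xi>)))"
        by (simp add: algebra_simps)
      finally have "ennreal (weight s \<eta> * (norm (P (\<eta> - \<xi>)) * norm (Q \<xi>))) \<le> ennreal (2 powr s * ((weight s (\<eta> - \<xi>) * norm (P (\<eta> - \<xi>))) * norm (Q \<xi>) + norm (P (\<eta> - \<xi>)) * (weight s \<xi> * norm (Q \<xi>))))"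
        by (rule ennreal_leI)
      then show "ennreal (weight s \<eta>) * (?p (\<eta> - \<xi>) * ?q \<xi>) \<le> ennreal (2 powr s) * (?wp (\<eta> - \<xi>) * ?q \<xi> + ?p (\<eta> - \<xi>) * ?wq \<xi>)"
        by (simp add: norm_mult ennreal_mult ennreal_plus)
    qed
    also have "\<dots> = ennreal (2 powr s) * ((\<integral>\<^sup>+\<xi>. ?wp (\<eta> - \<xi>) * ?q \<xi> \<partial>lborel) + ?B \<eta>)"
      by (subst nn_integral_cmult, measurable) (subst nn_integral_add, auto)
    also have "(\<integral>\<^sup>+\<xi>. ?wp (\<eta> - \<xi>) * ?q \<xi> \<partial>lborel) = (\<integral>\<^sup>+\<xi>. ?wp (\<eta> - (\<eta> - \<xi>)) * ?q (\<eta> - \<xi>) \<partial>lborel)"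
      by (rule nn_integral_lborel_reflect[symmetric]) measurable
    also have "\<dots> = ?A \<eta>" by (simp add: mult.commute)
    finally show ?thesis .
  qed
  have "hsq s (conv P Q) \<le> (\<integral>\<^sup>+\<eta>. ennreal (2 * 4 powr s) * ((?A \<eta>)\<^sup>2 + (?B \<eta>)\<^sup>2) \<partial>lborel)"
    unfolding hsq_def nsq_def
  proof (rule nn_integral_mono)
    fix \<eta>
    have "(ennreal (norm (of_real (weight s \<eta>) * conv P Q \<eta>)))\<^sup>2 \<le> (ennreal (2 powr s) * (?A \<eta> + ?B \<eta>))\<^sup>2"
      by (intro power_mono pt) auto
    also have "\<dots> \<le> (ennreal (2 powr s))\<^sup>2 * (2 * (?A \<eta>)\<^sup>2 + 2 * (?B \<eta>)\<^sup>2)"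
      unfolding power_mult_distrib by (intro mult_left_mono two_squares_ennreal) auto
    also have "(ennreal (2 powr s))\<^sup>2 = ennreal (4 powr s)"
      using powr_powr[of 2 2 s] powr_powr[of 2 s 2] by (simp add: ennreal_power mult.commute)
    also have "ennreal (4 powr s) * (2 * (?A \<eta>)\<^sup>2 + 2 * (?B \<eta>)\<^sup>2) = ennreal (2 * 4 powr s) * ((?A \<eta>)\<^sup>2 + (?B \<eta>)\<^sup>2)"
      by (simp add: ennreal_mult distrib_left mult_ac)
    finally show "(ennreal (norm (of_real (weight s \<eta>) * conv P Q \<eta>)))\<^sup>2 \<le> ennreal (2 * 4 powr s) * ((?A \<eta>)\<^sup>2 + (?B \<eta>)\<^sup>2)" .
  qed
  also have "\<dots> = ennreal (2 * 4 powr s) * ((\<integral>\<^sup>+\<eta>. (?A \<eta>)\<^sup>2 \<partial>lborel) + (\<integral>\<^sup>+\<eta>. (?B \<eta>)\<^sup>2 \<partial>lborel))"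
    by (subst nn_integral_cmult, measurable) (subst nn_integral_add, auto)
  also have "\<dots> \<le> ennreal (2 * 4 powr s) * ((wnorm Q)\<^sup>2 * hsq s P + (wnorm P)\<^sup>2 * hsq s Q)"
    unfolding wnorm_def hsq_def nsq_def by (intro mult_left_mono add_mono Young_L1_L2) auto
  finally show ?thesis by (simp add: mult.commute)
qed

lemma wnorm_conv:
  fixes P Q :: "real^'n::finite \<Rightarrow> complex"
  assumes [measurable]: "P \<in> borel_measurable borel" "Q \<in> borel_measurable borel"
  shows "wnorm (conv P Q) \<le> wnorm P * wnorm Q"
proof -
  have "wnorm (conv P Q) \<le> (\<integral>\<^sup>+\<eta>. (\<integral>\<^sup>+\<xi>. ennreal (norm (P (\<eta> - \<xi>))) * ennreal (norm (Q \<xi>)) \<partial>lborel) \<partial>lborel)"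
    unfolding wnorm_def by (intro nn_integral_mono conv_norm_le) auto
  also have "\<dots> = wnorm P * wnorm Q" unfolding wnorm_def by (rule nn_integral_convolution) auto
  finally show ?thesis .
qed

lemma wnorm_integrable: "P \<in> borel_measurable borel \<Longrightarrow> wnorm P < \<infinity> \<Longrightarrow> integrable lborel P"
  unfolding wnorm_def by (rule integrableI_bounded) auto

lemma fourier_norm_le_wnorm: "P \<in> borel_measurable borel \<Longrightarrow> ennreal (norm (fourier P x)) \<le> wnorm P"
  unfolding wnorm_def by (rule fourier_norm_le_nn)

lemma hsq_mono_norm: "(\<And>\<xi>. norm (P \<xi>) = norm (Q \<xi>)) \<Longrightarrow> hsq s P = hsq s Q"
  unfolding hsq_def nsq_def by (simp add: norm_mult)

lemma schwartz_hsq: "X \<in> schwartz \<Longrightarrow> hsq s X < \<infinity>"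
  unfolding hsq_def by (rule schwartz_nsq[OF schwartz_weight_mult])

lemma schwartz_wnorm: "X \<in> schwartz \<Longrightarrow> wnorm X < \<infinity>"
  using schwartz_integrable[of X] by (simp add: wnorm_def integrable_iff_bounded)

text \<open>The Fourier density of the product of \<open>fourier K\<close> with the functions \<open>fourier (D j)\<close>, for \<open>j\<close> in
  the list.\<close>

primrec dens :: "('d \<Rightarrow> real^'n::finite \<Rightarrow> complex) \<Rightarrow> (real^'n \<Rightarrow> complex) \<Rightarrow> 'd list \<Rightarrow> real^'n \<Rightarrow> complex" where
  "dens D K [] = K"
| "dens D K (j # js) = conv (D j) (dens D K js)"

lemma dens_measurable:
  assumes "\<And>j. D j \<in> borel_measurable borel" "K \<in> borel_measurable borel"
  shows "dens D K js \<in> borel_measurable borel"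
  by (induction js) (auto intro: conv_measurable assms)

lemma dens_wnorm:
  assumes m: "\<And>j. D j \<in> borel_measurable borel" "K \<in> borel_measurable borel"
    and K: "wnorm K \<le> ennreal W" and D: "\<And>j. wnorm (D j) \<le> ennreal \<kappa>" and nn: "W \<ge> 0" "\<kappa> \<ge> 0"
  shows "wnorm (dens D K js) \<le> ennreal (W * \<kappa> ^ length js)"
proof (induction js)
  case (Cons j js)
  have "wnorm (dens D K (j # js)) \<le> wnorm (D j) * wnorm (dens D K js)"
    unfolding dens.simps by (rule wnorm_conv[OF m(1) dens_measurable[OF m]])
  also have "\<dots> \<le> ennreal \<kappa> * ennreal (W * \<kappa> ^ length js)" by (intro mult_mono D Cons) auto
  also have "\<dots> = ennreal (W * \<kappa> ^ length (j # js))" using nn by (simp add: mult_ac flip: ennreal_mult)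
  finally show ?case .
qed (use K in simp)

lemma dens_fourier:
  assumes m: "\<And>j. D j \<in> borel_measurable borel" "K \<in> borel_measurable borel"
    and K: "wnorm K \<le> ennreal W" and D: "\<And>j. wnorm (D j) \<le> ennreal \<kappa>" and nn: "W \<ge> 0" "\<kappa> \<ge> 0"
  shows "fourier (dens D K js) x = fourier K x * monom_val js (\<chi> j. fourier (D j) x)"
proof (induction js)
  case (Cons j js)
  have "integrable lborel (D j)"
    by (rule wnorm_integrable[OF m(1) le_less_trans[OF D]]) simp
  moreover have "integrable lborel (dens D K js)"
    by (rule wnorm_integrable[OF dens_measurable[OF m] le_less_trans[OF dens_wnorm[OF assms]]]) simp
  ultimately show ?case using Cons by (simp add: fourier_conv monom_val_def)
qed (simp add: monom_val_def)

text \<open>Let \<open>h m\<close> be the supremum of \<open>hsq s\<close> over products of length \<open>m\<close>. The product estimate gives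
  the recursion \<open>h (m + 1) \<le> c (A W\<^sup>2 \<kappa>\<^bsup>2m\<^esup> + \<kappa>\<^sup>2 h m)\<close>: the squared \<open>\<H>\<^sup>s\<close>-norm \<open>A\<close> of the factors
  enters only linearly, and the geometric rate is governed by the Wiener norm \<open>\<kappa>\<close>.
  The rate \<open>\<rho>\<close> leaves room for each of the two terms to take one half of the bound.\<close>

lemma dens_hsq:
  assumes s: "s \<ge> 0" and m: "\<And>j. D j \<in> borel_measurable borel" "K \<in> borel_measurable borel"
    and K: "wnorm K \<le> ennreal W" and D: "\<And>j. wnorm (D j) \<le> ennreal \<kappa>" and nn: "W \<ge> 0" "\<kappa> \<ge> 0"
    and hK: "hsq s K \<le> ennreal B" and hD: "\<And>j. hsq s (D j) \<le> ennreal A" and A: "A \<ge> 0" and B: "B \<ge> 0"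
    and small: "2 * (2 * 4 powr s) * \<kappa>\<^sup>2 \<le> \<rho>" "\<kappa>\<^sup>2 \<le> \<rho>" and big: "2 * (2 * 4 powr s) * (A * W\<^sup>2) \<le> B * \<rho>"
  shows "hsq s (dens D K js) \<le> ennreal (B * \<rho> ^ length js)"
proof (induction js)
  case (Cons j js)
  let ?m = "length js" and ?C = "2 * 4 powr s"
  have \<rho>: "\<rho> \<ge> 0" using small(2) zero_le_power2[of \<kappa>] by linarith
  have "hsq s (dens D K (j # js)) \<le> ennreal ?C * (hsq s (D j) * (wnorm (dens D K js))\<^sup>2 + (wnorm (D j))\<^sup>2 * hsq s (dens D K js))"
    unfolding dens.simps by (rule hsq_conv[OF s m(1) dens_measurable[OF m]])
  also have "\<dots> \<le> ennreal ?C * (ennreal A * (ennreal (W * \<kappa> ^ ?m))\<^sup>2 + (ennreal \<kappa>)\<^sup>2 * ennreal (B * \<rho> ^ ?m))"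
    by (intro mult_left_mono add_mono mult_mono power_mono hD D dens_wnorm[OF m K D nn] Cons) auto
  also have "\<dots> = ennreal (?C * (A * (W * \<kappa> ^ ?m)\<^sup>2 + \<kappa>\<^sup>2 * (B * \<rho> ^ ?m)))"
    using A B nn \<rho> by (simp add: ennreal_power flip: ennreal_mult ennreal_plus)
  also have "\<dots> \<le> ennreal (B * \<rho> ^ length (j # js))"
  proof (rule ennreal_leI)
    have "(\<kappa> ^ ?m)\<^sup>2 \<le> \<rho> ^ ?m"
      using power_mono[OF small(2), of ?m] by (simp add: power_mult [symmetric] mult.commute)
    then have "?C * (A * W\<^sup>2) * (\<kappa> ^ ?m)\<^sup>2 \<le> (B * \<rho> / 2) * \<rho> ^ ?m"
      using big A B \<rho> by (intro mult_mono) auto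
    moreover have "?C * \<kappa>\<^sup>2 * (B * \<rho> ^ ?m) \<le> (\<rho> / 2) * (B * \<rho> ^ ?m)"
      using small(1) B \<rho> by (intro mult_right_mono) auto
    ultimately show "?C * (A * (W * \<kappa> ^ ?m)\<^sup>2 + \<kappa>\<^sup>2 * (B * \<rho> ^ ?m)) \<le> B * \<rho> ^ length (j # js)"
      by (simp add: power_mult_distrib algebra_simps)
  qed
  finally show ?case .
qed (use hK in simp)

lemma norm_vec_le_sum: "norm (w :: complex^'d::finite) \<le> (\<Sum>j\<in>UNIV. norm (w $ j))"
  unfolding norm_vec_def by (rule L2_set_le_sum) simp

text \<open>If the Wiener norms of the arguments are small, the Taylor series of \<open>\<Phi>\<close> at \<open>a\<close> may be
  composed with them and summed in \<open>\<H>\<^sup>s\<close>. The function \<open>fourier K\<close> is the cutoff that multiplies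
  the composition; it is needed because the composition need not decay at infinity. The value of
  \<open>\<rho>\<close> is chosen such that the terms of order \<open>m\<close>, of which there are \<open>d\<^sup>m\<close> with coefficients of size
  \<open>(e/R)\<^sup>m\<close>, add up to a function of squared norm \<open>O (8\<^sup>-\<^sup>m)\<close>, as \<open>L2_series\<close> demands.\<close>

lemma Taylor_density:
  fixes \<Phi> :: "complex^'d::finite \<Rightarrow> complex" and D :: "'d \<Rightarrow> real^'n::finite \<Rightarrow> complex"
  assumes s: "s > real CARD('n) / 2"
    and \<Phi>: "holomorphic_several \<Phi> S" and S: "open S" "cball a R \<subseteq> S" and R: "R > 0"
    and M: "\<And>x. x \<in> cball a R \<Longrightarrow> norm (\<Phi> x) \<le> M"
    and m: "\<And>j. D j \<in> borel_measurable borel" "K \<in> borel_measurable borel"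
    and K: "wnorm K \<le> ennreal W" and D: "\<And>j. wnorm (D j) \<le> ennreal \<kappa>" and nn: "W \<ge> 0" "\<kappa> \<ge> 0"
    and hK: "hsq s K \<le> ennreal B" and hD: "\<And>j. hsq s (D j) \<le> ennreal A" and A: "A \<ge> 0" and B: "B \<ge> 0"
    and small: "2 * (2 * 4 powr s) * \<kappa>\<^sup>2 \<le> \<rho>" "\<kappa>\<^sup>2 \<le> \<rho>" and big: "2 * (2 * 4 powr s) * (A * W\<^sup>2) \<le> B * \<rho>"
    and \<rho>: "(real CARD('d) * (exp 1 / R))\<^sup>2 * \<rho> = 1 / 8" and \<kappa>: "real CARD('d) * \<kappa> < R"
  shows "\<exists>Q. Q \<in> borel_measurable borel \<and> hsq s Q \<le> ennreal (4 * (M\<^sup>2 * B)) \<and>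
    (\<forall>x. fourier Q x = fourier K x * \<Phi> (a + (\<chi> j. fourier (D j) x)))"
proof -
  let ?d = "real CARD('d)" and ?E = "exp 1 / R"
  have s0: "s \<ge> 0" by (rule half_dim_nonneg[OF s])
  have M0: "M \<ge> 0" using order_trans[OF norm_ge_zero M[of a]] R by simp
  have \<rho>0: "\<rho> \<ge> 0" using small(2) zero_le_power2[of \<kappa>] by linarith
  define c where "c js = pds js \<Phi> a / fact (length js)" for js
  have c: "norm (c js) \<le> M * ?E ^ length js" for js
    unfolding c_def by (rule pds_coefficient_bound[OF \<Phi> S R M])
  define L where "L m = {js :: 'd list. length js = m}" for m
  have L: "finite (L m)" "card (L m) = CARD('d) ^ m" for m
    using finite_lists_length_eq[of "UNIV :: 'd set" m] card_lists_length_eq[of "UNIV :: 'd set" m] by (auto simp: L_def)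
  have dm [measurable]: "dens D K js \<in> borel_measurable borel" for js by (rule dens_measurable[OF m])
  define T where "T m \<xi> = (\<Sum>js\<in>L m. c js * dens D K js \<xi>)" for m \<xi>
  have Tm [measurable]: "T m \<in> borel_measurable borel" for m unfolding T_def by measurable
  have di: "integrable lborel (dens D K js)" for js
    by (rule wnorm_integrable[OF dm le_less_trans[OF dens_wnorm[OF m K D nn]]]) simp
  have Tsize: "nsq (\<lambda>\<xi>. of_real (weight s \<xi>) * T m \<xi>) \<le> ennreal (M\<^sup>2 * B * (1 / 8) ^ m)" for m
  proof -
    have "nsq (\<lambda>\<xi>. of_real (weight s \<xi>) * T m \<xi>) = nsq (\<lambda>\<xi>. \<Sum>js\<in>L m. c js * (of_real (weight s \<xi>) * dens D K js \<xi>))"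
      unfolding T_def by (simp add: sum_distrib_left mult_ac)
    also have "\<dots> \<le> of_nat (card (L m)) * (\<Sum>js\<in>L m. nsq (\<lambda>\<xi>. c js * (of_real (weight s \<xi>) * dens D K js \<xi>)))"
      by (rule nsq_sum[OF L(1)]) measurable
    also have "\<dots> = of_nat (card (L m)) * (\<Sum>js\<in>L m. ennreal ((norm (c js))\<^sup>2) * hsq s (dens D K js))"
      unfolding hsq_def by (subst nsq_cmult) auto
    also have "\<dots> \<le> of_nat (card (L m)) * (\<Sum>js\<in>L m. ennreal ((M * ?E ^ m)\<^sup>2) * ennreal (B * \<rho> ^ m))"
    proof (intro mult_left_mono sum_mono)
      fix js assume "js \<in> L m"
      then have l: "length js = m" by (simp add: L_def)
      show "ennreal ((norm (c js))\<^sup>2) * hsq s (dens D K js) \<le> ennreal ((M * ?E ^ m)\<^sup>2) * ennreal (B * \<rho> ^ m)"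
        using c[of js] dens_hsq[OF s0 m K D nn hK hD A B small big, where js = js] unfolding l
        by (intro mult_mono ennreal_leI power_mono) auto
    qed auto
    also have "\<dots> = ennreal (?d ^ m * (?d ^ m * ((M * ?E ^ m)\<^sup>2 * (B * \<rho> ^ m))))"
      using B \<rho>0 by (simp add: L(2) ennreal_mult ennreal_of_nat_eq_real_of_nat)
    also have "?d ^ m * (?d ^ m * ((M * ?E ^ m)\<^sup>2 * (B * \<rho> ^ m))) = M\<^sup>2 * B * ((?d * ?E)\<^sup>2 * \<rho>) ^ m"
    proof -
      have "x ^ m * (x ^ m * ((M * y ^ m)\<^sup>2 * (B * \<rho> ^ m))) = M\<^sup>2 * B * ((x * y)\<^sup>2 * \<rho>) ^ m" for x y :: real
        by (simp add: power_mult_distrib power2_eq_square mult_ac)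
      then show ?thesis .
    qed
    finally show ?thesis unfolding \<rho> .
  qed
  have "\<exists>g. g \<in> borel_measurable borel \<and> nsq g \<le> ennreal (4 * (M\<^sup>2 * B)) \<and>
    (\<forall>b\<in>borel_measurable borel. nsq b < \<infinity> \<longrightarrow>
        (\<lambda>k. LINT \<xi>|lborel. (of_real (weight s \<xi>) * T k \<xi>) * b \<xi>) sums (LINT \<xi>|lborel. g \<xi> * b \<xi>))"
    by (rule L2_series) (use Tsize B in auto)
  then obtain g where g: "g \<in> borel_measurable borel" "nsq g \<le> ennreal (4 * (M\<^sup>2 * B))"
    "\<forall>b\<in>borel_measurable borel. nsq b < \<infinity> \<longrightarrow>
        (\<lambda>k. LINT \<xi>|lborel. (of_real (weight s \<xi>) * T k \<xi>) * b \<xi>) sums (LINT \<xi>|lborel. g \<xi> * b \<xi>)" by blast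
  define Q where "Q \<xi> = of_real (weight (- s) \<xi>) * g \<xi>" for \<xi>
  have Q: "Q \<in> borel_measurable borel" unfolding Q_def using g(1) by measurable
  have hQ: "hsq s Q = nsq g" unfolding hsq_def Q_def by (simp add: weight_uminus mult.assoc[symmetric])
  have "fourier Q x = fourier K x * \<Phi> (a + (\<chi> j. fourier (D j) x))" for x
  proof -
    \<comment> \<open>For \<open>s > n/2\<close> the value at \<open>x\<close> is a continuous functional on \<open>\<H>\<^sup>s\<close>, given by the pairing with
      \<open>?b\<close> in \<open>L\<^sup>2\<close>; so the series may be evaluated termwise.\<close>
    let ?w = "\<chi> j. fourier (D j) x" and ?b = "\<lambda>\<xi>. cis (- (\<xi> \<bullet> x)) * of_real (weight (- s) \<xi>)"
    have "nsq ?b = nsq (\<lambda>\<xi>::real^'n. complex_of_real (weight (- s) \<xi>))"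
      unfolding nsq_def by (simp add: norm_mult)
    then have "nsq ?b < \<infinity>" by (simp add: nsq_weight[OF s])
    then have "(\<lambda>k. LINT \<xi>|lborel. (of_real (weight s \<xi>) * T k \<xi>) * ?b \<xi>) sums (LINT \<xi>|lborel. g \<xi> * ?b \<xi>)"
      using g(3) by (simp add: borel_measurable_times)
    moreover have "(LINT \<xi>|lborel. g \<xi> * ?b \<xi>) = fourier Q x"
      unfolding fourier_def Q_def by (simp add: mult_ac)
    moreover have "(LINT \<xi>|lborel. (of_real (weight s \<xi>) * T k \<xi>) * ?b \<xi>) = fourier K x * ((\<Sum>js | length js = k. pds js \<Phi> a * monom_val js ?w) / fact k)" for k
    proof -
      have "(LINT \<xi>|lborel. (of_real (weight s \<xi>) * T k \<xi>) * ?b \<xi>) = (LINT \<xi>|lborel. (\<Sum>js\<in>L k. c js * (cis (- (\<xi> \<bullet> x)) * dens D K js \<xi>)))"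
      proof (intro Bochner_Integration.integral_cong refl)
        fix \<xi> :: "real^'n"
        have "(of_real (weight s \<xi>) * T k \<xi>) * ?b \<xi> = cis (- (\<xi> \<bullet> x)) * T k \<xi> * (of_real (weight s \<xi>) * of_real (weight (- s) \<xi>))"
          by (simp only: mult_ac)
        also have "complex_of_real (weight s \<xi>) * of_real (weight (- s) \<xi>) = 1" by (simp add: weight_uminus)
        finally show "(of_real (weight s \<xi>) * T k \<xi>) * ?b \<xi> = (\<Sum>js\<in>L k. c js * (cis (- (\<xi> \<bullet> x)) * dens D K js \<xi>))"
          by (simp add: T_def sum_distrib_left mult.left_commute)
      qed
      also have "\<dots> = (\<Sum>js\<in>L k. c js * fourier (dens D K js) x)"
        unfolding fourier_def
        by (subst Bochner_Integration.integral_sum) (auto intro: fourier_integrable[OF di])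
      also have "\<dots> = (\<Sum>js\<in>L k. fourier K x * (pds js \<Phi> a * monom_val js ?w / fact k))"
        by (intro sum.cong refl) (simp add: dens_fourier[OF m K D nn] c_def L_def)
      finally show ?thesis by (simp add: L_def sum_distrib_left sum_divide_distrib)
    qed
    ultimately have 1: "(\<lambda>k. fourier K x * ((\<Sum>js | length js = k. pds js \<Phi> a * monom_val js ?w) / fact k)) sums fourier Q x" by simp
    have "norm (fourier (D j) x) \<le> \<kappa>" for j
      using order_trans[OF fourier_norm_le_wnorm[OF m(1)] D, of j x] nn by simp
    then have "norm ?w \<le> (\<Sum>j\<in>(UNIV::'d set). \<kappa>)"
      by (intro order_trans[OF norm_vec_le_sum] sum_mono) simp
    then have "norm ?w < R" using \<kappa> by simp
    then have "(\<lambda>k. fourier K x * ((\<Sum>js | length js = k. pds js \<Phi> a * monom_val js ?w) / fact k)) sums (fourier K x * \<Phi> (a + ?w))"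
      by (intro sums_mult several_Taylor[OF \<Phi> S])
    with 1 show ?thesis by (rule sums_unique2)
  qed
  with Q hQ g(2) show ?thesis by auto
qed

section \<open>Localisation makes the Wiener norm small\<close>

text \<open>The modulus of continuity of the translations of \<open>X\<close> in \<open>L\<^sup>1\<close>.\<close>

definition trans_osc :: "(real^'n::finite \<Rightarrow> complex) \<Rightarrow> real^'n \<Rightarrow> ennreal" where
  "trans_osc X z = (\<integral>\<^sup>+\<eta>. norm (X (\<eta> - z) - X \<eta>) \<partial>lborel)"

lemma trans_osc_measurable [measurable]:
  assumes [measurable]: "X \<in> borel_measurable borel" shows "trans_osc X \<in> borel_measurable borel"
  unfolding trans_osc_def by measurable

lemma trans_osc_le:
  assumes [measurable]: "X \<in> borel_measurable borel" shows "trans_osc X z \<le> 2 * wnorm X"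
proof -
  have "trans_osc X z \<le> (\<integral>\<^sup>+\<eta>. ennreal (norm (X (\<eta> - z))) + ennreal (norm (X \<eta>)) \<partial>lborel)"
    unfolding trans_osc_def
    by (intro nn_integral_mono) (simp add: ennreal_leI norm_triangle_ineq4 flip: ennreal_plus)
  also have "\<dots> = (\<integral>\<^sup>+\<eta>. ennreal (norm (X (\<eta> - z))) \<partial>lborel) + wnorm X"
    unfolding wnorm_def by (rule nn_integral_add) auto
  also have "(\<integral>\<^sup>+\<eta>. ennreal (norm (X (\<eta> - z))) \<partial>lborel) = wnorm X"
    unfolding wnorm_def by (rule nn_integral_lborel_shift) auto
  finally show ?thesis by (simp add: mult_2)
qed

lemma trans_osc_tendsto_0:
  fixes X :: "real^'n::finite \<Rightarrow> complex"
  assumes X: "X \<in> schwartz"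
  shows "(\<lambda>k. trans_osc X (eps k *\<^sub>R \<xi>)) \<longlonglongrightarrow> 0"
proof -
  let ?n = "CARD('n)" and ?w = "\<lambda>x::real^'n. (weight (- real CARD('n)) x)\<^sup>2"
  have [measurable]: "X \<in> borel_measurable borel" by (rule schwartz_measurable[OF X])
  obtain C where C: "C \<ge> 0" "\<And>x. (1 + norm x) ^ (2 * ?n) * norm (X x) \<le> C"
    using rapidE[OF schwartz_rapid[OF X]] by blast
  have bound: "norm (X (x - z)) \<le> C * 4 ^ ?n * ?w x" if z: "norm z \<le> 1" for x z
    by (rule decay_nearby[OF C(2)]) (use z in auto)
  have lim: "(\<lambda>k. eps k *\<^sub>R \<xi>) \<longlonglongrightarrow> 0"
    using tendsto_scaleR[OF eps_tendsto tendsto_const, of \<xi>] by simp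
  then have "\<forall>\<^sub>F k in sequentially. norm (eps k *\<^sub>R \<xi>) < 1"
    using tendsto_norm[OF lim] by (intro order_tendstoD(2)) auto
  then obtain N where N: "\<And>k. k \<ge> N \<Longrightarrow> norm (eps k *\<^sub>R \<xi>) \<le> 1"
    unfolding eventually_sequentially by (meson less_imp_le)
  have "(\<lambda>k. \<integral>\<^sup>+\<eta>. norm (X (\<eta> - eps (k + N) *\<^sub>R \<xi>) - X \<eta>) \<partial>lborel) \<longlonglongrightarrow> (\<integral>\<^sup>+\<eta>. (0::ennreal) \<partial>(lborel :: (real^'n) measure))"
  proof (rule nn_integral_dominated_convergence[where w = "\<lambda>x. ennreal (2 * (C * 4 ^ ?n)) * ennreal (?w x)"])
    show "AE \<eta> in lborel. ennreal (norm (X (\<eta> - eps (k + N) *\<^sub>R \<xi>) - X \<eta>)) \<le> ennreal (2 * (C * 4 ^ ?n)) * ennreal (?w \<eta>)" for k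
    proof (rule AE_I2)
      fix \<eta>
      have "norm (X (\<eta> - eps (k + N) *\<^sub>R \<xi>) - X \<eta>) \<le> norm (X (\<eta> - eps (k + N) *\<^sub>R \<xi>)) + norm (X (\<eta> - 0))"
        using norm_triangle_ineq4 by simp
      also have "\<dots> \<le> C * 4 ^ ?n * ?w \<eta> + C * 4 ^ ?n * ?w \<eta>"
        by (intro add_mono bound N) auto
      finally have "norm (X (\<eta> - eps (k + N) *\<^sub>R \<xi>) - X \<eta>) \<le> 2 * (C * 4 ^ ?n) * ?w \<eta>" by (simp add: algebra_simps)
      then show "ennreal (norm (X (\<eta> - eps (k + N) *\<^sub>R \<xi>) - X \<eta>)) \<le> ennreal (2 * (C * 4 ^ ?n)) * ennreal (?w \<eta>)"
        using C(1) by (simp add: ennreal_leI flip: ennreal_mult)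
    qed
    show "(\<integral>\<^sup>+x. ennreal (2 * (C * 4 ^ ?n)) * ennreal (?w x) \<partial>lborel) < \<infinity>"
      using weight_square_integrable[where 'n = 'n, of "real ?n"]
      by (subst nn_integral_cmult) (auto simp: ennreal_mult_less_top)
    show "AE \<eta> in lborel. (\<lambda>k. ennreal (norm (X (\<eta> - eps (k + N) *\<^sub>R \<xi>) - X \<eta>))) \<longlonglongrightarrow> 0"
    proof (rule AE_I2)
      fix \<eta>
      have "(\<lambda>k. \<eta> - eps (k + N) *\<^sub>R \<xi>) \<longlonglongrightarrow> \<eta> - 0"
        by (intro tendsto_diff tendsto_const LIMSEQ_ignore_initial_segment[OF lim])
      then have "(\<lambda>k. X (\<eta> - eps (k + N) *\<^sub>R \<xi>)) \<longlonglongrightarrow> X \<eta>"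
        using continuous_on_tendsto_compose[OF smooth_continuous_on[OF schwartz_smooth[OF X], of UNIV], of _ \<eta>] by simp
      then have "(\<lambda>k. norm (X (\<eta> - eps (k + N) *\<^sub>R \<xi>) - X \<eta>)) \<longlonglongrightarrow> norm (X \<eta> - X \<eta>)"
        by (intro tendsto_norm tendsto_diff tendsto_const)
      then have "(\<lambda>k. ennreal (norm (X (\<eta> - eps (k + N) *\<^sub>R \<xi>) - X \<eta>))) \<longlonglongrightarrow> ennreal (norm (X \<eta> - X \<eta>))"
        by (rule tendsto_ennrealI)
      then show "(\<lambda>k. ennreal (norm (X (\<eta> - eps (k + N) *\<^sub>R \<xi>) - X \<eta>))) \<longlonglongrightarrow> 0" by simp
    qed
  qed measurable
  then have "(\<lambda>k. trans_osc X (eps (k + N) *\<^sub>R \<xi>)) \<longlonglongrightarrow> 0" by (simp add: trans_osc_def)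
  then show ?thesis by (rule LIMSEQ_offset)
qed

lemma osc_square_tendsto_0:
  fixes X :: "real^'n::finite \<Rightarrow> complex"
  assumes X: "X \<in> schwartz" and s: "s > real CARD('n) / 2"
  shows "(\<lambda>k. \<integral>\<^sup>+\<xi>. (trans_osc X (eps k *\<^sub>R \<xi>) * ennreal (weight (- s) \<xi>))\<^sup>2 \<partial>lborel) \<longlonglongrightarrow> 0"
proof -
  have [measurable]: "X \<in> borel_measurable borel" by (rule schwartz_measurable[OF X])
  have "(\<lambda>k. \<integral>\<^sup>+\<xi>. (trans_osc X (eps k *\<^sub>R \<xi>) * ennreal (weight (- s) \<xi>))\<^sup>2 \<partial>lborel) \<longlonglongrightarrow> (\<integral>\<^sup>+\<xi>. (0::ennreal) \<partial>(lborel :: (real^'n) measure))"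
  proof (rule nn_integral_dominated_convergence[where w = "\<lambda>\<xi>. (2 * wnorm X)\<^sup>2 * ennreal ((weight (- s) \<xi>)\<^sup>2)"])
    show "AE \<xi> in lborel. (trans_osc X (eps k *\<^sub>R \<xi>) * ennreal (weight (- s) \<xi>))\<^sup>2 \<le> (2 * wnorm X)\<^sup>2 * ennreal ((weight (- s) \<xi>)\<^sup>2)" for k
    proof (rule AE_I2)
      fix \<xi> :: "real^'n"
      have "(trans_osc X (eps k *\<^sub>R \<xi>) * ennreal (weight (- s) \<xi>))\<^sup>2 = (trans_osc X (eps k *\<^sub>R \<xi>))\<^sup>2 * ennreal ((weight (- s) \<xi>)\<^sup>2)"
        by (simp add: power_mult_distrib ennreal_power)
      also have "\<dots> \<le> (2 * wnorm X)\<^sup>2 * ennreal ((weight (- s) \<xi>)\<^sup>2)"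
        by (intro mult_right_mono power_mono trans_osc_le) auto
      finally show "(trans_osc X (eps k *\<^sub>R \<xi>) * ennreal (weight (- s) \<xi>))\<^sup>2 \<le> (2 * wnorm X)\<^sup>2 * ennreal ((weight (- s) \<xi>)\<^sup>2)" .
    qed
    show "(\<integral>\<^sup>+\<xi>. (2 * wnorm X)\<^sup>2 * ennreal ((weight (- s) (\<xi>::real^'n))\<^sup>2) \<partial>lborel) < \<infinity>"
      using weight_square_integrable[OF s] schwartz_wnorm[OF X]
      by (subst nn_integral_cmult) (auto simp: ennreal_mult_less_top power_less_top_ennreal)
    show "AE \<xi> in lborel. (\<lambda>k. (trans_osc X (eps k *\<^sub>R \<xi>) * ennreal (weight (- s) \<xi>))\<^sup>2) \<longlonglongrightarrow> 0"
    proof (rule AE_I2)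
      fix \<xi> :: "real^'n"
      have "(\<lambda>k. trans_osc X (eps k *\<^sub>R \<xi>) * ennreal (weight (- s) \<xi>)) \<longlonglongrightarrow> 0 * ennreal (weight (- s) \<xi>)"
        by (intro tendsto_mult_ennreal trans_osc_tendsto_0 X tendsto_const) auto
      then have "(\<lambda>k. trans_osc X (eps k *\<^sub>R \<xi>) * ennreal (weight (- s) \<xi>)) \<longlonglongrightarrow> 0" by simp
      from tendsto_mult_ennreal[OF this this]
      show "(\<lambda>k. (trans_osc X (eps k *\<^sub>R \<xi>) * ennreal (weight (- s) \<xi>))\<^sup>2) \<longlonglongrightarrow> 0" by (simp add: power2_eq_square)
    qed
  qed measurable
  then show ?thesis by simp
qed

text \<open>The Fourier density of the dilated function \<open>\<lambda>x. fourier X (x / r)\<close>.\<close>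

definition scaled :: "real \<Rightarrow> (real^'n::finite \<Rightarrow> complex) \<Rightarrow> real^'n \<Rightarrow> complex" where
  "scaled r X \<eta> = of_real (r ^ CARD('n)) * X (r *\<^sub>R \<eta>)"

lemma inv_fourier_dilate:
  fixes \<phi> :: "real^'n::finite \<Rightarrow> complex"
  assumes [measurable]: "\<phi> \<in> borel_measurable borel" and r: "r > 0"
  shows "inv_fourier (\<lambda>x. \<phi> ((1 / r) *\<^sub>R x)) = scaled r (inv_fourier \<phi>)"
proof
  fix \<eta> :: "real^'n"
  have "(LINT x|lborel. cis (\<eta> \<bullet> x) * \<phi> ((1 / r) *\<^sub>R x))
     = of_real (\<bar>r\<bar> ^ DIM(real^'n)) * (LINT x|lborel. cis (\<eta> \<bullet> (0 + r *\<^sub>R x)) * \<phi> ((1 / r) *\<^sub>R (0 + r *\<^sub>R x)))"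
    by (rule integral_lborel_affine) (use r in auto)
  then show "inv_fourier (\<lambda>x. \<phi> ((1 / r) *\<^sub>R x)) \<eta> = scaled r (inv_fourier \<phi>) \<eta>"
    using r by (simp add: inv_fourier_def scaled_def)
qed

text \<open>The Wiener norm is invariant under dilations, so the Wiener norm of
  \<open>x \<mapsto> \<chi> (x/r) (f x - f 0)\<close> equals that of \<open>x \<mapsto> \<chi> x (f (r x) - f 0)\<close>. This tends to \<open>0\<close> with \<open>r\<close>,
  uniformly on bounded subsets of \<open>\<H>\<^sup>s\<close>: the Fourier density is an average of the differences
  \<open>X (\<eta> - r \<xi>) - X \<eta>\<close> against the density \<open>P \<xi>\<close> of \<open>f\<close>, and the \<open>L\<^sup>1\<close>-norms of these differences
  tend to \<open>0\<close> for every \<open>\<xi>\<close>.\<close>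

lemma localized_wnorm:
  fixes X P :: "real^'n::finite \<Rightarrow> complex"
  assumes Xm [measurable]: "X \<in> borel_measurable borel" and intX: "integrable lborel (scaled r X)"
    and Pm [measurable]: "P \<in> borel_measurable borel" and intP: "integrable lborel P" and r: "r > 0"
  shows "(wnorm (\<lambda>\<eta>. conv (scaled r X) P \<eta> - fourier P 0 * scaled r X \<eta>))\<^sup>2
    \<le> hsq s P * (\<integral>\<^sup>+\<xi>. (trans_osc X (r *\<^sub>R \<xi>) * ennreal (weight (- s) \<xi>))\<^sup>2 \<partial>lborel)"
proof -
  let ?X = "scaled r X" and ?D = "\<lambda>\<eta>. conv (scaled r X) P \<eta> - fourier P 0 * scaled r X \<eta>"
  have [measurable]: "?X \<in> borel_measurable borel" unfolding scaled_def by measurable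
  have Dle: "ennreal (norm (?D \<eta>)) \<le> (\<integral>\<^sup>+\<xi>. ennreal (norm (?X (\<eta> - \<xi>) - ?X \<eta>)) * ennreal (norm (P \<xi>)) \<partial>lborel)"
    if int: "integrable lborel (\<lambda>\<xi>. ?X (\<eta> - \<xi>) * P \<xi>)" for \<eta>
  proof -
    have "fourier P 0 * ?X \<eta> = (LINT \<xi>|lborel. ?X \<eta> * P \<xi>)"
      by (simp add: fourier_def)
    then have "?D \<eta> = (LINT \<xi>|lborel. ?X (\<eta> - \<xi>) * P \<xi> - ?X \<eta> * P \<xi>)"
      unfolding conv_def using int intP by simp
    also have "\<dots> = (LINT \<xi>|lborel. (?X (\<eta> - \<xi>) - ?X \<eta>) * P \<xi>)" by (simp add: left_diff_distrib)
    finally have "ennreal (norm (?D \<eta>)) \<le> (\<integral>\<^sup>+\<xi>. norm ((?X (\<eta> - \<xi>) - ?X \<eta>) * P \<xi>) \<partial>lborel)"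
      by (simp only:) (rule norm_integral_le_nn_integral, measurable)
    then show ?thesis by (simp add: norm_mult ennreal_mult')
  qed
  have AEint: "AE \<eta> in lborel. integrable lborel (\<lambda>\<xi>. ?X (\<eta> - \<xi>) * P \<xi>)"
  proof -
    have "(\<integral>\<^sup>+\<eta>. (\<integral>\<^sup>+\<xi>. ennreal (norm (?X (\<eta> - \<xi>))) * ennreal (norm (P \<xi>)) \<partial>lborel) \<partial>lborel) = wnorm ?X * wnorm P"
      unfolding wnorm_def by (rule nn_integral_convolution) auto
    also have "\<dots> < \<infinity>"
      using intX intP by (simp add: wnorm_def integrable_iff_bounded ennreal_mult_less_top)
    finally have "AE \<eta> in lborel. (\<integral>\<^sup>+\<xi>. ennreal (norm (?X (\<eta> - \<xi>))) * ennreal (norm (P \<xi>)) \<partial>lborel) \<noteq> \<infinity>"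
      by (intro nn_integral_PInf_AE) auto
    then show ?thesis
    proof eventually_elim
      fix \<eta> assume "(\<integral>\<^sup>+\<xi>. ennreal (norm (?X (\<eta> - \<xi>))) * ennreal (norm (P \<xi>)) \<partial>lborel) \<noteq> \<infinity>"
      then show "integrable lborel (\<lambda>\<xi>. ?X (\<eta> - \<xi>) * P \<xi>)"
        by (intro integrableI_bounded) (auto simp: norm_mult ennreal_mult' top.not_eq_extremum)
    qed
  qed
  have "wnorm ?D \<le> (\<integral>\<^sup>+\<eta>. (\<integral>\<^sup>+\<xi>. ennreal (norm (?X (\<eta> - \<xi>) - ?X \<eta>)) * ennreal (norm (P \<xi>)) \<partial>lborel) \<partial>lborel)"
    unfolding wnorm_def by (rule nn_integral_mono_AE) (use AEint Dle in \<open>auto elim: eventually_mono\<close>)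
  also have "\<dots> = (\<integral>\<^sup>+\<xi>. (\<integral>\<^sup>+\<eta>. ennreal (norm (?X (\<eta> - \<xi>) - ?X \<eta>)) * ennreal (norm (P \<xi>)) \<partial>lborel) \<partial>lborel)"
    by (rule lborel_pair.Fubini') measurable
  also have "\<dots> = (\<integral>\<^sup>+\<xi>. trans_osc X (r *\<^sub>R \<xi>) * ennreal (norm (P \<xi>)) \<partial>lborel)"
  proof (rule nn_integral_cong)
    fix \<xi> :: "real^'n"
    have "trans_osc X (r *\<^sub>R \<xi>) = ennreal (\<bar>r\<bar> ^ DIM(real^'n)) * (\<integral>\<^sup>+\<eta>. norm (X ((0 + r *\<^sub>R \<eta>) - r *\<^sub>R \<xi>) - X (0 + r *\<^sub>R \<eta>)) \<partial>lborel)"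
      unfolding trans_osc_def by (rule nn_integral_lborel_affine) (use r in auto)
    also have "\<dots> = (\<integral>\<^sup>+\<eta>. ennreal (r ^ CARD('n)) * norm (X (r *\<^sub>R (\<eta> - \<xi>)) - X (r *\<^sub>R \<eta>)) \<partial>lborel)"
      using r by (subst nn_integral_cmult[symmetric]) (auto simp: scaleR_diff_right)
    also have "\<dots> = (\<integral>\<^sup>+\<eta>. norm (?X (\<eta> - \<xi>) - ?X \<eta>) \<partial>lborel)"
    proof (rule nn_integral_cong)
      fix \<eta>
      have "norm (?X (\<eta> - \<xi>) - ?X \<eta>) = norm (complex_of_real (r ^ CARD('n)) * (X (r *\<^sub>R (\<eta> - \<xi>)) - X (r *\<^sub>R \<eta>)))"
        unfolding scaled_def by (simp only: right_diff_distrib)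
      also have "\<dots> = r ^ CARD('n) * norm (X (r *\<^sub>R (\<eta> - \<xi>)) - X (r *\<^sub>R \<eta>))"
        unfolding norm_mult using r by (simp add: norm_power)
      finally show "ennreal (r ^ CARD('n)) * norm (X (r *\<^sub>R (\<eta> - \<xi>)) - X (r *\<^sub>R \<eta>)) = ennreal (norm (?X (\<eta> - \<xi>) - ?X \<eta>))"
        using r by (simp add: ennreal_mult)
    qed
    finally show "(\<integral>\<^sup>+\<eta>. ennreal (norm (?X (\<eta> - \<xi>) - ?X \<eta>)) * ennreal (norm (P \<xi>)) \<partial>lborel) = trans_osc X (r *\<^sub>R \<xi>) * ennreal (norm (P \<xi>))"
      by (simp add: nn_integral_multc)
  qed
  also have "\<dots> = (\<integral>\<^sup>+\<xi>. (trans_osc X (r *\<^sub>R \<xi>) * ennreal (weight (- s) \<xi>)) * ennreal (norm (of_real (weight s \<xi>) * P \<xi>)) \<partial>lborel)"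
  proof (rule nn_integral_cong)
    fix \<xi> :: "real^'n"
    have "norm (P \<xi>) = weight (- s) \<xi> * norm (of_real (weight s \<xi>) * P \<xi>)"
      by (simp add: norm_mult weight_uminus)
    then show "trans_osc X (r *\<^sub>R \<xi>) * ennreal (norm (P \<xi>)) = (trans_osc X (r *\<^sub>R \<xi>) * ennreal (weight (- s) \<xi>)) * ennreal (norm (of_real (weight s \<xi>) * P \<xi>))"
      by (metis ennreal_mult mult.assoc norm_ge_zero weight_nonneg)
  qed
  finally have "(wnorm ?D)\<^sup>2 \<le> (\<integral>\<^sup>+\<xi>. (trans_osc X (r *\<^sub>R \<xi>) * ennreal (weight (- s) \<xi>)) * ennreal (norm (of_real (weight s \<xi>) * P \<xi>)) \<partial>lborel)\<^sup>2"
    by (intro power_mono) auto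
  also have "\<dots> \<le> (\<integral>\<^sup>+\<xi>. (trans_osc X (r *\<^sub>R \<xi>) * ennreal (weight (- s) \<xi>))\<^sup>2 \<partial>lborel) * (\<integral>\<^sup>+\<xi>. (ennreal (norm (of_real (weight s \<xi>) * P \<xi>)))\<^sup>2 \<partial>lborel)"
    by (rule Cauchy_Schwarz_nn_integral) measurable
  finally show ?thesis by (simp add: hsq_def nsq_def mult.commute)
qed

text \<open>The local form of the theorem at the origin: the cutoff \<open>k\<close> and the bound \<open>B\<close> are uniform over
  all tuples of functions in a ball of \<open>\<H>\<^sup>s\<close> whose values at \<open>0\<close> lie in the given compact set.\<close>

lemma local_composition:
  fixes \<Phi> :: "complex^'d::finite \<Rightarrow> complex" and h :: "real^'n::finite \<Rightarrow> complex"
  assumes s: "s > real CARD('n) / 2"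
    and h: "h \<in> test_functions" "h \<noteq> (\<lambda>x. 0)"
    and \<Phi>: "holomorphic_several \<Phi> S" and S: "open S" and C: "compact C" "C \<subseteq> S"
    and A: "A \<ge> 0" and \<delta>: "\<delta> > 0"
  shows "\<exists>k B. k \<in> test_functions \<and> k \<noteq> (\<lambda>x. 0) \<and> (\<forall>x::real^'n. k x \<noteq> 0 \<longrightarrow> norm x < \<delta>) \<and>
    (\<forall>P. (\<forall>j. P j \<in> borel_measurable borel \<and> hsq s (P j) \<le> ennreal A) \<and> (\<chi> j. fourier (P j) 0) \<in> C \<longrightarrow>
      (\<exists>Q. Q \<in> borel_measurable borel \<and> hsq s Q \<le> ennreal B \<and>
        (\<forall>x. fourier Q x = k x * \<Phi> (\<chi> j. fourier (P j) x))))"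
proof -
  let ?d = "real CARD('d)"
  have d: "?d \<ge> 1" using zero_less_card_finite[where 'a = 'd] by linarith
  have s0: "s \<ge> 0" by (rule half_dim_nonneg[OF s])
  obtain R where R: "R > 0" "(\<Union>a\<in>C. cball a R) \<subseteq> S"
    using compact_subset_open_imp_cball_epsilon_subset[OF C(1) S C(2)] by metis
  have "compact {a + w |a w. a \<in> C \<and> w \<in> cball 0 R}" by (intro compact_sums C compact_cball)
  moreover have sums: "{a + w |a w. a \<in> C \<and> w \<in> cball 0 R} = (\<Union>a\<in>C. cball a R)"
  proof (intro set_eqI iffI)
    fix x assume "x \<in> (\<Union>a\<in>C. cball a R)"
    then obtain a where "a \<in> C" "dist a x \<le> R" by auto
    then show "x \<in> {a + w |a w. a \<in> C \<and> w \<in> cball 0 R}"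
      unfolding mem_Collect_eq by (intro exI[of _ a] exI[of _ "x - a"]) (simp add: dist_norm norm_minus_commute)
  next
    fix x assume "x \<in> {a + w |a w. a \<in> C \<and> w \<in> cball 0 R}"
    then obtain a w where "x = a + w" "a \<in> C" "norm w \<le> R" by auto
    then show "x \<in> (\<Union>a\<in>C. cball a R)" by (auto simp: dist_norm intro!: bexI[of _ a])
  qed
  ultimately have "compact (\<Phi> ` (\<Union>a\<in>C. cball a R))"
    by (intro compact_continuous_image continuous_on_subset[OF several_continuous_on[OF \<Phi>] R(2)]) simp
  then have "bounded (\<Phi> ` (\<Union>a\<in>C. cball a R))" by (rule compact_imp_bounded)
  then obtain M where M: "\<And>a x. a \<in> C \<Longrightarrow> x \<in> cball a R \<Longrightarrow> norm (\<Phi> x) \<le> M"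
    unfolding bounded_iff by blast
  \<comment> \<open>The rate \<open>\<rho>\<close> is fixed by the Taylor coefficients and \<open>\<kappa>\<close> is the smallness required of
    the Wiener norms. Both depend on \<open>R\<close>, \<open>d\<close> and \<open>s\<close> only, so that the scale \<open>r\<close> can be
    chosen afterwards, uniformly over the tuples \<open>P\<close>.\<close>
  define \<rho> where "\<rho> = 1 / (8 * (?d * (exp 1 / R))\<^sup>2)"
  have dE: "(?d * (exp 1 / R))\<^sup>2 > 0" using d R by simp
  have \<rho>: "\<rho> > 0" "(?d * (exp 1 / R))\<^sup>2 * \<rho> = 1 / 8" using dE by (auto simp: \<rho>_def)
  define \<kappa> where "\<kappa> = Min {sqrt (\<rho> / (4 * 4 powr s)), sqrt \<rho>, R / (2 * ?d)}"
  have \<kappa>0: "\<kappa> > 0" using \<rho>(1) R d by (simp add: \<kappa>_def)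
  have \<kappa>1: "2 * (2 * 4 powr s) * \<kappa>\<^sup>2 \<le> \<rho>"
  proof -
    have "\<kappa>\<^sup>2 \<le> (sqrt (\<rho> / (4 * 4 powr s)))\<^sup>2" using \<kappa>0 by (intro power_mono) (auto simp: \<kappa>_def)
    also have "\<dots> = \<rho> / (4 * 4 powr s)" using \<rho>(1) by simp
    finally have "4 * 4 powr s * \<kappa>\<^sup>2 \<le> 4 * 4 powr s * (\<rho> / (4 * 4 powr s))" by (intro mult_left_mono) auto
    then show ?thesis by simp
  qed
  have \<kappa>2: "\<kappa>\<^sup>2 \<le> \<rho>"
  proof -
    have "\<kappa>\<^sup>2 \<le> (sqrt \<rho>)\<^sup>2" using \<kappa>0 by (intro power_mono) (auto simp: \<kappa>_def)
    then show ?thesis using \<rho>(1) by simp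
  qed
  have \<kappa>3: "?d * \<kappa> < R"
  proof -
    have "?d * \<kappa> \<le> ?d * (R / (2 * ?d))" using d by (intro mult_left_mono) (auto simp: \<kappa>_def)
    also have "\<dots> = R / 2" using d by simp
    finally show ?thesis using R by simp
  qed
  obtain \<chi>\<^sub>0 :: "real^'n \<Rightarrow> complex" where \<chi>: "\<chi>\<^sub>0 \<in> test_functions" "\<forall>x\<in>cball 0 1. \<chi>\<^sub>0 x = 1" "\<forall>x. norm (\<chi>\<^sub>0 x) \<le> 1"
    "\<forall>x. \<chi>\<^sub>0 x \<noteq> 0 \<longrightarrow> (\<exists>b\<in>cball 0 1. dist x b \<le> 1)"
    using ex_cutoff[OF h zero_less_one compact_cball, of 0 1] by blast
  have \<chi>supp: "norm x \<le> 2" if x: "\<chi>\<^sub>0 x \<noteq> 0" for x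
  proof -
    obtain b where "norm b \<le> 1" "norm (x - b) \<le> 1" using \<chi>(4)[rule_format, OF x] by (auto simp: dist_norm)
    then show ?thesis using norm_triangle_ineq[of b "x - b"] by simp
  qed
  define X where "X = inv_fourier \<chi>\<^sub>0"
  have X: "X \<in> schwartz" unfolding X_def by (intro inv_fourier_schwartz test_functions_schwartz \<chi>)
  have Xm: "X \<in> borel_measurable borel" by (rule schwartz_measurable[OF X])
  have "(\<lambda>k. ennreal A * (\<integral>\<^sup>+\<xi>. (trans_osc X (eps k *\<^sub>R \<xi>) * ennreal (weight (- s) \<xi>))\<^sup>2 \<partial>lborel)) \<longlonglongrightarrow> ennreal A * 0"
    by (intro tendsto_mult_ennreal osc_square_tendsto_0 X s tendsto_const) auto
  then have "\<forall>\<^sub>F k in sequentially. ennreal A * (\<integral>\<^sup>+\<xi>. (trans_osc X (eps k *\<^sub>R \<xi>) * ennreal (weight (- s) \<xi>))\<^sup>2 \<partial>lborel) < ennreal (\<kappa>\<^sup>2)"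
    using \<kappa>0 by (intro order_tendstoD(2)) auto
  then obtain N where N: "ennreal A * (\<integral>\<^sup>+\<xi>. (trans_osc X (eps N *\<^sub>R \<xi>) * ennreal (weight (- s) \<xi>))\<^sup>2 \<partial>lborel) < ennreal (\<kappa>\<^sup>2)"
    unfolding eventually_sequentially by blast
  define r where "r = eps N"
  have r: "r > 0" by (simp add: r_def)
  define \<chi>\<^sub>r where "\<chi>\<^sub>r x = \<chi>\<^sub>0 ((1 / r) *\<^sub>R x)" for x
  have \<chi>r: "\<chi>\<^sub>r \<in> test_functions"
    using test_functions_affine[OF \<chi>(1), of "1 / r" 0] r by (simp add: \<chi>\<^sub>r_def [abs_def])
  have \<chi>r1: "\<chi>\<^sub>r x = 1" if "norm x \<le> r" for x
    unfolding \<chi>\<^sub>r_def by (rule \<chi>(2)[rule_format]) (use that r in simp)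
  define X\<^sub>r where "X\<^sub>r = scaled r X"
  have Xr_eq: "X\<^sub>r = inv_fourier \<chi>\<^sub>r"
    unfolding X\<^sub>r_def X_def \<chi>\<^sub>r_def [abs_def]
    by (rule inv_fourier_dilate[symmetric]) (use \<chi>(1) r in \<open>auto intro: smooth_measurable test_functions_smooth\<close>)
  have Xr: "X\<^sub>r \<in> schwartz" unfolding Xr_eq by (intro inv_fourier_schwartz test_functions_schwartz \<chi>r)
  have Xrm: "X\<^sub>r \<in> borel_measurable borel" by (rule schwartz_measurable[OF Xr])
  have Xrf: "fourier X\<^sub>r = \<chi>\<^sub>r" unfolding Xr_eq by (intro fourier_inv_fourier test_functions_schwartz \<chi>r)
  \<comment> \<open>The final cutoff \<open>k\<close> is supported in the ball of radius \<open>2 / c\<close>. This is at most \<open>r\<close>, so that the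
    cutoff \<open>\<chi>\<^sub>r\<close> in the arguments of the Taylor series equals \<open>1\<close> there, and it is less than \<open>\<delta>\<close>.\<close>
  define c where "c = 2 / r + 4 / \<delta>"
  have c: "c > 0" "2 \<le> c * r" "4 \<le> c * \<delta>" using r \<delta> by (auto simp: c_def distrib_right intro: add_pos_pos)
  define k where "k x = \<chi>\<^sub>0 (c *\<^sub>R x)" for x
  have k: "k \<in> test_functions"
    using test_functions_affine[OF \<chi>(1), of c 0] c by (simp add: k_def [abs_def])
  have ksupp: "norm x \<le> r \<and> norm x < \<delta>" if "k x \<noteq> 0" for x
  proof -
    have n: "c * norm x \<le> 2" using \<chi>supp[of "c *\<^sub>R x"] that c by (simp add: k_def)
    then have "c * norm x \<le> c * r" "c * norm x < c * \<delta>" using c by linarith+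
    then show ?thesis using c(1) by simp
  qed
  define K where "K = inv_fourier k"
  have K: "K \<in> schwartz" unfolding K_def by (intro inv_fourier_schwartz test_functions_schwartz k)
  have Km: "K \<in> borel_measurable borel" by (rule schwartz_measurable[OF K])
  have Kf: "fourier K = k" unfolding K_def by (intro fourier_inv_fourier test_functions_schwartz k)
  obtain K1 where K1: "wnorm K = ennreal K1" "K1 \<ge> 0" using schwartz_wnorm[OF K] by (cases "wnorm K") auto
  obtain HK where HK: "hsq s K = ennreal HK" "HK \<ge> 0" using schwartz_hsq[OF K, of s] by (cases "hsq s K") auto
  obtain HX where HX: "hsq s X\<^sub>r = ennreal HX" "HX \<ge> 0" using schwartz_hsq[OF Xr, of s] by (cases "hsq s X\<^sub>r") auto
  obtain WX where WX: "wnorm X\<^sub>r = ennreal WX" "WX \<ge> 0" using schwartz_wnorm[OF Xr] by (cases "wnorm X\<^sub>r") auto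
  let ?m = "wmass s TYPE('n)"
  \<comment> \<open>\<open>A'\<close> bounds the squared \<open>\<H>\<^sup>s\<close>-norms of the localised arguments. It may be huge for small
    \<open>r\<close>; the constant \<open>B\<close> absorbs it.\<close>
  define A' where "A' = 2 * (2 * 4 powr s * (HX * (?m * A) + WX\<^sup>2 * A)) + 2 * ((?m * A) * HX)"
  have A': "A' \<ge> 0" unfolding A'_def using A HX WX by simp
  define B where "B = HK + 2 * (2 * 4 powr s) * (A' * K1\<^sup>2) / \<rho>"
  have B: "B \<ge> 0" "HK \<le> B" "2 * (2 * 4 powr s) * (A' * K1\<^sup>2) \<le> B * \<rho>"
    using HK A' \<rho>(1) by (auto simp: B_def distrib_right)
  show ?thesis
  proof (rule exI[of _ k], rule exI[of _ "4 * (M\<^sup>2 * B)"], intro conjI allI impI)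
    show "k \<in> test_functions" by (rule k)
    have "k 0 = 1" using \<chi>(2) by (simp add: k_def)
    then show "k \<noteq> (\<lambda>x. 0)" by (metis zero_neq_one)
    show "norm x < \<delta>" if "k x \<noteq> 0" for x using ksupp[OF that] by simp
    fix P :: "'d \<Rightarrow> real^'n \<Rightarrow> complex"
    assume "(\<forall>j. P j \<in> borel_measurable borel \<and> hsq s (P j) \<le> ennreal A) \<and> (\<chi> j. fourier (P j) 0) \<in> C"
    then have Pm: "P j \<in> borel_measurable borel" and PA: "hsq s (P j) \<le> ennreal A" and aC: "(\<chi> j. fourier (P j) 0) \<in> C" for j
      by auto
    define a where "a = (\<chi> j. fourier (P j) 0)"
    have Pi: "integrable lborel (P j)" for j
      by (rule hsq_integrable[OF s Pm le_less_trans[OF PA]]) simp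
    have Pw: "(wnorm (P j))\<^sup>2 \<le> ennreal (?m * A)" for j
    proof -
      have "(wnorm (P j))\<^sup>2 \<le> ennreal ?m * hsq s (P j)" by (rule wnorm_le_hsq[OF s Pm])
      also have "\<dots> \<le> ennreal ?m * ennreal A" by (intro mult_left_mono PA) auto
      finally show ?thesis using A by (simp add: ennreal_mult)
    qed
    define D where "D j \<eta> = conv X\<^sub>r (P j) \<eta> - fourier (P j) 0 * X\<^sub>r \<eta>" for j \<eta>
    have Dm: "D j \<in> borel_measurable borel" for j
      unfolding D_def by (intro borel_measurable_diff conv_measurable borel_measurable_times borel_measurable_const Xrm Pm)
    have Dw: "wnorm (D j) \<le> ennreal \<kappa>" for j
    proof (rule ennreal_power2_le_iff)
      have "(wnorm (D j))\<^sup>2 \<le> hsq s (P j) * (\<integral>\<^sup>+\<xi>. (trans_osc X (r *\<^sub>R \<xi>) * ennreal (weight (- s) \<xi>))\<^sup>2 \<partial>lborel)"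
        unfolding D_def X\<^sub>r_def
        by (rule localized_wnorm[OF Xm _ Pm Pi r]) (use schwartz_integrable[OF Xr] in \<open>simp add: X\<^sub>r_def\<close>)
      also have "\<dots> \<le> ennreal A * (\<integral>\<^sup>+\<xi>. (trans_osc X (r *\<^sub>R \<xi>) * ennreal (weight (- s) \<xi>))\<^sup>2 \<partial>lborel)"
        by (intro mult_right_mono PA) auto
      also have "\<dots> \<le> ennreal (\<kappa>\<^sup>2)" using N unfolding r_def by (rule less_imp_le)
      also have "\<dots> = (ennreal \<kappa>)\<^sup>2" using \<kappa>0 by (simp add: ennreal_power)
      finally show "(wnorm (D j))\<^sup>2 \<le> (ennreal \<kappa>)\<^sup>2" .
    qed
    have Dh: "hsq s (D j) \<le> ennreal A'" for j
    proof -
      let ?f = "\<lambda>\<xi>. of_real (weight s \<xi>) * conv X\<^sub>r (P j) \<xi>" and ?g = "\<lambda>\<xi>. - fourier (P j) 0 * (of_real (weight s \<xi>) * X\<^sub>r \<xi>)"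
      have fm: "?f \<in> borel_measurable borel" "(\<lambda>\<xi>. of_real (weight s \<xi>) * X\<^sub>r \<xi>) \<in> borel_measurable borel"
        using conv_measurable[OF Xrm Pm] Xrm by measurable
      have gm: "?g \<in> borel_measurable borel" by (intro borel_measurable_times borel_measurable_const fm)
      have "hsq s (D j) = nsq (\<lambda>\<xi>. ?f \<xi> + ?g \<xi>)"
        unfolding hsq_def D_def by (simp add: algebra_simps)
      also have "\<dots> \<le> 2 * nsq ?f + 2 * nsq ?g" by (rule nsq_add[OF fm(1) gm])
      also have "nsq ?f = hsq s (conv X\<^sub>r (P j))" by (simp add: hsq_def)
      also have "nsq ?g = ennreal ((norm (fourier (P j) 0))\<^sup>2) * hsq s X\<^sub>r"
        unfolding hsq_def by (subst nsq_cmult[OF fm(2)]) simp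
      also have "2 * hsq s (conv X\<^sub>r (P j)) + 2 * (ennreal ((norm (fourier (P j) 0))\<^sup>2) * hsq s X\<^sub>r)
          \<le> 2 * (ennreal (2 * 4 powr s) * (ennreal HX * ennreal (?m * A) + (ennreal WX)\<^sup>2 * ennreal A)) + 2 * (ennreal (?m * A) * ennreal HX)"
      proof (intro add_mono mult_left_mono mult_right_mono)
        have "hsq s (conv X\<^sub>r (P j)) \<le> ennreal (2 * 4 powr s) * (hsq s X\<^sub>r * (wnorm (P j))\<^sup>2 + (wnorm X\<^sub>r)\<^sup>2 * hsq s (P j))"
          by (rule hsq_conv[OF s0 Xrm Pm])
        also have "\<dots> \<le> ennreal (2 * 4 powr s) * (ennreal HX * ennreal (?m * A) + (ennreal WX)\<^sup>2 * ennreal A)"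
          unfolding HX(1) WX(1) by (intro mult_left_mono add_mono Pw PA) auto
        finally show "hsq s (conv X\<^sub>r (P j)) \<le> ennreal (2 * 4 powr s) * (ennreal HX * ennreal (?m * A) + (ennreal WX)\<^sup>2 * ennreal A)" .
        have "ennreal ((norm (fourier (P j) 0))\<^sup>2) \<le> (wnorm (P j))\<^sup>2"
          using power_mono[OF fourier_norm_le_wnorm[OF Pm, of j 0], of 2] by (simp add: ennreal_power)
        also have "\<dots> \<le> ennreal (?m * A)" by (rule Pw)
        finally have "ennreal ((norm (fourier (P j) 0))\<^sup>2) * hsq s X\<^sub>r \<le> ennreal (?m * A) * hsq s X\<^sub>r" by (rule mult_right_mono) simp
        then show "ennreal ((norm (fourier (P j) 0))\<^sup>2) * hsq s X\<^sub>r \<le> ennreal (?m * A) * ennreal HX" by (simp only: HX(1))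
      qed auto
      also have "\<dots> = ennreal A'"
        by (simp only: A'_def ennreal_mult ennreal_plus ennreal_power ennreal_numeral wmass_nonneg A HX(2) WX(2)
            mult_nonneg_nonneg zero_le_power add_nonneg_nonneg powr_ge_zero zero_le_numeral)
      finally show ?thesis .
    qed
    have aR: "cball a R \<subseteq> S" "\<And>x. x \<in> cball a R \<Longrightarrow> norm (\<Phi> x) \<le> M"
      using R(2) M aC by (auto simp: a_def)
    have "\<exists>Q. Q \<in> borel_measurable borel \<and> hsq s Q \<le> ennreal (4 * (M\<^sup>2 * B)) \<and>
        (\<forall>x. fourier Q x = fourier K x * \<Phi> (a + (\<chi> j. fourier (D j) x)))"
    proof (rule Taylor_density[OF s \<Phi> S aR(1) R(1) aR(2) Dm Km, where \<kappa> = \<kappa> and W = K1 and A = A' and \<rho> = \<rho>])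
      show "wnorm K \<le> ennreal K1" by (simp add: K1)
      show "hsq s K \<le> ennreal B" using HK B(2) by (simp add: ennreal_leI)
    qed (use Dw Dh K1 \<kappa>0 A' B \<kappa>1 \<kappa>2 \<kappa>3 \<rho> in auto)
    then obtain Q where Q: "Q \<in> borel_measurable borel" "hsq s Q \<le> ennreal (4 * (M\<^sup>2 * B))"
      "\<And>x. fourier Q x = k x * \<Phi> (a + (\<chi> j. fourier (D j) x))" unfolding Kf by blast
    have "fourier Q x = k x * \<Phi> (\<chi> j. fourier (P j) x)" for x
    proof (cases "k x = 0")
      case False
      then have 1: "\<chi>\<^sub>r x = 1" using ksupp \<chi>r1 by blast
      have "fourier (D j) x = fourier (P j) x - fourier (P j) 0" for j
      proof -
        have i1: "integrable lborel (conv X\<^sub>r (P j))"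
        proof (rule wnorm_integrable[OF conv_measurable[OF Xrm Pm]])
          have "wnorm (conv X\<^sub>r (P j)) \<le> wnorm X\<^sub>r * wnorm (P j)" by (rule wnorm_conv[OF Xrm Pm])
          also have "\<dots> < \<infinity>" using schwartz_wnorm[OF Xr] Pi[of j] by (simp add: ennreal_mult_less_top wnorm_def integrable_iff_bounded)
          finally show "wnorm (conv X\<^sub>r (P j)) < \<infinity>" .
        qed
        have i2: "integrable lborel (\<lambda>\<eta>. fourier (P j) 0 * X\<^sub>r \<eta>)" using schwartz_integrable[OF Xr] by simp
        have "fourier (D j) x = (LINT \<eta>|lborel. cis (- (\<eta> \<bullet> x)) * conv X\<^sub>r (P j) \<eta> - cis (- (\<eta> \<bullet> x)) * (fourier (P j) 0 * X\<^sub>r \<eta>))"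
          unfolding fourier_def[of "D j"] D_def by (simp only: right_diff_distrib)
        also have "\<dots> = fourier (conv X\<^sub>r (P j)) x - fourier (\<lambda>\<eta>. fourier (P j) 0 * X\<^sub>r \<eta>) x"
          unfolding fourier_def[of _ x] by (rule Bochner_Integration.integral_diff[OF fourier_integrable[OF i1] fourier_integrable[OF i2]])
        also have "\<dots> = fourier X\<^sub>r x * fourier (P j) x - fourier (P j) 0 * fourier X\<^sub>r x"
          by (simp only: fourier_conv[OF schwartz_integrable[OF Xr] Pi] fourier_cmult)
        finally show ?thesis by (simp add: Xrf 1)
      qed
      then have "a + (\<chi> j. fourier (D j) x) = (\<chi> j. fourier (P j) x)" by (simp add: a_def vec_eq_iff)
      then show ?thesis using Q(3) by simp
    qed (simp add: Q(3))
    with Q show "\<exists>Q. Q \<in> borel_measurable borel \<and> hsq s Q \<le> ennreal (4 * (M\<^sup>2 * B)) \<and>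
        (\<forall>x. fourier Q x = k x * \<Phi> (\<chi> j. fourier (P j) x))" by blast
  qed
qed

section \<open>Uniformly local Sobolev distributions as functions\<close>

lemma sobolev_density:
  fixes u :: "'n::finite functional"
  assumes s: "s > real CARD('n) / 2" and u: "u \<in> sobolev s" "sobolev_norm s u \<le> M"
  shows "\<exists>P. P \<in> borel_measurable borel \<and> hsq s P \<le> ennreal (Cn TYPE('n) * M\<^sup>2) \<and>
    (\<forall>\<phi>\<in>schwartz. u \<phi> = distr_of_fun (fourier P) \<phi>)"
proof -
  define g where "g = (SOME g. L2_density (bessel_distr s u) g)"
  have "\<exists>g. L2_density (bessel_distr s u) g" using u(1) unfolding sobolev_def by blast
  then have g: "L2_density (bessel_distr s u) g" unfolding g_def by (rule someI_ex)
  have "nsq g = ennreal ((L2_norm g)\<^sup>2)" using g by (simp add: L2_norm_sq L2_density_def)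
  also have "\<dots> \<le> ennreal (M\<^sup>2)"
  proof (intro ennreal_leI power_mono)
    show "L2_norm g \<le> M" using u(2) by (simp add: sobolev_norm_def g_def)
    show "0 \<le> L2_norm g" by (simp add: L2_norm_def integral_nonneg_AE)
  qed
  finally have "ennreal (Cn TYPE('n)) * nsq g \<le> ennreal (Cn TYPE('n) * M\<^sup>2)"
    by (simp add: ennreal_mult' Cn_def mult_left_mono)
  then show ?thesis using sobolev_imp_fourier_density[OF s g] order_trans by blast
qed

lemma linear_functional_zero:
  assumes "linear_functional_on V u" "(\<lambda>x. 0) \<in> V" shows "u (\<lambda>x. 0) = 0"
proof -
  have "\<forall>\<phi>\<in>V. \<forall>c. u (\<lambda>x. c * \<phi> x) = c * u \<phi>" using assms(1) unfolding linear_functional_on_def by blast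
  from this[rule_format, OF assms(2), of 0] show ?thesis by simp
qed

lemma linear_functional_add:
  assumes "linear_functional_on V u" "\<phi> \<in> V" "\<psi> \<in> V"
  shows "u (\<lambda>x. \<phi> x + \<psi> x) = u \<phi> + u \<psi>"
proof -
  have "\<forall>\<phi>\<in>V. \<forall>\<psi>\<in>V. u (\<lambda>x. \<phi> x + \<psi> x) = u \<phi> + u \<psi>" using assms(1) unfolding linear_functional_on_def by blast
  from this[rule_format, OF assms(2,3)] show ?thesis .
qed

lemma linear_functional_sum:
  assumes u: "linear_functional_on test_functions u" and F: "\<And>y. y \<in> Y \<Longrightarrow> F y \<in> test_functions" and Y: "finite Y"
  shows "u (\<lambda>x. \<Sum>y\<in>Y. F y x) = (\<Sum>y\<in>Y. u (F y))"
  using Y F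
proof (induction Y)
  case empty
  then show ?case using linear_functional_zero[OF u] by simp
next
  case (insert y Y)
  have "(\<lambda>x. \<Sum>y\<in>Y. F y x) \<in> test_functions" by (rule test_functions_sum) (use insert in auto)
  then have "u (\<lambda>x. F y x + (\<Sum>y\<in>Y. F y x)) = u (F y) + u (\<lambda>x. \<Sum>y\<in>Y. F y x)"
    by (intro linear_functional_add[OF u] insert.prems insertI1)
  then show ?case using insert by simp
qed

text \<open>A function \<open>U\<close> with \<open>U (\<tau>\<^sub>y h) = f y\<close> for all \<open>y\<close> represents the distribution, by a finite
  partition of unity made from the functions \<open>\<bar>\<tau>\<^sub>y h\<bar>\<^sup>2\<close>.\<close>

lemma glue_distribution:
  fixes u :: "'n::finite functional" and h U :: "real^'n \<Rightarrow> complex"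
  assumes u: "linear_functional_on test_functions u"
    and h: "h \<in> test_functions" "h 0 \<noteq> 0" and U: "continuous_on UNIV U"
    and loc: "\<And>y \<phi>. \<phi> \<in> test_functions \<Longrightarrow> u (\<lambda>x. translate y h x * \<phi> x) = distr_of_fun (\<lambda>x. U x * translate y h x) \<phi>"
    and \<phi>: "\<phi> \<in> test_functions"
  shows "u \<phi> = distr_of_fun U \<phi>"
proof -
  obtain R where R: "\<And>x. norm x > R \<Longrightarrow> \<phi> x = 0" using \<phi> by (auto simp: test_functions_iff)
  let ?N = "\<lambda>y. {x. translate y h x \<noteq> 0}"
  have th: "translate y h \<in> test_functions" for y by (rule test_functions_translate[OF h(1)])
  have "open (?N y)" for y
    by (intro open_Collect_neq smooth_continuous_on test_functions_smooth th continuous_on_const)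
  moreover have "cball 0 R \<subseteq> (\<Union>y\<in>cball 0 R. ?N y)"
  proof
    fix x assume "x \<in> cball (0::real^'n) R"
    moreover have "x \<in> ?N x" using h(2) by (simp add: translate_def)
    ultimately show "x \<in> (\<Union>y\<in>cball 0 R. ?N y)" by blast
  qed
  ultimately obtain Y where Y: "Y \<subseteq> cball 0 R" "finite Y" "cball 0 R \<subseteq> (\<Union>y\<in>Y. ?N y)"
    using compactE_image[OF compact_cball, of "cball 0 R" ?N 0 R] by metis
  define D where "D x = (\<Sum>y\<in>Y. translate y h x * cnj (translate y h x))" for x
  have D: "smooth D" unfolding D_def
    by (intro smooth_sum smooth_mult smooth_cnj test_functions_smooth th)
  have D0: "D x \<noteq> 0" if x: "x \<in> cball 0 R" for x
  proof -
    obtain y where y: "y \<in> Y" "translate y h x \<noteq> 0" using Y(3) x by blast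
    have "D x = of_real (\<Sum>y\<in>Y. (norm (translate y h x))\<^sup>2)"
      unfolding D_def of_real_sum by (simp only: complex_norm_square)
    moreover have "(\<Sum>y\<in>Y. (norm (translate y h x))\<^sup>2) > 0"
      by (rule sum_pos2[OF Y(2) y(1)]) (use y(2) in auto)
    ultimately show ?thesis by (metis less_irrefl of_real_eq_0_iff)
  qed
  define \<psi> where "\<psi> y x = (cnj (translate y h x) * \<phi> x) / D x" for y x
  have \<psi>: "\<psi> y \<in> test_functions" for y
    unfolding \<psi>_def
  proof (rule test_functions_divide[OF _ D closed_cball[of 0 R]])
    show "(\<lambda>x. cnj (translate y h x) * \<phi> x) \<in> test_functions"
      by (intro test_functions_mult' \<phi> smooth_cnj test_functions_smooth th)
    show "x \<in> cball 0 R" if "cnj (translate y h x) * \<phi> x \<noteq> 0" for x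
      using R[of x] that by (auto simp: not_less[symmetric])
  qed (rule D0)
  have split: "\<phi> x = (\<Sum>y\<in>Y. translate y h x * \<psi> y x)" for x
  proof (cases "x \<in> cball 0 R")
    case True
    have "(\<Sum>y\<in>Y. translate y h x * \<psi> y x) = (\<Sum>y\<in>Y. (translate y h x * cnj (translate y h x)) * (\<phi> x / D x))"
      by (simp add: \<psi>_def mult_ac)
    also have "\<dots> = D x * (\<phi> x / D x)" unfolding D_def by (rule sum_distrib_right[symmetric])
    finally show ?thesis using D0[OF True] by simp
  next
    case False
    then have "\<phi> x = 0" using R by (simp add: not_le)
    then show ?thesis by (simp add: \<psi>_def)
  qed
  have t: "(\<lambda>x. translate y h x * \<psi> y x) \<in> test_functions" for y
    by (intro test_functions_mult th test_functions_smooth \<psi>)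
  have "u \<phi> = u (\<lambda>x. \<Sum>y\<in>Y. translate y h x * \<psi> y x)"
    using split by (metis (no_types, lifting) ext)
  also have "\<dots> = (\<Sum>y\<in>Y. u (\<lambda>x. translate y h x * \<psi> y x))"
    by (rule linear_functional_sum[OF u t Y(2)])
  also have "\<dots> = (\<Sum>y\<in>Y. LINT x|lborel. U x * (translate y h x * \<psi> y x))"
    by (simp add: loc[OF \<psi>] distr_of_fun_def mult.assoc)
  also have "\<dots> = (LINT x|lborel. (\<Sum>y\<in>Y. U x * (translate y h x * \<psi> y x)))"
    by (rule Bochner_Integration.integral_sum[symmetric]) (rule continuous_test_integrable[OF U t])
  also have "\<dots> = distr_of_fun U \<phi>"
    unfolding distr_of_fun_def by (simp only: split sum_distrib_left)
  finally show ?thesis .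
qed

lemma translate_translate: "translate y (translate z h) = translate (y + z) h"
  by (simp add: translate_def fun_eq_iff diff_diff_eq)

text \<open>Translating the window makes it nonzero at the origin, so that its translate by \<open>y\<close> is a
  window around \<open>y\<close>.\<close>

lemma sobolev_ul_window:
  fixes u :: "'n::finite functional"
  assumes "u \<in> sobolev_ul s"
  shows "\<exists>h M. h \<in> test_functions \<and> h 0 \<noteq> 0 \<and>
    (\<forall>y. mult_distr (translate y h) u \<in> sobolev s \<and> sobolev_norm s (mult_distr (translate y h) u) \<le> M)"
proof -
  obtain h where h: "h \<in> test_functions" "h \<noteq> (\<lambda>x. 0)" "\<And>y. mult_distr (translate y h) u \<in> sobolev s"
    "bdd_above (range (\<lambda>y. sobolev_norm s (mult_distr (translate y h) u)))"
    using assms unfolding sobolev_ul_def by blast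
  obtain x0 where x0: "h x0 \<noteq> 0" using h(2) by blast
  obtain M where M: "\<And>y. sobolev_norm s (mult_distr (translate y h) u) \<le> M"
    using h(4) by (auto simp: bdd_above_def)
  show ?thesis
  proof (intro exI[of _ "translate (- x0) h"] exI[of _ M] conjI allI)
    show "translate (- x0) h \<in> test_functions" by (rule test_functions_translate[OF h(1)])
    show "translate (- x0) h 0 \<noteq> 0" using x0 by (simp add: translate_def)
  qed (simp_all add: translate_translate h(3) M)
qed

text \<open>The passage from the definition of \<open>\<H>\<^sup>s\<^sub>u\<^sub>l\<close> to functions: near every point, with uniform
  radius and uniform bound, the continuous representative coincides with a function in \<open>\<H>\<^sup>s\<close>. The
  windows \<open>(\<tau>\<^sub>y h) u\<close> are continuous functions \<open>f y\<close>; dividing by \<open>\<tau>\<^sub>y h\<close> near \<open>y\<close> gives functions that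
  agree on overlaps, since \<open>f y (\<tau>\<^sub>z h)\<close> and \<open>f z (\<tau>\<^sub>y h)\<close> define the same distribution.\<close>

lemma sobolev_ul_local_density:
  fixes u :: "'n::finite functional"
  assumes s: "s > real CARD('n) / 2" and u: "u \<in> sobolev_ul s"
  shows "continuous_on UNIV (cont_rep u) \<and> (\<exists>\<delta>>0. \<exists>A\<ge>0. \<forall>y. \<exists>P. P \<in> borel_measurable borel \<and>
     hsq s P \<le> ennreal A \<and> (\<forall>x. norm x < \<delta> \<longrightarrow> cont_rep u (y + x) = fourier P x))"
proof -
  have s0: "s \<ge> 0" by (rule half_dim_nonneg[OF s])
  obtain h M where h: "h \<in> test_functions" "h 0 \<noteq> 0"
    and hM: "\<And>y. mult_distr (translate y h) u \<in> sobolev s" "\<And>y. sobolev_norm s (mult_distr (translate y h) u) \<le> M"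
    using sobolev_ul_window[OF u] by blast
  have hnz: "h \<noteq> (\<lambda>x. 0)" using h(2) by auto
  let ?A = "Cn TYPE('n) * M\<^sup>2"
  have A0: "?A \<ge> 0" by (simp add: Cn_def)
  have "\<forall>y. \<exists>P. P \<in> borel_measurable borel \<and> hsq s P \<le> ennreal ?A \<and>
     (\<forall>\<phi>\<in>schwartz. mult_distr (translate y h) u \<phi> = distr_of_fun (fourier P) \<phi>)"
    using sobolev_density[OF s hM] by blast
  then obtain P where P: "\<And>y. P y \<in> borel_measurable borel" "\<And>y. hsq s (P y) \<le> ennreal ?A"
     "\<And>y \<phi>. \<phi> \<in> schwartz \<Longrightarrow> mult_distr (translate y h) u \<phi> = distr_of_fun (fourier (P y)) \<phi>" by metis
  have Pi: "integrable lborel (P y)" for y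
    by (rule hsq_integrable[OF s P(1) le_less_trans[OF P(2)]]) simp
  define f where "f y = fourier (P y)" for y
  have f: "continuous_on UNIV (f y)" for y unfolding f_def by (rule fourier_continuous[OF Pi])
  have fu: "u (\<lambda>x. translate y h x * \<phi> x) = distr_of_fun (f y) \<phi>" if "\<phi> \<in> test_functions" for y \<phi>
    using P(3)[OF test_functions_schwartz[OF that], of y] by (simp add: mult_distr_def f_def)
  have th: "translate y h \<in> test_functions" for y by (rule test_functions_translate[OF h(1)])
  have cons: "f y x * translate z h x = f z x * translate y h x" for y z x
  proof -
    have c: "continuous_on UNIV (\<lambda>x. f y x * translate z h x)" for y z
      by (intro continuous_intros f smooth_continuous_on test_functions_smooth th)
    have "(\<lambda>x. f y x * translate z h x) = (\<lambda>x. f z x * translate y h x)"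
    proof (rule continuous_distr_unique[OF h(1) hnz c c])
      fix \<phi> :: "real^'n \<Rightarrow> complex" assume \<phi>: "\<phi> \<in> test_functions"
      have *: "distr_of_fun (\<lambda>x. f y x * translate z h x) \<phi> = u (\<lambda>x. translate y h x * (translate z h x * \<phi> x))" for y z
        using fu[of "\<lambda>x. translate z h x * \<phi> x" y] \<phi> th
        by (simp add: distr_of_fun_def mult.assoc test_functions_mult' test_functions_smooth)
      show "distr_of_fun (\<lambda>x. f y x * translate z h x) \<phi> = distr_of_fun (\<lambda>x. f z x * translate y h x) \<phi>"
        unfolding * by (simp only: mult.left_commute)
    qed
    then show ?thesis by (rule fun_cong)
  qed
  \<comment> \<open>The quotient of \<open>f y\<close> by \<open>\<tau>\<^sub>y h\<close> at \<open>x\<close> is independent of \<open>y\<close>; at \<open>y = x\<close> the divisor is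
    \<open>h 0\<close>, which is nonzero.\<close>
  define U where "U x = f x x / h 0" for x
  have Uh: "U x * translate y h x = f y x" for x y
    using cons[of x x y] h(2) by (simp add: U_def translate_def field_simps)
  have U: "continuous_on UNIV U"
  proof -
    have "continuous (at z) U" for z
    proof -
      let ?N = "{x. translate z h x \<noteq> 0}"
      have o: "open ?N"
        by (intro open_Collect_neq smooth_continuous_on test_functions_smooth th continuous_on_const)
      have "continuous_on ?N (\<lambda>x. f z x / translate z h x)"
        by (intro continuous_on_divide continuous_on_subset[OF f] smooth_continuous_on test_functions_smooth th) auto
      then have "continuous_on ?N U"
        by (rule continuous_on_eq) (use Uh[of _ z] in \<open>auto simp: field_simps\<close>)
      moreover have "z \<in> ?N" using h(2) by (simp add: translate_def)
      ultimately show ?thesis using o by (simp add: continuous_on_eq_continuous_at)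
    qed
    then show ?thesis by (simp add: continuous_at_imp_continuous_on)
  qed
  have Uu: "u \<phi> = distr_of_fun U \<phi>" if "\<phi> \<in> test_functions" for \<phi>
  proof (rule glue_distribution[OF _ h U _ that])
    show "linear_functional_on test_functions u" using u by (simp add: sobolev_ul_def distribution_def)
    show "u (\<lambda>x. translate y h x * \<phi> x) = distr_of_fun (\<lambda>x. U x * translate y h x) \<phi>" if "\<phi> \<in> test_functions" for y \<phi>
      using fu[OF that] by (simp only: Uh)
  qed
  have rep: "cont_rep u = U"
    unfolding cont_rep_def
  proof (rule the_equality)
    show "continuous_on UNIV U \<and> (\<forall>\<phi>\<in>test_functions. u \<phi> = distr_of_fun U \<phi>)" using U Uu by blast
    fix V assume V: "continuous_on UNIV V \<and> (\<forall>\<phi>\<in>test_functions. u \<phi> = distr_of_fun V \<phi>)"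
    then have "distr_of_fun V \<phi> = distr_of_fun U \<phi>" if "\<phi> \<in> test_functions" for \<phi>
      using Uu[OF that] that by metis
    then show "V = U" using V U by (intro continuous_distr_unique[OF h(1) hnz]) auto
  qed
  have hc: "continuous (at 0) h"
    using smooth_continuous_on[OF test_functions_smooth[OF h(1)], of UNIV] by (simp add: continuous_on_eq_continuous_at)
  obtain e where e: "e > 0" "\<And>x. norm x < e \<Longrightarrow> h x \<noteq> 0"
    using continuous_at_avoid[OF hc, of 0] h(2) by (auto simp: dist_norm)
  \<comment> \<open>The cutoff \<open>\<theta>\<close> is supported in the ball of radius \<open>2 \<delta>\<close>, on which \<open>h\<close> has no zeros; so the
    window is undone near the origin by the test function \<open>\<theta> / h\<close>.\<close>
  define \<delta> where "\<delta> = e / 4"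
  have \<delta>: "\<delta> > 0" using e by (simp add: \<delta>_def)
  obtain \<theta> :: "real^'n \<Rightarrow> complex" where \<theta>: "\<theta> \<in> test_functions" "\<forall>x\<in>cball 0 \<delta>. \<theta> x = 1" "\<forall>x. norm (\<theta> x) \<le> 1"
    "\<forall>x. \<theta> x \<noteq> 0 \<longrightarrow> (\<exists>b\<in>cball 0 \<delta>. dist x b \<le> \<delta>)"
    using ex_cutoff[OF h(1) hnz \<delta> compact_cball, of 0 \<delta>] by blast
  have q: "(\<lambda>x. \<theta> x / h x) \<in> test_functions"
  proof (rule test_functions_divide[OF \<theta>(1) test_functions_smooth[OF h(1)] closed_cball[of 0 "2 * \<delta>"]])
    show "x \<in> cball 0 (2 * \<delta>)" if x: "\<theta> x \<noteq> 0" for x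
    proof -
      obtain b where "norm b \<le> \<delta>" "norm (x - b) \<le> \<delta>" using \<theta>(4)[rule_format, OF x] by (auto simp: dist_norm)
      then show ?thesis using norm_triangle_ineq[of b "x - b"] by simp
    qed
    show "h x \<noteq> 0" if "x \<in> cball 0 (2 * \<delta>)" for x using that e by (intro e(2)) (auto simp: \<delta>_def)
  qed
  define T where "T = inv_fourier (\<lambda>x. \<theta> x / h x)"
  have T: "T \<in> schwartz" unfolding T_def by (intro inv_fourier_schwartz test_functions_schwartz q)
  have Tf: "fourier T = (\<lambda>x. \<theta> x / h x)" unfolding T_def by (intro fourier_inv_fourier test_functions_schwartz q)
  have Tm: "T \<in> borel_measurable borel" by (rule schwartz_measurable[OF T])
  obtain HT where HT: "hsq s T = ennreal HT" "HT \<ge> 0" using schwartz_hsq[OF T, of s] by (cases "hsq s T") auto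
  obtain WT where WT: "wnorm T = ennreal WT" "WT \<ge> 0" using schwartz_wnorm[OF T] by (cases "wnorm T") auto
  let ?m = "wmass s TYPE('n)"
  define A where "A = 2 * 4 powr s * (HT * (?m * ?A) + WT\<^sup>2 * ?A)"
  have "\<exists>Q. Q \<in> borel_measurable borel \<and> hsq s Q \<le> ennreal A \<and> (\<forall>x. norm x < \<delta> \<longrightarrow> U (y + x) = fourier Q x)" for y
  proof -
    define P' where "P' \<xi> = cis (- (\<xi> \<bullet> y)) * P y \<xi>" for \<xi>
    have P'm: "P' \<in> borel_measurable borel" unfolding P'_def using P(1)[of y] by measurable
    have P'i: "integrable lborel P'" unfolding P'_def by (rule fourier_integrable[OF Pi])
    have hP': "hsq s P' \<le> ennreal ?A"
      using P(2)[of y] hsq_mono_norm[of P' "P y"] by (simp add: P'_def norm_mult)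
    have wP': "(wnorm P')\<^sup>2 \<le> ennreal (?m * ?A)"
    proof -
      have "(wnorm P')\<^sup>2 \<le> ennreal ?m * hsq s P'" by (rule wnorm_le_hsq[OF s P'm])
      also have "\<dots> \<le> ennreal ?m * ennreal ?A" by (intro mult_left_mono hP') auto
      finally show ?thesis using A0 by (simp add: ennreal_mult)
    qed
    show ?thesis
    proof (intro exI[of _ "conv T P'"] conjI allI impI)
      show "conv T P' \<in> borel_measurable borel" by (rule conv_measurable[OF Tm P'm])
      have "hsq s (conv T P') \<le> ennreal (2 * 4 powr s) * (hsq s T * (wnorm P')\<^sup>2 + (wnorm T)\<^sup>2 * hsq s P')"
        by (rule hsq_conv[OF s0 Tm P'm])
      also have "\<dots> \<le> ennreal (2 * 4 powr s) * (ennreal HT * ennreal (?m * ?A) + (ennreal WT)\<^sup>2 * ennreal ?A)"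
        unfolding HT(1) WT(1) by (intro mult_left_mono add_mono wP' hP') auto
      also have "\<dots> = ennreal A"
        unfolding A_def using A0 HT(2) WT(2) by (simp only: ennreal_mult ennreal_plus ennreal_power wmass_nonneg mult_nonneg_nonneg zero_le_power add_nonneg_nonneg powr_ge_zero zero_le_numeral)
      finally show "hsq s (conv T P') \<le> ennreal A" .
      fix x :: "real^'n" assume x: "norm x < \<delta>"
      have "fourier (conv T P') x = fourier T x * fourier P' x"
        by (rule fourier_conv[OF schwartz_integrable[OF T] P'i])
      also have "fourier P' x = f y (x + y)" unfolding P'_def [abs_def] f_def by (rule fourier_modulate)
      also have "\<dots> = U (x + y) * h x" using Uh[of "x + y" y] by (simp add: translate_def)
      also have "fourier T x = 1 / h x" using \<theta>(2) x by (simp add: Tf)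
      finally show "U (y + x) = fourier (conv T P') x"
        using e(2)[of x] x \<delta> by (simp add: \<delta>_def add.commute)
    qed
  qed
  moreover have "A \<ge> 0" unfolding A_def using A0 HT(2) WT(2) by (intro mult_nonneg_nonneg add_nonneg_nonneg) (auto simp: Cn_def)
  ultimately show ?thesis using U \<delta> unfolding rep by blast
qed

lemma bounded_test_integral_bound:
  fixes V k :: "real^'n::finite \<Rightarrow> complex"
  assumes k: "integrable lborel k" and V [measurable]: "V \<in> borel_measurable borel" "\<And>x. norm (V x) \<le> b"
    and \<phi> [measurable]: "\<phi> \<in> borel_measurable borel" "\<And>x. norm (\<phi> x) \<le> S"
  shows "integrable lborel (\<lambda>x. V x * (k x * \<phi> x))"
    "norm (LINT x|lborel. V x * (k x * \<phi> x)) \<le> (b * (LINT x|lborel. norm (k x))) * S"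
proof -
  have [measurable]: "k \<in> borel_measurable borel" using k by auto
  have b: "b \<ge> 0" and S: "S \<ge> 0" using order_trans[OF norm_ge_zero V(2)[of 0]] order_trans[OF norm_ge_zero \<phi>(2)[of 0]] by auto
  have le: "norm (V x * (k x * \<phi> x)) \<le> b * norm (k x) * S" for x
    unfolding norm_mult mult.assoc[symmetric] using b by (intro mult_mono V \<phi>) auto
  have i: "integrable lborel (\<lambda>x. b * norm (k x) * S)" using k by simp
  show 1: "integrable lborel (\<lambda>x. V x * (k x * \<phi> x))"
    by (rule Bochner_Integration.integrable_bound[OF i]) (use le in \<open>auto intro: order_trans[OF _ abs_ge_self]\<close>)
  have "norm (LINT x|lborel. V x * (k x * \<phi> x)) \<le> (LINT x|lborel. b * norm (k x) * S)"
    by (rule Bochner_Integration.integral_norm_bound_integral[OF 1 i le])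
  then show "norm (LINT x|lborel. V x * (k x * \<phi> x)) \<le> (b * (LINT x|lborel. norm (k x))) * S" by simp
qed

lemma bounded_distribution:
  fixes V :: "real^'n::finite \<Rightarrow> complex"
  assumes V: "continuous_on UNIV V" and b: "\<And>x. norm (V x) \<le> b"
  shows "distribution (distr_of_fun V)"
  unfolding distribution_def
proof (intro conjI allI impI)
  have Vm: "V \<in> borel_measurable borel" by (rule borel_measurable_continuous_onI[OF V])
  show "linear_functional_on test_functions (distr_of_fun V)"
    unfolding linear_functional_on_def distr_of_fun_def
  proof (intro conjI ballI allI)
    fix \<phi> \<psi> :: "real^'n \<Rightarrow> complex" and c :: complex
    assume \<phi>: "\<phi> \<in> test_functions"
    show "(LINT x|lborel. V x * (c * \<phi> x)) = c * (LINT x|lborel. V x * \<phi> x)"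
      by (simp only: mult.left_commute[of _ c] integral_mult_right_zero)
    assume \<psi>: "\<psi> \<in> test_functions"
    show "(LINT x|lborel. V x * (\<phi> x + \<psi> x)) = (LINT x|lborel. V x * \<phi> x) + (LINT x|lborel. V x * \<psi> x)"
      by (simp only: distrib_left Bochner_Integration.integral_add[OF continuous_test_integrable[OF V \<phi>] continuous_test_integrable[OF V \<psi>]])
  qed
  fix K :: "(real^'n) set" assume K: "compact K"
  have iK: "integrable lborel (indicator K :: real^'n \<Rightarrow> complex)"
  proof -
    have "integrable lborel (indicator K :: real^'n \<Rightarrow> real)"
      using emeasure_compact_finite[OF K] K by (intro integrable_real_indicator) (auto intro: borel_compact)
    then have "integrable lborel (\<lambda>x. complex_of_real (indicator K x))" by (rule integrable_of_real)
    moreover have "(indicator K :: real^'n \<Rightarrow> complex) = (\<lambda>x. complex_of_real (indicator K x))"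
      by (auto simp: indicator_def)
    ultimately show ?thesis by simp
  qed
  show "\<exists>C N. \<forall>\<phi>\<in>test_functions. {x. \<phi> x \<noteq> 0} \<subseteq> K \<longrightarrow>
     norm (distr_of_fun V \<phi>) \<le> C * (\<Sum>is | length is \<le> N. SUP x. norm (partials is \<phi> x))"
  proof (intro exI[of _ "b * (LINT x|lborel. norm (indicator K x :: complex))"] exI[of _ 0] ballI impI)
    fix \<phi> :: "real^'n \<Rightarrow> complex" assume \<phi>: "\<phi> \<in> test_functions" and sub: "{x. \<phi> x \<noteq> 0} \<subseteq> K"
    obtain S0 where S0: "\<And>x. norm (\<phi> x) \<le> S0" using test_functions_bounded[OF \<phi>] by blast
    have "norm (\<phi> x) \<le> (SUP x. norm (\<phi> x))" for x
      by (rule cSUP_upper) (use S0 in \<open>auto simp: bdd_above_def\<close>)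
    from bounded_test_integral_bound(2)[OF iK Vm b smooth_measurable[OF test_functions_smooth[OF \<phi>]] this]
    have "norm (LINT x|lborel. V x * (indicator K x * \<phi> x)) \<le> b * (LINT x|lborel. norm (indicator K x :: complex)) * (SUP x. norm (\<phi> x))" .
    moreover have "(\<lambda>x. V x * (indicator K x * \<phi> x)) = (\<lambda>x. V x * \<phi> x)"
      using sub by (auto simp: indicator_def fun_eq_iff)
    moreover have "{is :: 'n list. length is \<le> 0} = {[]}" by auto
    ultimately show "norm (distr_of_fun V \<phi>) \<le> b * (LINT x|lborel. norm (indicator K x :: complex)) * (\<Sum>is | length is \<le> 0. SUP x. norm (partials is \<phi> x))"
      by (simp add: distr_of_fun_def)
  qed
qed

lemma bounded_tempered_distribution:
  fixes V k :: "real^'n::finite \<Rightarrow> complex"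
  assumes V: "V \<in> borel_measurable borel" "\<And>x. norm (V x) \<le> b" and k: "integrable lborel k"
  shows "tempered_distribution (mult_distr k (distr_of_fun V))"
  unfolding tempered_distribution_def
proof (intro conjI)
  have bnd: "\<exists>S. \<forall>x. norm (\<phi> x) \<le> S" if \<phi>: "\<phi> \<in> schwartz" for \<phi> :: "real^'n \<Rightarrow> complex"
  proof -
    obtain S where "\<And>x::real^'n. (1 + norm x) ^ 0 * norm (\<phi> x) \<le> S" using rapidE[OF schwartz_rapid[OF \<phi>]] by blast
    then show ?thesis by auto
  qed
  have int: "integrable lborel (\<lambda>x. V x * (k x * \<phi> x))" if "\<phi> \<in> schwartz" for \<phi>
    using bnd[OF that] bounded_test_integral_bound(1)[OF k V schwartz_measurable[OF that]] by blast
  show "linear_functional_on schwartz (mult_distr k (distr_of_fun V))"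
    unfolding linear_functional_on_def
  proof (intro conjI ballI allI)
    fix \<phi> \<psi> :: "real^'n \<Rightarrow> complex" and c :: complex
    assume \<phi>: "\<phi> \<in> schwartz"
    show "mult_distr k (distr_of_fun V) (\<lambda>x. c * \<phi> x) = c * mult_distr k (distr_of_fun V) \<phi>"
      unfolding mult_distr_def distr_of_fun_def
      by (simp only: mult.left_commute[of _ c] integral_mult_right_zero)
    assume \<psi>: "\<psi> \<in> schwartz"
    show "mult_distr k (distr_of_fun V) (\<lambda>x. \<phi> x + \<psi> x) = mult_distr k (distr_of_fun V) \<phi> + mult_distr k (distr_of_fun V) \<psi>"
      unfolding mult_distr_def distr_of_fun_def
      by (simp only: distrib_left Bochner_Integration.integral_add[OF int[OF \<phi>] int[OF \<psi>]])
  qed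
  show "\<exists>C N. \<forall>\<phi>\<in>schwartz. norm (mult_distr k (distr_of_fun V) \<phi>) \<le> C * (\<Sum>is | length is \<le> N. SUP x. (1 + norm x) ^ N * norm (partials is \<phi> x))"
  proof (intro exI[of _ "b * (LINT x|lborel. norm (k x))"] exI[of _ 0] ballI)
    fix \<phi> :: "real^'n \<Rightarrow> complex" assume \<phi>: "\<phi> \<in> schwartz"
    have "norm (\<phi> x) \<le> (SUP x. norm (\<phi> x))" for x
      by (rule cSUP_upper) (use bnd[OF \<phi>] in \<open>auto simp: bdd_above_def\<close>)
    from bounded_test_integral_bound(2)[OF k V schwartz_measurable[OF \<phi>] this]
    have "norm (LINT x|lborel. V x * (k x * \<phi> x)) \<le> b * (LINT x|lborel. norm (k x)) * (SUP x. norm (\<phi> x))" .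
    moreover have "{is :: 'n list. length is \<le> 0} = {[]}" by auto
    ultimately show "norm (mult_distr k (distr_of_fun V) \<phi>) \<le> b * (LINT x|lborel. norm (k x)) * (\<Sum>is | length is \<le> 0. SUP x. (1 + norm x) ^ 0 * norm (partials is \<phi> x))"
      by (simp add: distr_of_fun_def mult_distr_def)
  qed
qed

text \<open>The converse passage from uniform local densities to the definition of \<open>\<H>\<^sup>s\<^sub>u\<^sub>l\<close>: a translation
  of a function multiplies its Fourier density by a factor of modulus \<open>1\<close>.\<close>

lemma local_density_imp_sobolev_ul:
  fixes V k :: "real^'n::finite \<Rightarrow> complex"
  assumes s: "s > real CARD('n) / 2"
    and k: "k \<in> test_functions" "k \<noteq> (\<lambda>x. 0)"
    and V: "continuous_on UNIV V" "\<And>x. norm (V x) \<le> b" and B: "B \<ge> 0"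
    and loc: "\<And>y. \<exists>Q. Q \<in> borel_measurable borel \<and> hsq s Q \<le> ennreal B \<and> (\<forall>x. fourier Q x = k x * V (y + x))"
  shows "distr_of_fun V \<in> sobolev_ul s"
proof -
  let ?u = "\<lambda>y. mult_distr (translate y k) (distr_of_fun V)"
  let ?c = "Cn TYPE('n)"
  have Vm: "V \<in> borel_measurable borel" by (rule borel_measurable_continuous_onI[OF V(1)])
  have main: "?u y \<in> sobolev s \<and> sobolev_norm s (?u y) \<le> sqrt (?c * B)" for y
  proof -
    obtain Q where Q: "Q \<in> borel_measurable borel" "hsq s Q \<le> ennreal B" "\<And>x. fourier Q x = k x * V (y + x)"
      using loc by blast
    define Q' where "Q' \<xi> = cis (- (\<xi> \<bullet> - y)) * Q \<xi>" for \<xi>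
    have Q'm: "Q' \<in> borel_measurable borel" unfolding Q'_def using Q(1) by measurable
    have Q'h: "hsq s Q' \<le> ennreal B"
      using Q(2) hsq_mono_norm[of Q' Q] by (simp add: Q'_def norm_mult)
    have Q'f: "fourier Q' x = translate y k x * V x" for x
      unfolding Q'_def [abs_def] fourier_modulate Q(3) by (simp add: translate_def)
    have u: "?u y \<phi> = distr_of_fun (fourier Q') \<phi>" for \<phi>
      unfolding mult_distr_def distr_of_fun_def Q'f by (simp only: mult_ac)
    have fin: "hsq s Q' < \<infinity>" using Q'h by (rule le_less_trans) simp
    have ex: "\<exists>g. L2_density (bessel_distr s (?u y)) g \<and> nsq g \<le> ennreal ?c * hsq s Q'"
      by (rule fourier_density_imp_sobolev[OF s Q'm fin u])
    then obtain g where g: "L2_density (bessel_distr s (?u y)) g" "nsq g \<le> ennreal ?c * hsq s Q'" by blast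
    have temp: "tempered_distribution (?u y)"
      by (rule bounded_tempered_distribution[OF Vm V(2) test_functions_integrable[OF test_functions_translate[OF k(1)]]])
    define g' where "g' = (SOME g. L2_density (bessel_distr s (?u y)) g)"
    have g': "L2_density (bessel_distr s (?u y)) g'" unfolding g'_def by (rule someI[of "L2_density (bessel_distr s (?u y))", OF g(1)])
    have "ennreal ((L2_norm g')\<^sup>2) = nsq g'" using g' by (simp add: L2_norm_sq L2_density_def)
    also have "\<dots> = nsq g" by (rule L2_density_norm_unique[OF k g' g(1)])
    also have "\<dots> \<le> ennreal ?c * ennreal B" using g(2) mult_left_mono[OF Q'h, of "ennreal ?c"] by (simp add: order_trans)
    also have "\<dots> = ennreal (?c * B)" using B by (simp add: ennreal_mult Cn_def)
    finally have "(L2_norm g')\<^sup>2 \<le> ?c * B" using B by (simp add: Cn_def)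
    then have "L2_norm g' \<le> sqrt (?c * B)" by (rule real_le_rsqrt)
    then have "sobolev_norm s (?u y) \<le> sqrt (?c * B)" by (simp add: sobolev_norm_def g'_def)
    with temp g(1) show ?thesis by (auto simp: sobolev_def)
  qed
  then have "bdd_above (range (\<lambda>y. sobolev_norm s (?u y)))"
    by (intro bdd_aboveI[of _ "sqrt (?c * B)"]) auto
  then show ?thesis
    unfolding sobolev_ul_def using bounded_distribution[OF V] k main by blast
qed

section \<open>Composition with holomorphic functions\<close>

theorem theorem4p10:
  fixes s :: real
    and \<Omega> :: "(complex^'d::finite) set"
    and \<Phi> :: "complex^'d \<Rightarrow> complex"
    and u :: "'d \<Rightarrow> 'n::finite functional"
  assumes "s > max (real CARD('n) / 2) (3 / 4)"
    and "open \<Omega>"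
    and "holomorphic_several \<Phi> \<Omega>"
    and "\<And>j. u j \<in> sobolev_ul s"
    and "closure (range (\<lambda>x. \<chi> j. cont_rep (u j) x)) \<subseteq> \<Omega>"
  shows "distr_of_fun (\<lambda>x. \<Phi> (\<chi> j. cont_rep (u j) x)) \<in> sobolev_ul s"
proof -
  have s: "s > real CARD('n) / 2" using assms(1) by simp
  let ?U = "\<lambda>x. \<chi> j. cont_rep (u j) x"
  let ?C = "closure (range ?U)"
  have cU: "continuous_on UNIV (cont_rep (u j))" for j
    using sobolev_ul_local_density[OF s assms(4)] by blast
  have "\<forall>j. \<exists>\<delta> A. \<delta> > 0 \<and> A \<ge> 0 \<and> (\<forall>y. \<exists>P. P \<in> borel_measurable borel \<and>
     hsq s P \<le> ennreal A \<and> (\<forall>x. norm x < \<delta> \<longrightarrow> cont_rep (u j) (y + x) = fourier P x))"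
    using sobolev_ul_local_density[OF s assms(4)] by blast
  then obtain \<delta>' A' where \<delta>': "\<And>j. \<delta>' j > 0" and A': "\<And>j. A' j \<ge> 0" and
    loc: "\<And>j y. \<exists>P. P \<in> borel_measurable borel \<and> hsq s P \<le> ennreal (A' j) \<and>
      (\<forall>x. norm x < \<delta>' j \<longrightarrow> cont_rep (u j) (y + x) = fourier P x)" by metis
  define \<delta> where "\<delta> = Min (range \<delta>')"
  have \<delta>: "\<delta> > 0" "\<And>j. \<delta> \<le> \<delta>' j" using \<delta>' by (auto simp: \<delta>_def)
  define A where "A = (\<Sum>j\<in>UNIV. A' j)"
  have A: "A \<ge> 0" "\<And>j. A' j \<le> A" unfolding A_def using A' by (auto intro: sum_nonneg member_le_sum)
  define dens_at where "dens_at y j P \<longleftrightarrow> P \<in> borel_measurable borel \<and> hsq s P \<le> ennreal A \<and>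
      (\<forall>x. norm x < \<delta> \<longrightarrow> cont_rep (u j) (y + x) = fourier P x)" for y j P
  have "\<exists>P. dens_at y j P" for j y
  proof -
    obtain P where P: "P \<in> borel_measurable borel" "hsq s P \<le> ennreal (A' j)"
      "\<And>x. norm x < \<delta>' j \<Longrightarrow> cont_rep (u j) (y + x) = fourier P x" using loc by blast
    have "hsq s P \<le> ennreal A" using P(2) A(2)[of j] by (meson ennreal_leI order_trans)
    moreover have "cont_rep (u j) (y + x) = fourier P x" if "norm x < \<delta>" for x
      using P(3) that \<delta>(2)[of j] by simp
    ultimately show ?thesis using P(1) unfolding dens_at_def by blast
  qed
  then have dens_some: "dens_at y j (SOME P. dens_at y j P)" for y j by (rule someI_ex)
  define P where "P y j = (SOME P. dens_at y j P)" for y j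
  have "dens_at y j (P y j)" for y j unfolding P_def by (rule dens_some)
  then have P: "\<And>j y. P y j \<in> borel_measurable borel" "\<And>j y. hsq s (P y j) \<le> ennreal A"
    "\<And>j y x. norm x < \<delta> \<Longrightarrow> cont_rep (u j) (y + x) = fourier (P y j) x" unfolding dens_at_def by blast+
  have at0: "(\<chi> j. fourier (P y j) 0) = ?U y" for y
    using P(3)[of 0 _ y] \<delta>(1) by (simp add: vec_eq_iff)
  \<comment> \<open>By the embedding into the Wiener algebra the functions are bounded, so the closure of the
    joint range is compact.\<close>
  have "norm (?U y) \<le> (\<Sum>j\<in>(UNIV::'d set). sqrt (wmass s TYPE('n) * A))" for y
  proof (rule order_trans[OF norm_vec_le_sum], rule sum_mono)
    fix j
    have "(ennreal (norm (fourier (P y j) 0)))\<^sup>2 \<le> (wnorm (P y j))\<^sup>2"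
      by (intro power_mono fourier_norm_le_wnorm P) auto
    also have "\<dots> \<le> ennreal (wmass s TYPE('n)) * hsq s (P y j)" by (rule wnorm_le_hsq[OF s P(1)])
    also have "\<dots> \<le> ennreal (wmass s TYPE('n)) * ennreal A" by (intro mult_left_mono P) auto
    finally have "(norm (fourier (P y j) 0))\<^sup>2 \<le> wmass s TYPE('n) * A"
      using A by (simp add: ennreal_power flip: ennreal_mult)
    then have "norm (fourier (P y j) 0) \<le> sqrt (wmass s TYPE('n) * A)" by (rule real_le_rsqrt)
    then show "norm (?U y $ j) \<le> sqrt (wmass s TYPE('n) * A)" using P(3)[of 0 j y] \<delta>(1) by simp
  qed
  then have "bounded (range ?U)" unfolding bounded_iff by blast
  then have C: "compact ?C" by (simp add: compact_closure)
  obtain h :: "real^'n \<Rightarrow> complex" where h: "h \<in> test_functions" "h \<noteq> (\<lambda>x. 0)"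
    using assms(4) unfolding sobolev_ul_def by blast
  obtain k B where k: "k \<in> test_functions" "k \<noteq> (\<lambda>x. 0)" "\<And>x. k x \<noteq> 0 \<Longrightarrow> norm x < \<delta>"
    and comp: "\<And>P. (\<forall>j. P j \<in> borel_measurable borel \<and> hsq s (P j) \<le> ennreal A) \<and> (\<chi> j. fourier (P j) 0) \<in> ?C \<Longrightarrow>
      (\<exists>Q. Q \<in> borel_measurable borel \<and> hsq s Q \<le> ennreal B \<and>
        (\<forall>x::real^'n. fourier Q x = k x * \<Phi> (\<chi> j. fourier (P j) x)))"
    using local_composition[OF s h assms(3,2) C assms(5) A(1) \<delta>(1)] by blast
  have cV: "continuous_on UNIV (\<lambda>x. \<Phi> (?U x))"
  proof (rule continuous_on_compose2[OF several_continuous_on[OF assms(3)]])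
    show "continuous_on UNIV ?U" by (intro continuous_on_vec_lambda cU)
    show "range ?U \<subseteq> \<Omega>" using assms(5) closure_subset by blast
  qed
  have "bounded (\<Phi> ` ?C)"
    by (intro compact_imp_bounded compact_continuous_image C continuous_on_subset[OF several_continuous_on[OF assms(3)] assms(5)])
  then obtain b where "\<And>z. z \<in> ?C \<Longrightarrow> norm (\<Phi> z) \<le> b" unfolding bounded_iff by blast
  then have b: "norm (\<Phi> (?U x)) \<le> b" for x using closure_subset[of "range ?U"] by blast
  have "\<exists>Q. Q \<in> borel_measurable borel \<and> hsq s Q \<le> ennreal (max 0 B) \<and> (\<forall>x. fourier Q x = k x * \<Phi> (?U (y + x)))" for y
  proof -
    have "?U y \<in> ?C" using closure_subset[of "range ?U"] by blast
    then have "\<exists>Q. Q \<in> borel_measurable borel \<and> hsq s Q \<le> ennreal B \<and>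
        (\<forall>x::real^'n. fourier Q x = k x * \<Phi> (\<chi> j. fourier (P y j) x))"
      by (intro comp) (simp add: P at0)
    then obtain Q where Q: "Q \<in> borel_measurable borel" "hsq s Q \<le> ennreal B"
      "\<And>x. fourier Q x = k x * \<Phi> (\<chi> j. fourier (P y j) x)" by blast
    have "fourier Q x = k x * \<Phi> (?U (y + x))" for x
      using k(3)[of x] P(3)[of x _ y] by (cases "k x = 0") (simp_all add: Q(3))
    moreover have "hsq s Q \<le> ennreal (max 0 B)" 
      by (rule order_trans[OF Q(2) ennreal_leI]) simp
    ultimately show ?thesis using Q(1) by blast
  qed
  then show ?thesis
    by (intro local_density_imp_sobolev_ul[OF s k(1,2) cV b, of "max 0 B"]) auto
qed

end
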